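(* For every $s>0$: (i) for every integer $j\ge1$, $q_j(\infty,s)=p_j(\infty,s)$ holds if and only if $q_{j-1}(s)=q_j(s)$; (ii) for every integer $j\ge0$, $q_j(\infty,s)=p_{j+1}(\infty,s)$ holds if and only if $p_j(s)=p_{j+1}(s)$.
   Context: Let $\Pi$ be a homogeneous Poisson point process of unit intensity in the strip $S=[0,1]\times(-\infty,0]$. An atom $a=(x_a,y_a)$ of $\Pi$ is a record if no other atom of $S$ lies to its north-west (smaller horizontal and larger vertical coordinate); its box area is $(1-x_a)\,|y_a|$, the area of the part of $S$ north-east of $a$. Let $W$ be uniform on $[0,1]$ independent of $\Pi$ and $V$ the vertical line $\{x=W\}$. Define $p_j(\infty,s)$ as the probability that exactly $j$ records of $S$ have box area at most $s$, and $q_j(\infty,s)$ as the probability that exactly $j$ records of $S$ lying to the left of $V$ have box area at most $s$. Further, with $\sigma_1(k,j)$ the unsigned Stirling numbers of the first kind ($\sigma_1(k,j)=0$ for $k<j$, $\sigma_1(0,0)=1$), $p_j(t)=e^{-t}\sum_{k=j}^\infty \frac{t^k}{k!}\frac{\sigma_1(k,j)}{k!}$ and $q_j(t)=\frac1t\int_0^t p_j(u)\,du$. *)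

theory Defs
  imports "HOL-Probability.Probability" "HOL-Combinatorics.Stirling"
begin

text \<open>Explicit construction of a unit-intensity Poisson point process on the strip
  S = [0,1] x (-inf,0]: the strip is cut into the unit boxes
  B k = [0,1] x [-(k+1), -k]; box k receives N k ~ Poisson(1) atoms, namely the
  first N k of an i.i.d. sequence U k 0, U k 1, ... of uniform points of B k, all
  counts and points independent. W is an independent uniform variable on [0,1].\<close>

definition strip_box :: "nat \<Rightarrow> (real \<times> real) set" where
  "strip_box k = {0..1} \<times> {- (real k + 1) .. - real k}"

type_synonym outcome = "((nat \<Rightarrow> nat) \<times> (nat \<times> nat \<Rightarrow> real \<times> real)) \<times> real"

definition PPP_space :: "outcome measure" where
  "PPP_space =
     ((PiM UNIV (\<lambda>k::nat. measure_pmf (poisson_pmf 1)))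
        \<Otimes>\<^sub>M (PiM UNIV (\<lambda>ki::nat \<times> nat. uniform_measure lborel (strip_box (fst ki)))))
     \<Otimes>\<^sub>M uniform_measure lborel {0..1::real}"

definition atoms :: "outcome \<Rightarrow> (real \<times> real) set" where
  "atoms \<omega> = {snd (fst \<omega>) (k, i) | k i. i < fst (fst \<omega>) k}"

definition W_of :: "outcome \<Rightarrow> real" where
  "W_of \<omega> = snd \<omega>"

definition records :: "outcome \<Rightarrow> (real \<times> real) set" where
  "records \<omega> = {a \<in> atoms \<omega>. \<not> (\<exists>b \<in> atoms \<omega>. b \<noteq> a \<and> fst b < fst a \<and> snd b > snd a)}"

definition box_area :: "real \<times> real \<Rightarrow> real" where
  "box_area a = (1 - fst a) * \<bar>snd a\<bar>"

definition p_inf :: "nat \<Rightarrow> real \<Rightarrow> real" where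
  "p_inf j s = measure PPP_space
     {\<omega> \<in> space PPP_space. finite {a \<in> records \<omega>. box_area a \<le> s}
                           \<and> card {a \<in> records \<omega>. box_area a \<le> s} = j}"

definition q_inf :: "nat \<Rightarrow> real \<Rightarrow> real" where
  "q_inf j s = measure PPP_space
     {\<omega> \<in> space PPP_space. finite {a \<in> records \<omega>. fst a < W_of \<omega> \<and> box_area a \<le> s}
                           \<and> card {a \<in> records \<omega>. fst a < W_of \<omega> \<and> box_area a \<le> s} = j}"

definition p_fun :: "nat \<Rightarrow> real \<Rightarrow> real" where
  "p_fun j t = exp (- t) * (\<Sum>k. t ^ k / fact k * real (stirling k j) / fact k)"

definition q_fun :: "nat \<Rightarrow> real \<Rightarrow> real" where
  "q_fun j t = (1 / t) * integral {0..t} (p_fun j)"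

end

theory Submission
  imports Defs
begin

text \<open>Scan the strip from left to right and watch the box to the north-east of the best atom so far. Its
  area decreases continuously as time passes and jumps to a uniform fraction of itself at each new
  record, so it falls below \<open>s\<close> either continuously (with probability \<open>c\<close>), leaving a box of area
  \<open>s\<close>, or by a record whose box area is uniform on \<open>[0, s]\<close> (with probability \<open>A = 1 - c\<close>). Hence
  \<open>p_inf j s = A * q_fun (j - 1) s + c * p_fun j s\<close>. With the uniform line, the same decomposition and
  the differential equations between the functions \<open>p_fun\<close> and \<open>q_fun\<close> give
  \<open>q_inf j s = A * q_fun j s + c * p_fun j s\<close>, so that both equivalences are immediate from \<open>A, c > 0\<close>.

  The decomposition at the atom where the area falls below \<open>s\<close> is an application of the Mecke formula,
  which for the given construction of the process reduces to \<open>n * P(N = n) = P(N = n - 1)\<close> for a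
  Poisson variable of mean one. It also yields the void probabilities and, by splitting at the
  leftmost atom, the law of the number of records in a rectangle.\<close>

section \<open>The Mecke formula\<close>

text \<open>The scan has no first record: records accumulate at the left edge, where the box area is
  unbounded. Counting therefore has to start at the passage below \<open>s\<close>. The atom
  responsible for it is characterised without stopping times, as the unique \<open>a\<close> such
  that the remaining atoms satisfy a condition depending on \<open>a\<close>.

  Both constants stem from \<open>exp (- (x * s / (1 - x)))\<close>, the probability that the area
  has not passed below \<open>s\<close> by time \<open>x\<close>. Its integral is the mean passage
  time, which turns out to equal the probability \<open>c\<close> of a continuous passage; weighted
  with the length \<open>s / (1 - x)\<close> of the depths at which an atom triggers the passage, it
  gives \<open>A\<close>.

  In the average over the line the roles cross: for \<open>j > 0\<close> the jumps contribute
  \<open>(p_fun j s + s * q_fun j s) * c\<close> and the continuous passages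
  \<open>q_fun j s * D\<close>, where \<open>D\<close> is the integral of \<open>s / u\<close> over
  continuous passages with the atom at depth \<open>u\<close>. The identity
  \<open>D + s * c = A\<close> merges the two multiples of \<open>q_fun j s\<close>.\<close>

type_synonym config = "(nat \<Rightarrow> nat) \<times> (nat \<times> nat \<Rightarrow> real \<times> real)"

definition counts_space :: "(nat \<Rightarrow> nat) measure" where
  "counts_space = PiM UNIV (\<lambda>k::nat. measure_pmf (poisson_pmf 1))"

definition points_space :: "(nat \<times> nat \<Rightarrow> real \<times> real) measure" where
  "points_space = PiM UNIV (\<lambda>n::nat \<times> nat. uniform_measure lborel (strip_box (fst n)))"

definition config_space :: "config measure" where
  "config_space = counts_space \<Otimes>\<^sub>M points_space"

text \<open>The Mecke formula sums over indices, not points, so coinciding points would still be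
  counted separately; the two views agree only almost surely.\<close>

definition idx :: "config \<Rightarrow> (nat \<times> nat) set" where
  "idx \<omega> = {(k, i). i < fst \<omega> k}"

text \<open>Deleting the atom with index \<open>n\<close> closes the gap in its box: the later points of that box
  move down by one index.\<close>

definition skip :: "nat \<times> nat \<Rightarrow> nat \<times> nat \<Rightarrow> nat \<times> nat" where
  "skip n m = (fst m, if fst m = fst n \<and> snd n \<le> snd m then Suc (snd m) else snd m)"

definition del :: "nat \<times> nat \<Rightarrow> config \<Rightarrow> config" where
  "del n \<omega> = ((fst \<omega>)(fst n := fst \<omega> (fst n) - 1), \<lambda>m. snd \<omega> (skip n m))"

definition strip :: "(real \<times> real) set" where
  "strip = {0..1} \<times> {..0}"

section \<open>The product spaces, deletion of an index, and measurability\<close>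

lemma emeasure_strip_box: "emeasure lborel (strip_box k) = 1"
  unfolding strip_box_def
  by (subst lborel_prod[symmetric], subst lborel.emeasure_pair_measure_Times) auto

lemma sets_strip_box [measurable]: "strip_box k \<in> sets borel"
  unfolding strip_box_def by (intro borel_Times) auto

lemma sets_strip [measurable]: "strip \<in> sets borel"
  unfolding strip_def by (intro borel_Times) auto

lemma prob_space_box: "prob_space (uniform_measure lborel (strip_box k))"
  by (rule prob_space_uniform_measure) (auto simp: emeasure_strip_box)

lemma prob_space_points: "prob_space points_space"
  unfolding points_space_def by (rule prob_space_PiM) (rule prob_space_box)

lemma prob_space_counts: "prob_space counts_space"
  unfolding counts_space_def by (rule prob_space_PiM) (rule measure_pmf.prob_space_axioms)

interpretation points: prob_space points_space by (rule prob_space_points)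
interpretation counts: prob_space counts_space by (rule prob_space_counts)
interpretation cfg_pair: pair_prob_space counts_space points_space ..
interpretation cfg: prob_space config_space
  unfolding config_space_def by (rule cfg_pair.prob_space_axioms)

lemma sets_counts_space [measurable_cong]: "sets counts_space = sets (PiM UNIV (\<lambda>_. count_space UNIV))"
  unfolding counts_space_def by (rule sets_PiM_cong) auto

lemma sets_points_space [measurable_cong]: "sets points_space = sets (PiM UNIV (\<lambda>_. borel))"
  unfolding points_space_def by (rule sets_PiM_cong) auto

lemma sets_config_space [measurable_cong]:
  "sets config_space = sets (PiM UNIV (\<lambda>_. count_space UNIV) \<Otimes>\<^sub>M PiM UNIV (\<lambda>_. borel))"
  unfolding config_space_def by (rule sets_pair_measure_cong[OF sets_counts_space sets_points_space])

lemma space_counts_space [simp]: "space counts_space = UNIV"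
  by (simp add: counts_space_def space_PiM)

lemma space_points_space [simp]: "space points_space = UNIV"
  by (simp add: points_space_def space_PiM)

lemma space_config_space [simp]: "space config_space = UNIV"
  by (simp add: config_space_def space_pair_measure)

lemma skip_neq: "skip n m \<noteq> n"
  by (cases n; cases m) (auto simp: skip_def)

lemma inj_skip: "inj (skip n)"
  by (auto simp: inj_def skip_def prod_eq_iff split: if_splits)

lemma skip_surj:
  assumes "m \<noteq> n" obtains m' where "m = skip n m'"
proof (cases "fst m = fst n \<and> snd n < snd m")
  case True
  then have "m = skip n (fst m, snd m - 1)" by (auto simp: skip_def prod_eq_iff)
  then show ?thesis using that by blast
next
  case False
  then have "m = skip n m" using assms by (auto simp: skip_def prod_eq_iff)
  then show ?thesis using that by blast
qed

lemma skip_image_idx_del: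
  assumes "n \<in> idx \<omega>"
  shows "skip n ` idx (del n \<omega>) = idx \<omega> - {n}"
proof (intro equalityI subsetI)
  fix m assume "m \<in> skip n ` idx (del n \<omega>)"
  then obtain m' where "m' \<in> idx (del n \<omega>)" "m = skip n m'" by blast
  then show "m \<in> idx \<omega> - {n}"
    using skip_neq[of n m'] assms by (auto simp: idx_def del_def skip_def split: if_splits)
next
  fix m assume m: "m \<in> idx \<omega> - {n}"
  then obtain m' where m': "m = skip n m'" using skip_surj[of m n] by auto
  with m assms have "m' \<in> idx (del n \<omega>)"
    by (auto simp: idx_def del_def skip_def split: if_splits)
  with m' show "m \<in> skip n ` idx (del n \<omega>)" by blast
qed

lemma measurable_fst_config [measurable]: "(\<lambda>\<omega>. fst \<omega> k) \<in> measurable config_space (count_space UNIV)"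
  by measurable

lemma measurable_snd_config [measurable]: "(\<lambda>\<omega>. snd \<omega> n) \<in> measurable config_space borel"
  by measurable

lemma measurable_reindex [measurable]: "(\<lambda>U m. U (g m)) \<in> measurable points_space points_space"
proof -
  have "(\<lambda>U m. U (g m)) \<in> measurable (PiM UNIV (\<lambda>_::nat \<times> nat. borel :: (real \<times> real) measure)) (PiM UNIV (\<lambda>_::nat \<times> nat. borel))"
    by (rule measurable_PiM_single') auto
  then show ?thesis
    using measurable_cong_sets[OF sets_points_space sets_points_space] by blast
qed

lemma measurable_upd [measurable]: "(\<lambda>N. N (k := N k - Suc 0)) \<in> measurable counts_space counts_space"
proof -
  have "(\<lambda>N. N (k := N k - Suc 0)) \<in> measurable (PiM UNIV (\<lambda>_::nat. count_space (UNIV::nat set))) (PiM UNIV (\<lambda>_::nat. count_space UNIV))"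
    by (rule measurable_PiM_single') auto
  then show ?thesis
    using measurable_cong_sets[OF sets_counts_space sets_counts_space] by blast
qed

lemma measurable_del [measurable]: "del n \<in> measurable config_space config_space"
proof -
  have "(\<lambda>\<omega>. ((fst \<omega>)(fst n := fst \<omega> (fst n) - Suc 0), \<lambda>m. snd \<omega> (skip n m))) \<in> measurable (counts_space \<Otimes>\<^sub>M points_space) (counts_space \<Otimes>\<^sub>M points_space)"
    by (intro measurable_Pair measurable_compose[OF measurable_fst measurable_upd]
        measurable_compose[OF measurable_snd measurable_reindex])
  then show ?thesis
    by (simp add: del_def[abs_def] config_space_def)
qed

text \<open>The point with index \<open>n\<close> is independent of all others, and the others,
  renumbered along \<open>skip n\<close>, again have the law of the whole family:
  \<open>skip n\<close> keeps the box number, so each renumbered point is uniform on the right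
  box.\<close>

lemma points_split:
  fixes f :: "(real \<times> real) \<Rightarrow> (nat \<times> nat \<Rightarrow> real \<times> real) \<Rightarrow> ennreal"
  assumes f: "case_prod f \<in> borel_measurable (borel \<Otimes>\<^sub>M points_space)"
  shows "(\<integral>\<^sup>+U. f (U n) (\<lambda>m. U (skip n m)) \<partial>points_space) =
         (\<integral>\<^sup>+a. (\<integral>\<^sup>+U. f a U \<partial>points_space) * indicator (strip_box (fst n)) a \<partial>lborel)"
proof -
  define M where "M = (\<lambda>n::nat \<times> nat. uniform_measure lborel (strip_box (fst n)))"
  have M: "prob_space (M i)" for i unfolding M_def by (rule prob_space_box)
  have pM: "points_space = PiM UNIV M" unfolding points_space_def M_def ..
  interpret R: prob_space "PiM (UNIV - {n}) M" by (rule prob_space_PiM) (rule M)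
  interpret Mn: prob_space "M n" by (rule M)
  interpret pair_prob_space "M n" "PiM (UNIV - {n}) M" ..
  have sM: "sets (M i) = sets borel" for i unfolding M_def by simp
  have f0: "(\<lambda>U. f (U n) (\<lambda>m. U (skip n m))) \<in> borel_measurable (PiM UNIV M)"
  proof -
    have "(\<lambda>U. (U n, \<lambda>m. U (skip n m))) \<in> measurable points_space (borel \<Otimes>\<^sub>M points_space)"
      by measurable
    from measurable_compose[OF this f] show ?thesis by (simp only: prod.case pM)
  qed
  have ins: "insert n (UNIV - {n}) = UNIV" by auto
  have upd: "(\<lambda>(x, X). X(n := x)) \<in> measurable (M n \<Otimes>\<^sub>M PiM (UNIV - {n}) M) (PiM UNIV M)"
    using measurable_fun_upd[of UNIV "UNIV - {n}" n snd "M n \<Otimes>\<^sub>M PiM (UNIV - {n}) M" M fst]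
    by (simp add: case_prod_beta' ins)
  have eq1: "PiM UNIV M = distr (M n \<Otimes>\<^sub>M PiM (UNIV - {n}) M) (PiM UNIV M) (\<lambda>(x, X). X(n := x))"
    using distr_pair_PiM_eq_PiM[of "UNIV - {n}" M n, OF M M] by (simp add: ins)
  have eq2: "distr (PiM (UNIV - {n}) M) (PiM UNIV M) (\<lambda>\<omega> m. \<omega> (skip n m)) = PiM UNIV M"
  proof -
    have 1: "skip n \<in> UNIV \<rightarrow> UNIV - {n}" using skip_neq by auto
    have 2: "(\<lambda>i. M (skip n i)) = M" by (simp add: M_def skip_def)
    from distr_PiM_reindex[of "UNIV - {n}" M "skip n" UNIV, OF M inj_skip 1]
    show ?thesis unfolding 2 restrict_UNIV .
  qed
  have t: "(\<lambda>\<omega> m. \<omega> (skip n m)) \<in> measurable (PiM (UNIV - {n}) M) (PiM UNIV M)"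
  proof (rule measurable_PiM_single')
    fix i 
    have "M (skip n i) = M i" by (simp add: M_def skip_def)
    with measurable_component_singleton[of "skip n i" "UNIV - {n}" M] skip_neq[of n i]
    show "(\<lambda>\<omega>. \<omega> (skip n i)) \<in> measurable (PiM (UNIV - {n}) M) (M i)" by auto
  qed (auto simp: M_def)
  have f1: "f a \<in> borel_measurable (PiM UNIV M)" for a
    using measurable_Pair2[OF f, of a] unfolding pM[symmetric] prod.case by (metis UNIV_I space_borel)
  have "(\<lambda>(x,X). (x, \<lambda>m. X (skip n m))) \<in> measurable (M n \<Otimes>\<^sub>M PiM (UNIV - {n}) M) (borel \<Otimes>\<^sub>M points_space)"
    unfolding case_prod_beta' pM
    by (intro measurable_Pair measurable_compose[OF measurable_snd t]
         measurable_fst'' measurable_ident_sets sM)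
  from measurable_compose[OF this f]
  have meas: "(\<lambda>p. f (fst p) (\<lambda>m. snd p (skip n m))) \<in> borel_measurable (M n \<Otimes>\<^sub>M PiM (UNIV - {n}) M)"
    by (simp add: case_prod_beta')
  have "(\<integral>\<^sup>+U. f (U n) (\<lambda>m. U (skip n m)) \<partial>PiM UNIV M) =
     (\<integral>\<^sup>+p. f (fst p) (\<lambda>m. snd p (skip n m)) \<partial>(M n \<Otimes>\<^sub>M PiM (UNIV - {n}) M))"
    by (subst eq1, subst nn_integral_distr[OF upd])
       (use f0 in \<open>simp_all add: case_prod_beta' skip_neq\<close>)
  also have "\<dots> = (\<integral>\<^sup>+a. \<integral>\<^sup>+X. f a (\<lambda>m. X (skip n m)) \<partial>PiM (UNIV - {n}) M \<partial>M n)"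
    by (subst R.nn_integral_fst[symmetric]) (use meas in \<open>auto simp: case_prod_beta'\<close>)
  also have "\<dots> = (\<integral>\<^sup>+a. \<integral>\<^sup>+U. f a U \<partial>PiM UNIV M \<partial>M n)"
  proof (rule nn_integral_cong)
    fix a
    show "(\<integral>\<^sup>+X. f a (\<lambda>m. X (skip n m)) \<partial>PiM (UNIV - {n}) M) = (\<integral>\<^sup>+U. f a U \<partial>PiM UNIV M)"
      using nn_integral_distr[OF t, of "f a"] f1[of a] unfolding eq2 by simp
  qed
  also have "\<dots> = (\<integral>\<^sup>+a. (\<integral>\<^sup>+U. f a U \<partial>points_space) * indicator (strip_box (fst n)) a \<partial>lborel)"
  proof -
    have "(\<lambda>a. \<integral>\<^sup>+U. f a U \<partial>points_space) \<in> borel_measurable borel"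
      using points.borel_measurable_nn_integral[OF f] .
    then show ?thesis
      unfolding M_def pM[symmetric, unfolded M_def]
      by (subst nn_integral_uniform_measure) (auto simp: emeasure_strip_box divide_ennreal_def pM M_def)
  qed
  finally show ?thesis unfolding pM .
qed

text \<open>Termwise this is \<open>(x + 1) * P(N = x + 1) = P(N = x)\<close> for mean one. The term
  \<open>x = 0\<close>, where \<open>x - 1\<close> is truncated, carries the factor 0.\<close>

lemma poisson_shift:
  fixes H :: "nat \<Rightarrow> ennreal"
  shows "(\<integral>\<^sup>+x. of_nat x * H (x - 1) \<partial>measure_pmf (poisson_pmf 1)) = (\<integral>\<^sup>+x. H x \<partial>measure_pmf (poisson_pmf 1))"
proof -
  have e: "ennreal (pmf (poisson_pmf 1) (Suc x)) * (of_nat (Suc x) * H x) = ennreal (pmf (poisson_pmf 1) x) * H x" for x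
  proof -
    have "ennreal (pmf (poisson_pmf 1) (Suc x)) * of_nat (Suc x) = ennreal (pmf (poisson_pmf 1) (Suc x) * real (Suc x))"
      by (subst ennreal_mult) (auto simp flip: ennreal_of_nat_eq_real_of_nat)
    also have "pmf (poisson_pmf 1) (Suc x) * real (Suc x) = pmf (poisson_pmf 1) x"
      by (simp add: field_simps del: of_nat_Suc)
    finally show ?thesis by (simp add: mult.assoc[symmetric] del: of_nat_Suc pmf_poisson)
  qed
  have "(\<integral>\<^sup>+x. of_nat x * H (x - 1) \<partial>measure_pmf (poisson_pmf 1)) = 
     (\<Sum>x. ennreal (pmf (poisson_pmf 1) x) * (of_nat x * H (x - 1)))"
    by (simp add: nn_integral_measure_pmf nn_integral_count_space_nat)
  also have "\<dots> = (\<Sum>x. ennreal (pmf (poisson_pmf 1) (Suc x)) * (of_nat (Suc x) * H x))"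
    by (subst suminf_offset[where i=1]) (auto simp del: of_nat_Suc)
  also have "\<dots> = (\<Sum>x. ennreal (pmf (poisson_pmf 1) x) * H x)"
    unfolding e ..
  also have "\<dots> = (\<integral>\<^sup>+x. H x \<partial>measure_pmf (poisson_pmf 1))"
    by (simp add: nn_integral_measure_pmf nn_integral_count_space_nat)
  finally show ?thesis .
qed

text \<open>The factor \<open>N k\<close> is the number of ways to choose an atom of box
  \<open>k\<close>; size-biasing a Poisson count and then removing one atom gives back the original
  law.\<close>

lemma counts_shift:
  fixes h :: "(nat \<Rightarrow> nat) \<Rightarrow> ennreal"
  assumes h [measurable]: "h \<in> borel_measurable counts_space"
  shows "(\<integral>\<^sup>+N. of_nat (N k) * h (N(k := N k - 1)) \<partial>counts_space) = (\<integral>\<^sup>+N. h N \<partial>counts_space)"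
proof -
  define M where "M = (\<lambda>k::nat. measure_pmf (poisson_pmf 1))"
  have M: "prob_space (M i)" for i unfolding M_def by (rule measure_pmf.prob_space_axioms)
  have pM: "counts_space = PiM UNIV M" unfolding counts_space_def M_def ..
  interpret R: prob_space "PiM (UNIV - {k}) M" by (rule prob_space_PiM) (rule M)
  interpret Mk: prob_space "M k" by (rule M)
  interpret pair_prob_space "M k" "PiM (UNIV - {k}) M" ..
  have ins: "insert k (UNIV - {k}) = UNIV" by auto
  have upd: "(\<lambda>(x, X). X(k := x)) \<in> measurable (M k \<Otimes>\<^sub>M PiM (UNIV - {k}) M) (PiM UNIV M)"
    using measurable_fun_upd[of UNIV "UNIV - {k}" k snd "M k \<Otimes>\<^sub>M PiM (UNIV - {k}) M" M fst]
    by (simp add: case_prod_beta' ins)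
  have eq1: "PiM UNIV M = distr (M k \<Otimes>\<^sub>M PiM (UNIV - {k}) M) (PiM UNIV M) (\<lambda>(x, X). X(k := x))"
    using distr_pair_PiM_eq_PiM[of "UNIV - {k}" M k, OF M M] by (simp add: ins)
  have split: "(\<integral>\<^sup>+N. g N \<partial>PiM UNIV M) = (\<integral>\<^sup>+X. \<integral>\<^sup>+x. g (X(k := x)) \<partial>M k \<partial>PiM (UNIV - {k}) M)"
    if g: "g \<in> borel_measurable (PiM UNIV M)" for g :: "_ \<Rightarrow> ennreal"
  proof -
    have m: "(\<lambda>p. g ((snd p)(k := fst p))) \<in> borel_measurable (M k \<Otimes>\<^sub>M PiM (UNIV - {k}) M)"
      using measurable_compose[OF upd g] by (simp add: case_prod_beta')
    have "(\<integral>\<^sup>+N. g N \<partial>PiM UNIV M) = (\<integral>\<^sup>+N. g N \<partial>distr (M k \<Otimes>\<^sub>M PiM (UNIV - {k}) M) (PiM UNIV M) (\<lambda>(x, X). X(k := x)))"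
      unfolding eq1[symmetric] ..
    also have "\<dots> = (\<integral>\<^sup>+p. g ((snd p)(k := fst p)) \<partial>(M k \<Otimes>\<^sub>M PiM (UNIV - {k}) M))"
      using g by (subst nn_integral_distr[OF upd]) (simp_all add: case_prod_beta')
    also have "\<dots> = (\<integral>\<^sup>+X. \<integral>\<^sup>+x. g (X(k := x)) \<partial>M k \<partial>PiM (UNIV - {k}) M)"
      using nn_integral_snd[of "\<lambda>p. g ((snd p)(k := fst p))"] m by simp
    finally show ?thesis .
  qed
  have m1: "(\<lambda>N. of_nat (N k) * h (N(k := N k - 1))) \<in> borel_measurable (PiM UNIV M)"
    unfolding pM[symmetric] by simp
  have "(\<integral>\<^sup>+N. of_nat (N k) * h (N(k := N k - 1)) \<partial>PiM UNIV M) = 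
     (\<integral>\<^sup>+X. \<integral>\<^sup>+x. of_nat x * h (X(k := x - 1)) \<partial>M k \<partial>PiM (UNIV - {k}) M)"
    by (subst split[OF m1]) simp
  also have "\<dots> = (\<integral>\<^sup>+X. \<integral>\<^sup>+x. h (X(k := x)) \<partial>M k \<partial>PiM (UNIV - {k}) M)"
    unfolding M_def by (subst poisson_shift[where H = "\<lambda>x. h (_(k := x))"]) simp
  also have "\<dots> = (\<integral>\<^sup>+N. h N \<partial>PiM UNIV M)"
    by (subst split) (use h pM in auto)
  finally show ?thesis unfolding pM .
qed

text \<open>Neighbouring boxes share only horizontal edges at integer heights, a null set; off these
  edges the box containing a point is determined by the floor of \<open>- y\<close>.\<close>

lemma strip_boxes_AE: "AE a in lborel. (\<Sum>k. indicator (strip_box k) a) = (indicator strip a :: ennreal)"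
proof -
  have "countable ((\<lambda>k::nat. - real k) ` UNIV)" by auto
  then have "(\<lambda>k::nat. - real k) ` UNIV \<in> null_sets lborel"
    by (rule countable_imp_null_set_lborel)
  then have "UNIV \<times> (\<lambda>k::nat. - real k) ` UNIV \<in> null_sets (lborel \<Otimes>\<^sub>M lborel)"
    by (auto simp: null_sets_def lborel.emeasure_pair_measure_Times)
  then have N: "UNIV \<times> (\<lambda>k::nat. - real k) ` UNIV \<in> null_sets lborel"
    by (simp add: lborel_prod)
  show ?thesis
  proof (rule AE_I'[OF N], rule subsetI)
    fix a :: "real \<times> real"
    assume "a \<in> {x \<in> space lborel. (\<Sum>k. indicator (strip_box k) x) \<noteq> (indicator strip x :: ennreal)}"
    moreover obtain x y where a: "a = (x, y)" by (cases a)
    ultimately have neq: "(\<Sum>k. indicator (strip_box k) (x,y)) \<noteq> (indicator strip (x,y) :: ennreal)" by simp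
    have "(x, y) \<in> UNIV \<times> (\<lambda>k::nat. - real k) ` UNIV"
    proof (rule ccontr)
      assume "\<not> ?thesis"
      then have ny: "y \<noteq> - real k" for k by auto
      define k where "k = nat \<lfloor>- y\<rfloor>"
      have ind: "indicator (strip_box k') (x,y) = (if k' = k then indicator strip (x,y) else 0 :: ennreal)" for k'
      proof -
        have "(- (real k' + 1) \<le> y \<and> y \<le> - real k') \<longleftrightarrow> y \<le> 0 \<and> k' = k"
        proof safe
          assume a: "- (real k' + 1) \<le> y" "y \<le> - real k'"
          with ny[of "Suc k'"] have "\<lfloor>- y\<rfloor> = int k'"
            by (intro floor_unique) auto
          then show "k' = k" by (simp add: k_def)
          show "y \<le> 0" using a by linarith
        next
          assume "y \<le> 0"
          then have "real k = of_int \<lfloor>-y\<rfloor>" by (auto simp: k_def)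
          then show "- (real k + 1) \<le> y" "y \<le> - real k" by linarith+
        qed
        then show ?thesis by (auto simp: strip_box_def strip_def indicator_def)
      qed
      have "(\<Sum>k'. indicator (strip_box k') (x,y)) = (indicator strip (x,y) :: ennreal)"
        unfolding ind by (subst suminf_finite[of "{k}"]) auto
      with neq show False by simp
    qed
    with a show "a \<in> UNIV \<times> (\<lambda>k::nat. - real k) ` UNIV" by simp
  qed
qed

text \<open>For a fixed index \<open>(k, i)\<close> the point is integrated out by
  \<open>points_split\<close>; what remains depends on \<open>i\<close> only through
  \<open>i < N k\<close>. Summing over \<open>i\<close> yields the factor \<open>N k\<close>, which
  \<open>counts_shift\<close> absorbs together with the deletion, and summing over \<open>k\<close>
  glues the boxes to the strip.\<close>

theorem mecke:
  fixes f :: "(real \<times> real) \<Rightarrow> config \<Rightarrow> ennreal"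
  assumes f [measurable]: "case_prod f \<in> borel_measurable (borel \<Otimes>\<^sub>M config_space)"
  shows "(\<integral>\<^sup>+\<omega>. (\<integral>\<^sup>+n. f (snd \<omega> n) (del n \<omega>) * indicator (idx \<omega>) n \<partial>count_space UNIV) \<partial>config_space) =
         (\<integral>\<^sup>+a. (\<integral>\<^sup>+\<omega>. f a \<omega> \<partial>config_space) * indicator strip a \<partial>lborel)"
proof -
  have f': "(\<lambda>x. f (g x) (h x)) \<in> borel_measurable N" 
    if "g \<in> measurable N borel" "h \<in> measurable N config_space" for g h N
    using measurable_compose[OF measurable_Pair[OF that] f] by simp
  have m1 [measurable]: "(\<lambda>\<omega>. f (snd \<omega> n) (del n \<omega>) * indicator (idx \<omega>) n) \<in> borel_measurable config_space" for n
  proof -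
    have [measurable]: "(\<lambda>\<omega>. f (snd \<omega> n) (del n \<omega>)) \<in> borel_measurable config_space"
      by (rule f') auto
    have "(\<lambda>\<omega>. f (snd \<omega> n) (del n \<omega>) * indicator (idx \<omega>) n) = 
       (\<lambda>\<omega>. if snd n < fst \<omega> (fst n) then f (snd \<omega> n) (del n \<omega>) else 0)"
      by (auto simp: fun_eq_iff idx_def case_prod_beta)
    then show ?thesis by simp
  qed
  define h where "h k N = (\<integral>\<^sup>+a. (\<integral>\<^sup>+U. f a (N, U) \<partial>points_space) * indicator (strip_box k) a \<partial>lborel)" for k N
  have m2 [measurable]: "(\<lambda>p. \<integral>\<^sup>+U. f (snd p) (fst p, U) \<partial>points_space) \<in> borel_measurable (counts_space \<Otimes>\<^sub>M borel)"
    by (rule points.borel_measurable_nn_integral, unfold case_prod_beta')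
       (rule f', auto simp: config_space_def)
  have hm [measurable]: "h k \<in> borel_measurable counts_space" for k
    unfolding h_def[abs_def]
    by (rule lborel.borel_measurable_nn_integral) (use m2 in \<open>simp add: case_prod_beta'\<close>)
  have term_eq: "(\<integral>\<^sup>+\<omega>. f (snd \<omega> (k,i)) (del (k,i) \<omega>) * indicator (idx \<omega>) (k,i) \<partial>config_space) = 
     (\<integral>\<^sup>+N. h k (N(k := N k - 1)) * indicator {..<N k} i \<partial>counts_space)" for k i
  proof -
    have "(\<integral>\<^sup>+\<omega>. f (snd \<omega> (k,i)) (del (k,i) \<omega>) * indicator (idx \<omega>) (k,i) \<partial>config_space) =
       (\<integral>\<^sup>+N. \<integral>\<^sup>+U. f (U (k,i)) (N(k := N k - 1), \<lambda>m. U (skip (k,i) m)) * indicator {..<N k} i \<partial>points_space \<partial>counts_space)"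
      unfolding config_space_def
      by (subst points.nn_integral_fst[symmetric])
        (use m1[of "(k,i)"] in \<open>auto simp: config_space_def idx_def del_def indicator_def\<close>)
    also have "\<dots> = (\<integral>\<^sup>+N. h k (N(k := N k - 1)) * indicator {..<N k} i \<partial>counts_space)"
    proof (rule nn_integral_cong)
      fix N
      have m: "(\<lambda>(a, U). f a (N(k := N k - 1), U)) \<in> borel_measurable (borel \<Otimes>\<^sub>M points_space)"
        unfolding case_prod_beta' by (rule f') (auto simp: config_space_def)
      have [measurable]: "(\<lambda>U. f (U (k,i)) (N(k := N k - 1), \<lambda>m. U (skip (k,i) m))) \<in> borel_measurable points_space"
        by (rule f') (auto simp: config_space_def)
      show "(\<integral>\<^sup>+U. f (U (k,i)) (N(k := N k - 1), \<lambda>m. U (skip (k,i) m)) * indicator {..<N k} i \<partial>points_space) =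
         h k (N(k := N k - 1)) * indicator {..<N k} i"
        unfolding h_def
        using points_split[OF m, of "(k,i)"] by (subst nn_integral_multc) (simp_all del: One_nat_def)
    qed
    finally show ?thesis .
  qed
  have "(\<integral>\<^sup>+\<omega>. (\<integral>\<^sup>+n. f (snd \<omega> n) (del n \<omega>) * indicator (idx \<omega>) n \<partial>count_space UNIV) \<partial>config_space) =
     (\<integral>\<^sup>+n. (\<integral>\<^sup>+\<omega>. f (snd \<omega> n) (del n \<omega>) * indicator (idx \<omega>) n \<partial>config_space) \<partial>count_space UNIV)"
    by (rule nn_integral_count_space_nn_integral) (use m1 in auto)
  also have "\<dots> = (\<integral>\<^sup>+k. \<integral>\<^sup>+i. (\<integral>\<^sup>+N. h k (N(k := N k - 1)) * indicator {..<N k} i \<partial>counts_space) \<partial>count_space UNIV \<partial>count_space UNIV)"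
    by (subst nn_integral_fst_count_space[symmetric]) (simp add: term_eq)
  also have "\<dots> = (\<integral>\<^sup>+k. (\<integral>\<^sup>+N. \<integral>\<^sup>+i. h k (N(k := N k - 1)) * indicator {..<N k} i \<partial>count_space UNIV \<partial>counts_space) \<partial>count_space UNIV)"
    by (intro nn_integral_cong nn_integral_count_space_nn_integral[symmetric]) auto
  also have "\<dots> = (\<integral>\<^sup>+k. (\<integral>\<^sup>+N. of_nat (N k) * h k (N(k := N k - 1)) \<partial>counts_space) \<partial>count_space UNIV)"
    by (intro nn_integral_cong, subst nn_integral_cmult_indicator) (auto simp: mult.commute)
  also have "\<dots> = (\<integral>\<^sup>+k. (\<integral>\<^sup>+N. h k N \<partial>counts_space) \<partial>count_space UNIV)"
    by (intro nn_integral_cong counts_shift hm)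
  also have "\<dots> = (\<integral>\<^sup>+k. (\<integral>\<^sup>+a. (\<integral>\<^sup>+\<omega>. f a \<omega> \<partial>config_space) * indicator (strip_box k) a \<partial>lborel) \<partial>count_space UNIV)"
  proof (rule nn_integral_cong)
    fix k
    interpret cl: pair_sigma_finite counts_space "lborel :: (real \<times> real) measure" ..
    have "(\<integral>\<^sup>+N. h k N \<partial>counts_space) = (\<integral>\<^sup>+a. (\<integral>\<^sup>+N. (\<integral>\<^sup>+U. f a (N, U) \<partial>points_space) * indicator (strip_box k) a \<partial>counts_space) \<partial>lborel)"
      unfolding h_def by (rule cl.Fubini'[symmetric]) (use m2 in \<open>simp add: case_prod_beta'\<close>)
    also have "\<dots> = (\<integral>\<^sup>+a. (\<integral>\<^sup>+N. (\<integral>\<^sup>+U. f a (N, U) \<partial>points_space)  \<partial>counts_space) * indicator (strip_box k) a \<partial>lborel)"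
      by (intro nn_integral_cong nn_integral_multc points.borel_measurable_nn_integral, unfold case_prod_beta')
         (rule f', auto simp: config_space_def)
    also have "\<dots> = (\<integral>\<^sup>+a. (\<integral>\<^sup>+\<omega>. f a \<omega> \<partial>config_space) * indicator (strip_box k) a \<partial>lborel)"
      unfolding config_space_def
      by (subst points.nn_integral_fst) 
         (use f'[of "\<lambda>_. _" config_space "\<lambda>x. x"] in \<open>auto simp: config_space_def\<close>)
    finally show "(\<integral>\<^sup>+N. h k N \<partial>counts_space) = (\<integral>\<^sup>+a. (\<integral>\<^sup>+\<omega>. f a \<omega> \<partial>config_space) * indicator (strip_box k) a \<partial>lborel)" .
  qed
  also have "\<dots> = (\<integral>\<^sup>+a. (\<integral>\<^sup>+\<omega>. f a \<omega> \<partial>config_space) * (\<Sum>k. indicator (strip_box k) a) \<partial>lborel)"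
    using cfg.borel_measurable_nn_integral[OF f]
    by (subst nn_integral_count_space_nn_integral[symmetric]) (auto simp: nn_integral_cmult nn_integral_count_space_nat)
  also have "\<dots> = (\<integral>\<^sup>+a. (\<integral>\<^sup>+\<omega>. f a \<omega> \<partial>config_space) * indicator strip a \<partial>lborel)"
    by (rule nn_integral_cong_AE) (use strip_boxes_AE in eventually_elim, simp)
  finally show ?thesis .
qed

section \<open>Generic configurations\<close>

definition pts :: "config \<Rightarrow> (real \<times> real) set" where
  "pts \<omega> = snd \<omega> ` idx \<omega>"

lemma atoms_eq_pts: "atoms \<omega> = pts (fst \<omega>)"
  unfolding atoms_def pts_def idx_def by auto

text \<open>Injectivity enters because a second index carrying the same point would keep it in the
  set after the deletion.\<close>

lemma pts_del:
  assumes "n \<in> idx \<omega>" "inj_on (snd \<omega>) (idx \<omega>)"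
  shows "pts (del n \<omega>) = pts \<omega> - {snd \<omega> n}"
proof -
  have "pts (del n \<omega>) = snd \<omega> ` (skip n ` idx (del n \<omega>))"
    by (simp add: pts_def image_image del_def)
  also have "\<dots> = snd \<omega> ` (idx \<omega> - {n})"
    using assms by (simp add: skip_image_idx_del)
  also have "\<dots> = pts \<omega> - {snd \<omega> n}"
    using assms by (auto simp: pts_def inj_on_def)
  finally show ?thesis .
qed

section \<open>Measurability of statements about the random point set\<close>

lemma borel_measurable_fst_snd_real [measurable (raw)]:
  fixes f :: "'a \<Rightarrow> real \<times> real"
  assumes "f \<in> measurable M borel"
  shows "(\<lambda>x. fst (f x)) \<in> measurable M borel" "(\<lambda>x. snd (f x)) \<in> measurable M borel"
proof -
  have "fst \<in> measurable borel (borel :: real measure)" "snd \<in> measurable borel (borel :: real measure)"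
    by (auto intro!: borel_measurable_continuous_onI continuous_intros)
  then show "(\<lambda>x. fst (f x)) \<in> measurable M borel" "(\<lambda>x. snd (f x)) \<in> measurable M borel"
    using measurable_compose[OF assms] by blast+
qed

lemma pred_idx [measurable]:
  assumes [measurable]: "f \<in> measurable M config_space"
  shows "Measurable.pred M (\<lambda>x. n \<in> idx (f x))"
proof -
  have "(\<lambda>x. n \<in> idx (f x)) = (\<lambda>x. snd n < fst (f x) (fst n))"
    by (auto simp: idx_def case_prod_beta)
  moreover have "(\<lambda>x. fst (f x) (fst n)) \<in> measurable M (count_space UNIV)"
    by (rule measurable_compose[OF assms measurable_fst_config])
  ultimately show ?thesis by simp
qed

lemma measurable_point [measurable]:
  assumes "f \<in> measurable M config_space"
  shows "(\<lambda>x. snd (f x) n) \<in> measurable M borel"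
  by (rule measurable_compose[OF assms measurable_snd_config])

lemma pred_ball_pts [measurable]:
  assumes [measurable]: "f \<in> measurable M config_space"
    "\<And>n. Measurable.pred M (\<lambda>x. P x (snd (f x) n))"
  shows "Measurable.pred M (\<lambda>x. \<forall>a\<in>pts (f x). P x a)"
proof -
  have "(\<lambda>x. \<forall>a\<in>pts (f x). P x a) = (\<lambda>x. \<forall>n. n \<in> idx (f x) \<longrightarrow> P x (snd (f x) n))"
    by (auto simp: pts_def)
  then show ?thesis by simp
qed

lemma pred_bex_pts [measurable]:
  assumes [measurable]: "f \<in> measurable M config_space"
    "\<And>n. Measurable.pred M (\<lambda>x. P x (snd (f x) n))"
  shows "Measurable.pred M (\<lambda>x. \<exists>a\<in>pts (f x). P x a)"
proof -
  have "(\<lambda>x. \<exists>a\<in>pts (f x). P x a) = (\<lambda>x. \<exists>n. n \<in> idx (f x) \<and> P x (snd (f x) n))"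
    unfolding pts_def by blast
  then show ?thesis by simp
qed

text \<open>Lists of indices range over a countable type, so in this form the number of points is
  described by countable quantifiers and is measurable. The list \<open>xs\<close> holds one
  representative index for each point.\<close>

lemma finite_card_image_iff:
  "finite (u ` I) \<and> card (u ` I) = j \<longleftrightarrow>
    (\<exists>xs. length xs = j \<and> distinct xs \<and> (\<forall>n\<in>set xs. n \<in> I) \<and> (\<forall>n\<in>set xs. \<forall>m\<in>set xs. n \<noteq> m \<longrightarrow> u n \<noteq> u m) \<and>
        (\<forall>n. n \<in> I \<longrightarrow> (\<exists>m\<in>set xs. u n = u m)))" (is "?L \<longleftrightarrow> ?R")
proof
  assume L: ?L
  obtain F where F: "F \<subseteq> I" "inj_on u F" "u ` F = u ` I"
    by (metis subset_image_inj subset_refl)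
  with L have "finite F" "card F = j"
    using finite_image_iff[OF F(2)] card_image[OF F(2)] by auto
  moreover then obtain xs where xs: "set xs = F" "distinct xs" using finite_distinct_list by blast
  ultimately have "length xs = j" using distinct_card by fastforce
  moreover have "\<forall>n. n \<in> I \<longrightarrow> (\<exists>m\<in>F. u n = u m)" using F(3) by (metis imageE imageI)
  ultimately show ?R using F xs by (intro exI[of _ xs]) (auto simp: inj_on_def)
next
  assume ?R
  then obtain xs where xs: "length xs = j" "distinct xs" "\<forall>n\<in>set xs. n \<in> I"
    "\<forall>n\<in>set xs. \<forall>m\<in>set xs. n \<noteq> m \<longrightarrow> u n \<noteq> u m" "\<forall>n. n \<in> I \<longrightarrow> (\<exists>m\<in>set xs. u n = u m)"
    by (elim exE conjE) (rule that)
  from xs(4) have "inj_on u (set xs)" by (metis inj_onI)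
  moreover have "u ` I = u ` set xs" 
  proof (intro equalityI image_subsetI)
    fix n assume "n \<in> I"
    with xs(5) obtain m where "m \<in> set xs" "u n = u m" by blast
    then show "u n \<in> u ` set xs" by simp
  qed (use xs(3) in simp)
  ultimately show ?L using xs by (simp add: card_image distinct_card)
qed

lemma pred_card_pts [measurable]:
  assumes [measurable]: "f \<in> measurable M config_space"
    "\<And>n. Measurable.pred M (\<lambda>x. P x (snd (f x) n))"
  shows "Measurable.pred M (\<lambda>x. finite {a\<in>pts (f x). P x a} \<and> card {a\<in>pts (f x). P x a} = j)"
proof -
  have eq: "{a\<in>pts (f x). P x a} = snd (f x) ` {n. n \<in> idx (f x) \<and> P x (snd (f x) n)}" for x
    by (auto simp: pts_def)
  have [measurable]: "Measurable.pred M (\<lambda>x. snd (f x) n = snd (f x) m)" for n m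
    by measurable
  show ?thesis
    unfolding eq finite_card_image_iff mem_Collect_eq by measurable
qed

text \<open>The formula is applied to the indicator of failure: the mean number of atoms violating
  \<open>P\<close> is an integral over \<open>a\<close> that vanishes, so almost surely there is
  none.\<close>

lemma mecke_AE:
  assumes [measurable]: "Measurable.pred (borel \<Otimes>\<^sub>M config_space) (\<lambda>x. P (fst x) (snd x))"
    and AE: "AE a in lborel. a \<in> strip \<longrightarrow> (AE \<omega> in config_space. P a \<omega>)"
  shows "AE \<omega> in config_space. \<forall>n\<in>idx \<omega>. P (snd \<omega> n) (del n \<omega>)"
proof -
  define f :: "real \<times> real \<Rightarrow> config \<Rightarrow> ennreal" where "f a \<omega> = (if P a \<omega> then 0 else 1)" for a \<omega>
  have m [measurable]: "case_prod f \<in> borel_measurable (borel \<Otimes>\<^sub>M config_space)"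
    unfolding f_def case_prod_beta' by measurable
  have fm: "(\<lambda>\<omega>. f (snd \<omega> n) (del n \<omega>)) \<in> borel_measurable config_space" for n
    using measurable_compose[OF measurable_Pair[OF measurable_snd_config measurable_del] m] by simp
  have fm2: "(\<lambda>\<omega>. f a \<omega>) \<in> borel_measurable config_space" for a
    using measurable_compose[OF measurable_Pair[OF measurable_const measurable_ident_sets[OF refl]] m] by simp
  have m2: "(\<lambda>\<omega>. f (snd \<omega> n) (del n \<omega>) * indicator (idx \<omega>) n) \<in> borel_measurable config_space" for n
  proof -
    have "(\<lambda>\<omega>. f (snd \<omega> n) (del n \<omega>) * indicator (idx \<omega>) n) = 
       (\<lambda>\<omega>. if n \<in> idx \<omega> then f (snd \<omega> n) (del n \<omega>) else 0)"
      by (auto simp: fun_eq_iff)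
    then show ?thesis using fm[of n] by simp
  qed
  have "(\<integral>\<^sup>+\<omega>. (\<integral>\<^sup>+n. f (snd \<omega> n) (del n \<omega>) * indicator (idx \<omega>) n \<partial>count_space UNIV) \<partial>config_space) =
         (\<integral>\<^sup>+a. (\<integral>\<^sup>+\<omega>. f a \<omega> \<partial>config_space) * indicator strip a \<partial>lborel)"
    by (rule mecke[OF m])
  also have "\<dots> = (\<integral>\<^sup>+a. 0 \<partial>(lborel :: (real \<times> real) measure))"
  proof (rule nn_integral_cong_AE, use AE in eventually_elim)
    fix a assume a: "a \<in> strip \<longrightarrow> (AE \<omega> in config_space. P a \<omega>)"
    show "(\<integral>\<^sup>+\<omega>. f a \<omega> \<partial>config_space) * indicator strip a = 0"
    proof (cases "a \<in> strip")
      case True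
      with a have "AE \<omega> in config_space. P a \<omega>" by simp
      then have "AE \<omega> in config_space. f a \<omega> = 0" by eventually_elim (simp add: f_def)
      then show ?thesis using fm2 by (simp add: nn_integral_0_iff_AE)
    qed simp
  qed
  finally have "(\<integral>\<^sup>+n. (\<integral>\<^sup>+\<omega>. f (snd \<omega> n) (del n \<omega>) * indicator (idx \<omega>) n \<partial>config_space) \<partial>count_space UNIV) = 0"
    by (subst nn_integral_count_space_nn_integral[symmetric]) (use m2 in auto)
  then have "\<forall>n. (\<integral>\<^sup>+\<omega>. f (snd \<omega> n) (del n \<omega>) * indicator (idx \<omega>) n \<partial>config_space) = 0"
    by (auto simp: nn_integral_0_iff_AE AE_count_space)
  then have "\<forall>n. AE \<omega> in config_space. f (snd \<omega> n) (del n \<omega>) * indicator (idx \<omega>) n = 0"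
    using m2 by (simp add: nn_integral_0_iff_AE)
  then have "AE \<omega> in config_space. \<forall>n. f (snd \<omega> n) (del n \<omega>) * indicator (idx \<omega>) n = 0"
    by (simp add: AE_all_countable)
  then show ?thesis
    by eventually_elim (auto simp: f_def indicator_def split: if_splits)
qed

text \<open>When at most one atom satisfies \<open>P\<close>, the number of such atoms is the
  indicator of existence, and the mean number given by the Mecke formula becomes a
  probability.\<close>

lemma mecke_unique:
  assumes P [measurable]: "Measurable.pred (borel \<Otimes>\<^sub>M config_space) (\<lambda>x. P (fst x) (snd x))"
    and E [measurable]: "Measurable.pred config_space E"
    and ex: "AE \<omega> in config_space. E \<omega> \<longleftrightarrow> (\<exists>n\<in>idx \<omega>. P (snd \<omega> n) (del n \<omega>))"
    and unique: "AE \<omega> in config_space. \<forall>n\<in>idx \<omega>. \<forall>m\<in>idx \<omega>. P (snd \<omega> n) (del n \<omega>) \<longrightarrow> P (snd \<omega> m) (del m \<omega>) \<longrightarrow> n = m"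
  shows "emeasure config_space {\<omega>. E \<omega>} = (\<integral>\<^sup>+a. emeasure config_space {\<omega>. P a \<omega>} * indicator strip a \<partial>lborel)"
proof -
  define f :: "real \<times> real \<Rightarrow> config \<Rightarrow> ennreal" where "f a \<omega> = indicator {\<omega>. P a \<omega>} \<omega>" for a \<omega>
  have f_eq: "f = (\<lambda>a \<omega>. if P a \<omega> then 1 else 0)" by (auto simp: f_def indicator_def fun_eq_iff)
  have m [measurable]: "case_prod f \<in> borel_measurable (borel \<Otimes>\<^sub>M config_space)"
    unfolding f_eq case_prod_beta' by measurable
  have Pa: "Measurable.pred config_space (P a)" for a
    using measurable_compose[OF measurable_Pair[OF measurable_const measurable_ident_sets[OF refl]] P] by simp
  have "emeasure config_space {\<omega>. E \<omega>} = (\<integral>\<^sup>+\<omega>. indicator {\<omega>. E \<omega>} \<omega> \<partial>config_space)"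
    using E by (subst nn_integral_indicator) (auto simp: pred_def)
  also have "\<dots> = (\<integral>\<^sup>+\<omega>. (\<integral>\<^sup>+n. f (snd \<omega> n) (del n \<omega>) * indicator (idx \<omega>) n \<partial>count_space UNIV) \<partial>config_space)"
  proof (rule nn_integral_cong_AE, use ex unique in eventually_elim)
    fix \<omega>
    assume ex: "E \<omega> \<longleftrightarrow> (\<exists>n\<in>idx \<omega>. P (snd \<omega> n) (del n \<omega>))"
      and unique: "\<forall>n\<in>idx \<omega>. \<forall>m\<in>idx \<omega>. P (snd \<omega> n) (del n \<omega>) \<longrightarrow> P (snd \<omega> m) (del m \<omega>) \<longrightarrow> n = m"
    show "indicator {\<omega>. E \<omega>} \<omega> = (\<integral>\<^sup>+n. f (snd \<omega> n) (del n \<omega>) * indicator (idx \<omega>) n \<partial>count_space UNIV)"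
    proof (cases "E \<omega>")
      case True
      then obtain n where n: "n \<in> idx \<omega>" "P (snd \<omega> n) (del n \<omega>)" using ex by blast
      have "(\<integral>\<^sup>+n. f (snd \<omega> n) (del n \<omega>) * indicator (idx \<omega>) n \<partial>count_space UNIV) =
        (\<integral>\<^sup>+m. indicator {n} m \<partial>count_space UNIV)"
        using n unique by (intro nn_integral_cong) (auto simp: f_def indicator_def)
      then show ?thesis using True by simp
    next
      case False
      then have "(\<integral>\<^sup>+n. f (snd \<omega> n) (del n \<omega>) * indicator (idx \<omega>) n \<partial>count_space UNIV) =
        (\<integral>\<^sup>+m. 0 \<partial>count_space (UNIV :: (nat \<times> nat) set))"
        using ex by (intro nn_integral_cong) (auto simp: f_def indicator_def)
      then show ?thesis using False by simp
    qed
  qed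
  also have "\<dots> = (\<integral>\<^sup>+a. (\<integral>\<^sup>+\<omega>. f a \<omega> \<partial>config_space) * indicator strip a \<partial>lborel)"
    by (rule mecke[OF m])
  also have "\<dots> = (\<integral>\<^sup>+a. emeasure config_space {\<omega>. P a \<omega>} * indicator strip a \<partial>lborel)"
    using Pa by (intro nn_integral_cong) (auto simp: f_def pred_def)
  finally show ?thesis .
qed

text \<open>Collects the almost sure properties on which the deterministic arguments about single
  configurations rest. The finiteness clause allows minimisers to be chosen although infinitely many
  points may lie further below.\<close>

definition generic :: "(real \<times> real) set \<Rightarrow> bool" where
  "generic X \<longleftrightarrow> X \<subseteq> {0<..<1} \<times> {..<0} \<and> (\<forall>T. finite {a \<in> X. T \<le> snd a}) \<and> inj_on fst X \<and> inj_on snd X"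

lemma AE_lborel_pair_coords:
  fixes x y :: real
  shows "AE a :: real \<times> real in lborel. fst a \<noteq> x" "AE a :: real \<times> real in lborel. snd a \<noteq> y"
proof -
  have "{x} \<times> UNIV \<in> null_sets (lborel \<Otimes>\<^sub>M lborel :: (real \<times> real) measure)"
    unfolding null_sets_def by (auto simp: lborel.emeasure_pair_measure_Times)
  then have "{x} \<times> UNIV \<in> null_sets (lborel :: (real \<times> real) measure)"
    unfolding lborel_prod .
  then show "AE a :: real \<times> real in lborel. fst a \<noteq> x"
    by (intro AE_I'[of "{x} \<times> UNIV"]) auto
  have "UNIV \<times> {y} \<in> null_sets (lborel \<Otimes>\<^sub>M lborel :: (real \<times> real) measure)"
    unfolding null_sets_def by (auto simp: lborel.emeasure_pair_measure_Times)
  then have "UNIV \<times> {y} \<in> null_sets (lborel :: (real \<times> real) measure)"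
    unfolding lborel_prod .
  then show "AE a :: real \<times> real in lborel. snd a \<noteq> y"
    by (intro AE_I'[of "UNIV \<times> {y}"]) auto
qed

lemma AE_points_pred:
  assumes [measurable]: "Measurable.pred borel P" and "AE a in lborel. a \<in> strip \<longrightarrow> P a"
  shows "AE \<omega> in config_space. \<forall>n\<in>idx \<omega>. P (snd \<omega> n)"
  by (rule mecke_AE[where P = "\<lambda>a _. P a"]) (use assms(2) in \<open>auto elim!: eventually_mono\<close>)

lemma AE_in_strip: "AE \<omega> in config_space. pts \<omega> \<subseteq> {0<..<1} \<times> {..<0}"
proof -
  have "AE a in lborel. a \<in> strip \<longrightarrow> 0 < fst a \<and> fst a < (1::real) \<and> snd a < (0::real)"
    using AE_lborel_pair_coords(1)[of 0] AE_lborel_pair_coords(1)[of 1] AE_lborel_pair_coords(2)[of 0]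
    by eventually_elim (auto simp: strip_def less_le)
  then have "AE \<omega> in config_space. \<forall>n\<in>idx \<omega>. 0 < fst (snd \<omega> n) \<and> fst (snd \<omega> n) < 1 \<and> snd (snd \<omega> n) < 0"
    by (rule AE_points_pred[rotated]) measurable
  then show ?thesis by eventually_elim (simp add: pts_def image_subset_iff mem_Times_iff)
qed

text \<open>By the Mecke formula the mean number of atoms in \<open>A\<close> is the area of
  \<open>A \<inter> strip\<close>, and a count with finite mean is almost surely finite.\<close>

lemma AE_finite_idx:
  assumes A [measurable]: "A \<in> sets borel" and fin: "emeasure lborel (A \<inter> strip) < \<infinity>"
  shows "AE \<omega> in config_space. finite {n \<in> idx \<omega>. snd \<omega> n \<in> A}"
proof -
  have m: "case_prod (\<lambda>a \<omega>. indicator A a :: ennreal) \<in> borel_measurable (borel \<Otimes>\<^sub>M config_space)"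
    unfolding case_prod_beta' by measurable
  have eq: "indicator A (snd \<omega> n) * indicator (idx \<omega>) n = (indicator {n \<in> idx \<omega>. snd \<omega> n \<in> A} n :: ennreal)" for \<omega> n
    by (auto simp: indicator_def)
  have m2: "(\<lambda>\<omega>. indicator {n \<in> idx \<omega>. snd \<omega> n \<in> A} n :: ennreal) \<in> borel_measurable config_space" for n
  proof -
    have "(\<lambda>\<omega>. indicator {n \<in> idx \<omega>. snd \<omega> n \<in> A} n :: ennreal) = (\<lambda>\<omega>. if n \<in> idx \<omega> then indicator A (snd \<omega> n) else 0)"
      by (auto simp: fun_eq_iff indicator_def)
    then show ?thesis by simp
  qed
  have m3: "(\<lambda>\<omega>. \<integral>\<^sup>+n. indicator {n \<in> idx \<omega>. snd \<omega> n \<in> A} n \<partial>count_space UNIV) \<in> borel_measurable config_space"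
  proof -
    interpret sigma_finite_measure "count_space (UNIV :: (nat \<times> nat) set)"
      by (rule sigma_finite_measure_count_space)
    show ?thesis
      by (rule borel_measurable_nn_integral, unfold case_prod_beta',
          rule measurable_compose_countable[OF measurable_compose[OF measurable_fst m2] measurable_snd])
  qed
  have "(\<integral>\<^sup>+\<omega>. (\<integral>\<^sup>+n. indicator {n \<in> idx \<omega>. snd \<omega> n \<in> A} n \<partial>count_space UNIV) \<partial>config_space) =
    (\<integral>\<^sup>+a. indicator A a * indicator strip a \<partial>lborel)"
    using mecke[OF m] by (simp add: eq cfg.emeasure_space_1[simplified])
  also have "\<dots> = emeasure lborel (A \<inter> strip)"
    by (simp add: indicator_inter_arith[symmetric])
  finally have "(\<integral>\<^sup>+\<omega>. (\<integral>\<^sup>+n. indicator {n \<in> idx \<omega>. snd \<omega> n \<in> A} n \<partial>count_space UNIV) \<partial>config_space) \<noteq> \<infinity>"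
    using fin by auto
  then have "AE \<omega> in config_space. (\<integral>\<^sup>+n. indicator {n \<in> idx \<omega>. snd \<omega> n \<in> A} n \<partial>count_space UNIV) \<noteq> \<infinity>"
    by (rule nn_integral_PInf_AE[OF m3])
  then show ?thesis
    by eventually_elim (auto simp: emeasure_count_space split: if_splits)
qed

text \<open>The Mecke formula is used twice: for a fixed \<open>a\<close> no atom shares a
  coordinate with it, and then \<open>a\<close> is replaced by an atom and the configuration by the
  remaining atoms.\<close>

lemma AE_distinct:
  "AE \<omega> in config_space. \<forall>n\<in>idx \<omega>. \<forall>m\<in>idx \<omega>. n \<noteq> m \<longrightarrow> 
     fst (snd \<omega> n) \<noteq> fst (snd \<omega> m) \<and> snd (snd \<omega> n) \<noteq> snd (snd \<omega> m)"
proof -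
  have "AE \<omega> in config_space. \<forall>n\<in>idx \<omega>. \<forall>b\<in>pts (del n \<omega>). fst b \<noteq> fst (snd \<omega> n) \<and> snd b \<noteq> snd (snd \<omega> n)"
  proof (rule mecke_AE[where P = "\<lambda>a \<omega>. \<forall>b\<in>pts \<omega>. fst b \<noteq> fst a \<and> snd b \<noteq> snd a"])
    have "AE \<omega> in config_space. \<forall>b\<in>pts \<omega>. fst b \<noteq> fst a \<and> snd b \<noteq> snd a" for a
    proof -
      have "AE \<omega> in config_space. \<forall>n\<in>idx \<omega>. fst (snd \<omega> n) \<noteq> fst a \<and> snd (snd \<omega> n) \<noteq> snd a"
      proof (rule AE_points_pred)
        show "AE b in lborel. b \<in> strip \<longrightarrow> fst b \<noteq> fst a \<and> snd b \<noteq> snd a"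
          using AE_lborel_pair_coords(1)[of "fst a"] AE_lborel_pair_coords(2)[of "snd a"] by eventually_elim auto
      qed measurable
      then show ?thesis by eventually_elim (auto simp: pts_def)
    qed
    then show "AE a in lborel. a \<in> strip \<longrightarrow> (AE \<omega> in config_space. \<forall>b\<in>pts \<omega>. fst b \<noteq> fst a \<and> snd b \<noteq> snd a)"
      by simp
  qed measurable
  then show ?thesis
  proof eventually_elim
    fix \<omega> assume *: "\<forall>n\<in>idx \<omega>. \<forall>b\<in>pts (del n \<omega>). fst b \<noteq> fst (snd \<omega> n) \<and> snd b \<noteq> snd (snd \<omega> n)"
    show "\<forall>n\<in>idx \<omega>. \<forall>m\<in>idx \<omega>. n \<noteq> m \<longrightarrow> 
     fst (snd \<omega> n) \<noteq> fst (snd \<omega> m) \<and> snd (snd \<omega> n) \<noteq> snd (snd \<omega> m)"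
    proof (intro ballI impI)
      fix n m assume nm: "n \<in> idx \<omega>" "m \<in> idx \<omega>" "n \<noteq> m"
      then have "m \<in> skip n ` idx (del n \<omega>)" by (simp add: skip_image_idx_del)
      then have "snd \<omega> m \<in> pts (del n \<omega>)" by (auto simp: pts_def del_def)
      with * nm(1) show "fst (snd \<omega> n) \<noteq> fst (snd \<omega> m) \<and> snd (snd \<omega> n) \<noteq> snd (snd \<omega> m)"
        by fastforce
    qed
  qed
qed

lemma emeasure_strip_rect:
  assumes "0 \<le> z" "z \<le> w" "w \<le> 1" "y \<le> 0"
  shows "emeasure lborel ({z..<w} \<times> {y<..} \<inter> strip) = ennreal ((w - z) * (- y))"
    "emeasure lborel ({z..<w} \<times> {y..} \<inter> strip) = ennreal ((w - z) * (- y))"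
proof -
  have 1: "{z..<w} \<times> {y<..} \<inter> strip = {z..<w} \<times> {y<..0}" "{z..<w} \<times> {y..} \<inter> strip = {z..<w} \<times> {y..0}"
    using assms by (auto simp: strip_def)
  show "emeasure lborel ({z..<w} \<times> {y<..} \<inter> strip) = ennreal ((w - z) * (- y))"
    "emeasure lborel ({z..<w} \<times> {y..} \<inter> strip) = ennreal ((w - z) * (- y))"
    unfolding 1 using assms
    by (simp_all add: lborel_prod[symmetric] lborel.emeasure_pair_measure_Times ennreal_mult[symmetric])
qed

lemma AE_generic: "AE \<omega> in config_space. inj_on (snd \<omega>) (idx \<omega>) \<and> generic (pts \<omega>)"
proof -
  have "AE \<omega> in config_space. finite {n \<in> idx \<omega>. snd \<omega> n \<in> UNIV \<times> {- real T..}}" for T :: nat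
  proof (rule AE_finite_idx)
    have "UNIV \<times> {- real T..} \<inter> strip = {0..1} \<times> {- real T..0}" by (auto simp: strip_def)
    then show "emeasure lborel (UNIV \<times> {- real T..} \<inter> strip) < \<infinity>"
      by (simp add: lborel_prod[symmetric] lborel.emeasure_pair_measure_Times)
  qed (auto intro: borel_Times)
  then have "AE \<omega> in config_space. \<forall>T::nat. finite {n \<in> idx \<omega>. snd \<omega> n \<in> UNIV \<times> {- real T..}}"
    by (simp add: AE_all_countable)
  then show ?thesis using AE_in_strip AE_distinct
  proof eventually_elim
    fix \<omega>
    assume fin: "\<forall>T::nat. finite {n \<in> idx \<omega>. snd \<omega> n \<in> UNIV \<times> {- real T..}}"
      and sub: "pts \<omega> \<subseteq> {0<..<1} \<times> {..<0}"
      and dist: "\<forall>n\<in>idx \<omega>. \<forall>m\<in>idx \<omega>. n \<noteq> m \<longrightarrow> fst (snd \<omega> n) \<noteq> fst (snd \<omega> m) \<and> snd (snd \<omega> n) \<noteq> snd (snd \<omega> m)"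
    have "finite {a \<in> pts \<omega>. T \<le> snd a}" for T
    proof -
      obtain k :: nat where "-T \<le> real k" using real_arch_simple by blast
      then have "{a \<in> pts \<omega>. T \<le> snd a} \<subseteq> snd \<omega> ` {n \<in> idx \<omega>. snd \<omega> n \<in> UNIV \<times> {- real k..}}"
        unfolding pts_def by (auto simp: mem_Times_iff)
      with fin show ?thesis by (meson finite_imageI finite_subset)
    qed
    moreover have "inj_on (snd \<omega>) (idx \<omega>)" "inj_on fst (pts \<omega>)" "inj_on snd (pts \<omega>)"
    proof -
      show "inj_on (snd \<omega>) (idx \<omega>)" by (rule inj_onI) (use dist in metis)
      show "inj_on fst (pts \<omega>)" unfolding pts_def
        by (rule inj_onI, elim imageE) (use dist in metis)
      show "inj_on snd (pts \<omega>)" unfolding pts_def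
        by (rule inj_onI, elim imageE) (use dist in metis)
    qed
    ultimately show "inj_on (snd \<omega>) (idx \<omega>) \<and> generic (pts \<omega>)"
      using sub by (simp add: generic_def)
  qed
qed

section \<open>The generating functions of the record counts\<close>

text \<open>\<open>stirling k j / fact k\<close> is the probability that a random permutation of
  \<open>k\<close> points has \<open>j\<close> records; mixing over a Poisson number of points with
  mean \<open>t\<close> gives \<open>exp (- t) * rec_gf j t\<close>, which is
  \<open>p_fun j t\<close>.\<close>

definition rec_coeff :: "nat \<Rightarrow> nat \<Rightarrow> real" where
  "rec_coeff j k = real (stirling k j) / (fact k * fact k)"

definition rec_gf :: "nat \<Rightarrow> real \<Rightarrow> real" where
  "rec_gf j t = (\<Sum>k. rec_coeff j k * t ^ k)"

definition rec_gf' :: "nat \<Rightarrow> real \<Rightarrow> real" where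
  "rec_gf' j t = (\<Sum>k. diffs (rec_coeff j) k * t ^ k)"

lemma stirling_le_fact: "stirling n k \<le> fact n"
proof (cases "k \<le> n")
  case True
  then have "stirling n k \<le> (\<Sum>k\<le>n. stirling n k)" by (intro member_le_sum) auto
  then show ?thesis by (simp add: sum_stirling)
qed simp

lemma rec_coeff_nonneg: "0 \<le> rec_coeff j k"
  by (simp add: rec_coeff_def)

text \<open>\<open>stirling k j \<le> fact k\<close> bounds the series by the exponential series, so
  it converges for all \<open>t\<close> and may be differentiated termwise.\<close>

lemma summable_rec_coeff: "summable (\<lambda>k. rec_coeff j k * t ^ k)"
proof (rule summable_comparison_test')
  show "summable (\<lambda>k. \<bar>t\<bar> ^ k / fact k)"
    using summable_exp[of "\<bar>t\<bar>"] by (simp add: field_simps)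
  fix k :: nat
  have "real (stirling k j) \<le> fact k"
    using of_nat_mono[OF stirling_le_fact[of k j], where 'a = real] by simp
  then have "real (stirling k j) / fact k \<le> 1"
    by (simp add: divide_le_eq)
  then have "real (stirling k j) / fact k * (\<bar>t\<bar> ^ k / fact k) \<le> 1 * (\<bar>t\<bar> ^ k / fact k)"
    by (intro mult_right_mono) auto
  then show "norm (rec_coeff j k * t ^ k) \<le> \<bar>t\<bar> ^ k / fact k"
    by (simp add: rec_coeff_def abs_mult power_abs)
qed

lemma summable_diffs_rec_coeff: "summable (\<lambda>k. diffs (rec_coeff j) k * t ^ k)"
  by (rule termdiff_converges_all) (rule summable_rec_coeff)

lemma p_fun_eq: "p_fun j t = exp (- t) * rec_gf j t"
  by (simp add: p_fun_def rec_gf_def rec_coeff_def field_simps)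

lemma DERIV_rec_gf: "(rec_gf j has_real_derivative rec_gf' j t) (at t)"
  unfolding rec_gf_def[abs_def] rec_gf'_def
  by (rule termdiffs_strong_converges_everywhere) (rule summable_rec_coeff)

lemma DERIV_rec_gf_chain [derivative_intros]:
  assumes "(f has_real_derivative f') (at x)"
  shows "((\<lambda>x. rec_gf j (f x)) has_real_derivative rec_gf' j (f x) * f') (at x)"
  using DERIV_chain2[OF DERIV_rec_gf assms] .

lemma rec_gf_nonneg: "0 \<le> t \<Longrightarrow> 0 \<le> rec_gf j t"
  unfolding rec_gf_def by (intro suminf_nonneg summable_rec_coeff) (simp add: rec_coeff_nonneg)

lemma rec_gf'_nonneg: "0 \<le> t \<Longrightarrow> 0 \<le> rec_gf' j t"
  unfolding rec_gf'_def
  by (intro suminf_nonneg summable_diffs_rec_coeff) (simp add: diffs_def rec_coeff_nonneg)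

lemma rec_gf_0: "rec_gf 0 t = 1"
proof -
  have "rec_coeff 0 k = (if k = 0 then 1 else 0)" for k
    by (cases k) (simp_all add: rec_coeff_def)
  then show ?thesis unfolding rec_gf_def by (subst suminf_finite[of "{0}"]) auto
qed

lemma rec_gf_Suc_0: "rec_gf (Suc j) 0 = 0"
  unfolding rec_gf_def using powser_zero[of "rec_coeff (Suc j)"] by (simp add: rec_coeff_def)

lemma p_fun_nonneg: "0 \<le> t \<Longrightarrow> 0 \<le> p_fun j t"
  by (simp add: p_fun_eq rec_gf_nonneg)

lemma continuous_rec_gf [continuous_intros]:
  "continuous_on A f \<Longrightarrow> continuous_on A (\<lambda>x. rec_gf j (f x))"
  by (rule continuous_on_compose2[of UNIV "rec_gf j"])
     (auto intro!: DERIV_continuous_on DERIV_subset[OF DERIV_rec_gf])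

lemma DERIV_rec_gf': "(rec_gf' j has_real_derivative (\<Sum>k. diffs (diffs (rec_coeff j)) k * t ^ k)) (at t)"
  unfolding rec_gf'_def[abs_def]
  by (rule termdiffs_strong_converges_everywhere) (rule summable_diffs_rec_coeff)

lemma continuous_rec_gf' [continuous_intros]:
  "continuous_on A f \<Longrightarrow> continuous_on A (\<lambda>x. rec_gf' j (f x))"
  by (rule continuous_on_compose2[of UNIV "rec_gf' j"])
     (auto intro!: DERIV_continuous_on DERIV_subset[OF DERIV_rec_gf'])

lemma continuous_p_fun [continuous_intros]:
  "continuous_on A f \<Longrightarrow> continuous_on A (\<lambda>x. p_fun j (f x))"
  unfolding p_fun_eq by (intro continuous_intros)

lemma measurable_p_fun [measurable]: "p_fun j \<in> borel_measurable borel"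
  by (intro borel_measurable_continuous_onI continuous_intros)

lemma measurable_rec_gf' [measurable]: "rec_gf' j \<in> borel_measurable borel"
  by (intro borel_measurable_continuous_onI continuous_intros)

text \<open>The antiderivative of \<open>p_fun j\<close> that vanishes at 0, in closed form; for
  \<open>t > 0\<close> it equals \<open>t * q_fun j t\<close>. Thus \<open>q_fun j\<close> is
  \<open>exp (- t)\<close> times the derivative of the next generating function.\<close>

definition p_int :: "nat \<Rightarrow> real \<Rightarrow> real" where
  "p_int j t = t * exp (- t) * rec_gf' (Suc j) t"

text \<open>The Stirling recurrence, read as \<open>t G'' + (1 - t) G' = F\<close> for the generating functions
  \<open>G\<close> of index \<open>Suc j\<close> and \<open>F\<close> of index \<open>j\<close>.\<close>

lemma DERIV_p_int: "(p_int j has_real_derivative p_fun j t) (at t)"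
proof -
  define c where "c = rec_coeff (Suc j)"
  define D where "D = (\<Sum>k. diffs c k * t ^ k)"
  define D' where "D' = (\<Sum>k. diffs (diffs c) k * t ^ k)"
  have sD: "(\<lambda>k. diffs c k * t ^ k) sums D"
    unfolding D_def c_def by (rule summable_sums) (rule summable_diffs_rec_coeff)
  have sD': "(\<lambda>k. diffs (diffs c) k * t ^ k) sums D'"
    unfolding D'_def c_def
    by (rule summable_sums, rule termdiff_converges_all) (rule summable_diffs_rec_coeff)
  have shift: "(\<lambda>k. real k * b k * t ^ k) sums (t * S)" if "(\<lambda>k. diffs b k * t ^ k) sums S" for b S
  proof -
    have "(\<lambda>k. real (Suc k) * b (Suc k) * t ^ Suc k) sums (t * S)"
      using sums_mult[OF that, of t] by (simp add: diffs_def mult_ac)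
    then show ?thesis using sums_Suc_iff[of "\<lambda>k. real k * b k * t ^ k" "t * S"] by simp
  qed
  have "(\<lambda>k. diffs c k * t ^ k + real k * diffs c k * t ^ k - real k * c k * t ^ k) sums (D + t * D' - t * D)"
    by (intro sums_add sums_diff sD shift sD')
  also have "(\<lambda>k. diffs c k * t ^ k + real k * diffs c k * t ^ k - real k * c k * t ^ k) = (\<lambda>k. rec_coeff j k * t ^ k)"
  proof
    fix k
    have "real (Suc k) * real (Suc k) * c (Suc k) = real k * c k + rec_coeff j k"
    proof -
      have "real (Suc k) * real (Suc k) * c (Suc k) = real (stirling (Suc k) (Suc j)) / (fact k * fact k)"
        by (simp add: c_def rec_coeff_def del: of_nat_Suc stirling.simps)
      then show ?thesis by (simp add: c_def rec_coeff_def add_divide_distrib)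
    qed
    then have "diffs c k + real k * diffs c k - real k * c k = rec_coeff j k"
      by (simp add: diffs_def algebra_simps)
    then show "diffs c k * t ^ k + real k * diffs c k * t ^ k - real k * c k * t ^ k = rec_coeff j k * t ^ k"
      by (metis (no_types, lifting) distrib_right left_diff_distrib)
  qed
  finally have "D + t * D' - t * D = rec_gf j t"
    unfolding rec_gf_def by (simp add: sums_unique)
  moreover have "(p_int j has_real_derivative exp (- t) * (D + t * D' - t * D)) (at t)"
    unfolding p_int_def[abs_def]
    by (rule derivative_eq_intros DERIV_rec_gf' refl)+
       (simp add: D_def D'_def c_def rec_gf'_def algebra_simps)
  ultimately show ?thesis by (simp add: p_fun_eq)
qed

lemma DERIV_p_int_chain [derivative_intros]:
  assumes "(f has_real_derivative f') (at x)"
  shows "((\<lambda>x. p_int j (f x)) has_real_derivative p_fun j (f x) * f') (at x)"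
  using DERIV_chain2[OF DERIV_p_int assms] .

lemma p_int_0 [simp]: "p_int j 0 = 0"
  by (simp add: p_int_def)

lemma p_int_nonneg: "0 \<le> t \<Longrightarrow> 0 \<le> p_int j t"
  by (simp add: p_int_def rec_gf'_nonneg)

lemma q_fun_eq:
  assumes "0 < t"
  shows "q_fun j t = p_int j t / t" "q_fun j t = exp (- t) * rec_gf' (Suc j) t"
proof -
  have "(p_fun j has_integral p_int j t - p_int j 0) {0..t}"
    using assms
    by (intro fundamental_theorem_of_calculus)
       (auto simp: has_real_derivative_iff_has_vector_derivative[symmetric] intro: DERIV_subset[OF DERIV_p_int])
  then show "q_fun j t = p_int j t / t"
    by (simp add: q_fun_def integral_unique)
  then show "q_fun j t = exp (- t) * rec_gf' (Suc j) t"
    using assms by (simp add: p_int_def)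
qed

text \<open>Adding \<open>DERIV_p_int\<close> cancels the last term:
  \<open>p_fun j + p_int j\<close> has derivative \<open>exp (- t) * rec_gf' j t\<close>, which for
  \<open>j > 0\<close> and \<open>t > 0\<close> is \<open>q_fun (j - 1) t\<close>. This is the
  antiderivative behind the average of the jump terms over the line.\<close>

lemma DERIV_p_fun: "(p_fun j has_real_derivative exp (- t) * rec_gf' j t - p_fun j t) (at t)"
proof -
  have "((\<lambda>t. exp (- t) * rec_gf j t) has_real_derivative exp (- t) * rec_gf' j t - exp (- t) * rec_gf j t) (at t)"
    by (rule derivative_eq_intros refl)+ simp
  then show ?thesis by (simp add: p_fun_eq[abs_def])
qed

lemma p_fun_0: "p_fun 0 t = exp (- t)"
  by (simp add: p_fun_eq rec_gf_0)

lemma p_fun_Suc_0: "p_fun (Suc j) 0 = 0"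
  by (simp add: p_fun_eq rec_gf_Suc_0)

lemma nn_integral_p_fun_scaled:
  assumes "0 \<le> v" "0 < c"
  shows "(\<integral>\<^sup>+u. ennreal (p_fun j (c * u)) * indicator {0..v} u \<partial>lborel) = ennreal (p_int j (c * v) / c)"
proof -
  have "(\<integral>\<^sup>+u. ennreal (p_fun j (c * u)) * indicator {0..v} u \<partial>lborel) = p_int j (c * v) / c - p_int j (c * 0) / c"
    using assms
    by (intro nn_integral_FTC_Icc)
       (auto intro!: derivative_eq_intros DERIV_subset[OF DERIV_p_int] p_fun_nonneg)
  then show ?thesis by simp
qed

lemma nn_integral_reflect:
  fixes f :: "real \<Rightarrow> ennreal"
  assumes [measurable]: "f \<in> borel_measurable borel"
  shows "(\<integral>\<^sup>+y. f y \<partial>lborel) = (\<integral>\<^sup>+u. f (- u) \<partial>lborel)"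
  using nn_integral_real_affine[OF assms, of "-1" 0] by simp

text \<open>The integral splits at the leftmost atom \<open>(x, y')\<close> of a rectangle: the
  exponential is the probability that nothing lies to its left, the second factor the law of the
  records north-east of it. After integration over \<open>y'\<close> the exponentials merge into
  \<open>exp (- ((w - z) * v))\<close>, free of \<open>x\<close>, and a derivative of
  \<open>rec_gf (Suc j)\<close> remains.\<close>

lemma nn_integral_p_fun_rect:
  assumes "z \<le> w" "y \<le> 0"
  shows "(\<integral>\<^sup>+x. (\<integral>\<^sup>+y'. ennreal (exp (- ((x - z) * (- y))) * p_fun j ((w - x) * (- y'))) * indicator {y<..0} y' \<partial>lborel) * indicator {z..<w} x \<partial>lborel) =
    ennreal (p_fun (Suc j) ((w - z) * (- y)))" (is "?L = _")
proof -
  define v where "v = - y"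
  have v: "0 \<le> v" "y = - v" using assms by (auto simp: v_def)
  have inner: "(\<integral>\<^sup>+y'. ennreal (exp (- ((x - z) * (- y))) * p_fun j ((w - x) * (- y'))) * indicator {y<..0} y' \<partial>lborel) = 
     ennreal (v * exp (- ((w - z) * v)) * rec_gf' (Suc j) ((w - x) * v))" if x: "x < w" for x
  proof -
    have "(\<integral>\<^sup>+y'. ennreal (exp (- ((x - z) * (- y))) * p_fun j ((w - x) * (- y'))) * indicator {y<..0} y' \<partial>lborel) =
      (\<integral>\<^sup>+y'. ennreal (exp (- ((x - z) * v))) * (ennreal (p_fun j ((w - x) * (- y'))) * indicator {y<..0} y') \<partial>lborel)"
      using x by (intro nn_integral_cong) (auto simp: v indicator_def ennreal_mult')
    also have "\<dots> = ennreal (exp (- ((x - z) * v))) * (\<integral>\<^sup>+y'. ennreal (p_fun j ((w - x) * (- y'))) * indicator {y<..0} y' \<partial>lborel)"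
      by (rule nn_integral_cmult) measurable
    also have "(\<integral>\<^sup>+y'. ennreal (p_fun j ((w - x) * (- y'))) * indicator {y<..0} y' \<partial>lborel) =
       (\<integral>\<^sup>+u. ennreal (p_fun j ((w - x) * u)) * indicator {y<..0} (- u) \<partial>lborel)"
      by (subst nn_integral_reflect) auto
    also have "\<dots> = (\<integral>\<^sup>+u. ennreal (p_fun j ((w - x) * u)) * indicator {0..v} u \<partial>lborel)"
      by (rule nn_integral_cong_AE, rule AE_mp[OF AE_lborel_singleton[of v]], rule AE_I2) (auto simp: v indicator_def)
    also have "\<dots> = ennreal (p_int j ((w - x) * v) / (w - x))"
      using x v by (intro nn_integral_p_fun_scaled) auto
    also have "ennreal (exp (- ((x - z) * v))) * \<dots> = ennreal (exp (- ((x - z) * v)) * (p_int j ((w - x) * v) / (w - x)))"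
      by (rule ennreal_mult'[symmetric]) simp
    also have "exp (- ((x - z) * v)) * (p_int j ((w - x) * v) / (w - x)) = 
        v * (exp (- ((x - z) * v)) * exp (- ((w - x) * v))) * rec_gf' (Suc j) ((w - x) * v)"
      using x by (simp add: p_int_def)
    also have "exp (- ((x - z) * v)) * exp (- ((w - x) * v)) = exp (- ((w - z) * v))"
      by (simp add: exp_add[symmetric] algebra_simps)
    finally show ?thesis .
  qed
  have "?L = (\<integral>\<^sup>+x. ennreal (v * exp (- ((w - z) * v)) * rec_gf' (Suc j) ((w - x) * v)) * indicator {z..w} x \<partial>lborel)"
  proof (rule nn_integral_cong_AE, rule AE_mp[OF AE_lborel_singleton[of w]], rule AE_I2, rule impI)
    fix x assume "x \<noteq> w"
    show "(\<integral>\<^sup>+y'. ennreal (exp (- ((x - z) * (- y))) * p_fun j ((w - x) * (- y'))) * indicator {y<..0} y' \<partial>lborel) * indicator {z..<w} x =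
      ennreal (v * exp (- ((w - z) * v)) * rec_gf' (Suc j) ((w - x) * v)) * indicator {z..w} x"
    proof (cases "z \<le> x \<and> x < w")
      case True
      then show ?thesis by (subst inner) auto
    qed (use \<open>x \<noteq> w\<close> in \<open>auto simp: indicator_def\<close>)
  qed
  \<comment> \<open>The antiderivative in \<open>x\<close> contains the factor
    \<open>rec_gf (Suc j) ((w - x) * v)\<close>, so its value at \<open>x = w\<close>
    vanishes.\<close>
  also have "\<dots> = ennreal ((- exp (- ((w - z) * v)) * rec_gf (Suc j) ((w - w) * v)) - (- exp (- ((w - z) * v)) * rec_gf (Suc j) ((w - z) * v)))"
    using assms v
    by (intro nn_integral_FTC_Icc)
       (auto intro!: derivative_eq_intros DERIV_subset[OF DERIV_rec_gf_chain] rec_gf'_nonneg mult_nonneg_nonneg)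
  also have "\<dots> = ennreal (p_fun (Suc j) ((w - z) * (- y)))"
    by (simp add: rec_gf_Suc_0 p_fun_eq v)
  finally show ?thesis .
qed

section \<open>Void probabilities and records in a rectangle\<close>

text \<open>Finiteness is recorded because \<open>card\<close> of an infinite set is 0, so that
  infinitely many records would otherwise pass for none.\<close>

definition num :: "'a set \<Rightarrow> nat \<Rightarrow> bool" where
  "num S j \<longleftrightarrow> finite S \<and> card S = j"

lemma num_0 [simp]: "num S 0 \<longleftrightarrow> S = {}"
  by (auto simp: num_def)

lemma num_insert: "a \<notin> S \<Longrightarrow> num (insert a S) j \<longleftrightarrow> j \<noteq> 0 \<and> num S (j - 1)"
  by (cases j) (auto simp: num_def)

lemma num_remove: "a \<in> S \<Longrightarrow> num (S - {a}) j \<longleftrightarrow> num S (Suc j)"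
  using num_insert[of a "S - {a}" "Suc j"] by (simp add: insert_absorb)

lemma pred_num_pts [measurable]:
  assumes "f \<in> measurable M config_space"
    "\<And>n. Measurable.pred M (\<lambda>x. P x (snd (f x) n))"
  shows "Measurable.pred M (\<lambda>x. num {a\<in>pts (f x). P x a} j)"
  unfolding num_def by (rule pred_card_pts) (use assms in auto)

text \<open>Passes from indices to point sets: almost surely deleting an index amounts to forming
  \<open>X - {a}\<close>, so existence and uniqueness of the distinguished atom become deterministic
  statements about generic sets.\<close>

lemma mecke_generic:
  assumes P: "Measurable.pred (borel \<Otimes>\<^sub>M config_space) (\<lambda>x. P (fst x) (pts (snd x)))"
    and E: "Measurable.pred config_space (\<lambda>\<omega>. E (pts \<omega>))"
    and ex: "\<And>X. generic X \<Longrightarrow> E X \<longleftrightarrow> (\<exists>a\<in>X. P a (X - {a}))"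
    and unique: "\<And>X a b. generic X \<Longrightarrow> a \<in> X \<Longrightarrow> b \<in> X \<Longrightarrow> P a (X - {a}) \<Longrightarrow> P b (X - {b}) \<Longrightarrow> a = b"
  shows "emeasure config_space {\<omega>. E (pts \<omega>)} =
    (\<integral>\<^sup>+a. emeasure config_space {\<omega>. P a (pts \<omega>)} * indicator strip a \<partial>lborel)"
proof (rule mecke_unique[where P = "\<lambda>a \<omega>. P a (pts \<omega>)", OF P E])
  show "AE \<omega> in config_space. E (pts \<omega>) \<longleftrightarrow> (\<exists>n\<in>idx \<omega>. P (snd \<omega> n) (pts (del n \<omega>)))"
    using AE_generic
  proof eventually_elim
    fix \<omega> assume g: "inj_on (snd \<omega>) (idx \<omega>) \<and> generic (pts \<omega>)"
    have "(\<exists>n\<in>idx \<omega>. P (snd \<omega> n) (pts (del n \<omega>))) \<longleftrightarrow> (\<exists>n\<in>idx \<omega>. P (snd \<omega> n) (pts \<omega> - {snd \<omega> n}))"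
      using g by (intro bex_cong) (auto simp: pts_del)
    then show "E (pts \<omega>) \<longleftrightarrow> (\<exists>n\<in>idx \<omega>. P (snd \<omega> n) (pts (del n \<omega>)))"
      using g ex[of "pts \<omega>"] by (simp add: pts_def)
  qed
  show "AE \<omega> in config_space. \<forall>n\<in>idx \<omega>. \<forall>m\<in>idx \<omega>.
      P (snd \<omega> n) (pts (del n \<omega>)) \<longrightarrow> P (snd \<omega> m) (pts (del m \<omega>)) \<longrightarrow> n = m"
    using AE_generic
  proof eventually_elim
    fix \<omega> assume g: "inj_on (snd \<omega>) (idx \<omega>) \<and> generic (pts \<omega>)"
    show "\<forall>n\<in>idx \<omega>. \<forall>m\<in>idx \<omega>. P (snd \<omega> n) (pts (del n \<omega>)) \<longrightarrow> P (snd \<omega> m) (pts (del m \<omega>)) \<longrightarrow> n = m"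
    proof (intro ballI impI)
      fix n m assume nm: "n \<in> idx \<omega>" "m \<in> idx \<omega>" and P: "P (snd \<omega> n) (pts (del n \<omega>))" "P (snd \<omega> m) (pts (del m \<omega>))"
      have "snd \<omega> n = snd \<omega> m"
        using P nm g by (intro unique[of "pts \<omega>"]) (simp_all add: pts_del, simp_all add: pts_def)
      then show "n = m" using g nm by (meson inj_onD)
    qed
  qed
qed

text \<open>Counts the atoms of \<open>A\<close> whose removal leaves \<open>n\<close> atoms in
  \<open>A\<close>: if \<open>A\<close> contains \<open>Suc n\<close> atoms, each of them qualifies,
  otherwise none does. The result is the recurrence of the Poisson distribution.\<close>

lemma mecke_count:
  assumes A [measurable]: "A \<in> sets borel" and fin: "emeasure lborel (A \<inter> strip) < \<infinity>"
  shows "of_nat (Suc n) * emeasure config_space {\<omega>. num (pts \<omega> \<inter> A) (Suc n)} =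
    emeasure lborel (A \<inter> strip) * emeasure config_space {\<omega>. num (pts \<omega> \<inter> A) n}"
proof -
  define f :: "real \<times> real \<Rightarrow> config \<Rightarrow> ennreal" where
    "f a \<omega> = (if a \<in> A \<and> num (pts \<omega> \<inter> A) n then 1 else 0)" for a \<omega>
  have Int_eq: "pts \<omega> \<inter> A = {a\<in>pts \<omega>. a \<in> A}" for \<omega> by auto
  have numm [measurable]: "Measurable.pred config_space (\<lambda>\<omega>. num (pts \<omega> \<inter> A) k)" for k
    unfolding Int_eq by measurable
  have m: "case_prod f \<in> borel_measurable (borel \<Otimes>\<^sub>M config_space)"
    unfolding f_def case_prod_beta' by measurable
  have "(\<integral>\<^sup>+\<omega>. (\<integral>\<^sup>+m. f (snd \<omega> m) (del m \<omega>) * indicator (idx \<omega>) m \<partial>count_space UNIV) \<partial>config_space) =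
    (\<integral>\<^sup>+\<omega>. of_nat (Suc n) * indicator {\<omega>. num (pts \<omega> \<inter> A) (Suc n)} \<omega> \<partial>config_space)"
  proof (rule nn_integral_cong_AE, use AE_generic AE_finite_idx[OF A fin] in eventually_elim)
    fix \<omega> assume g: "inj_on (snd \<omega>) (idx \<omega>) \<and> generic (pts \<omega>)"
      and fin: "finite {m \<in> idx \<omega>. snd \<omega> m \<in> A}"
    define J where "J = {m \<in> idx \<omega>. snd \<omega> m \<in> A}"
    have J: "pts \<omega> \<inter> A = snd \<omega> ` J" "inj_on (snd \<omega>) J" "finite J"
      using g fin by (auto simp: J_def pts_def intro: inj_on_subset)
    have f: "f (snd \<omega> m) (del m \<omega>) * indicator (idx \<omega>) m =
       indicator J m * indicator {\<omega>. num (pts \<omega> \<inter> A) (Suc n)} \<omega>" for m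
    proof (cases "m \<in> J")
      case True
      then have "pts (del m \<omega>) \<inter> A = (pts \<omega> \<inter> A) - {snd \<omega> m}" "snd \<omega> m \<in> pts \<omega> \<inter> A"
        using g by (auto simp: pts_del J_def, auto simp: pts_def)
      then have "num (pts (del m \<omega>) \<inter> A) n \<longleftrightarrow> num (pts \<omega> \<inter> A) (Suc n)"
        by (simp only: num_remove)
      then show ?thesis using True by (simp add: f_def J_def)
    qed (auto simp: f_def J_def)
    have "(\<integral>\<^sup>+m. f (snd \<omega> m) (del m \<omega>) * indicator (idx \<omega>) m \<partial>count_space UNIV) =
       of_nat (card J) * indicator {\<omega>. num (pts \<omega> \<inter> A) (Suc n)} \<omega>"
      unfolding f using J(3) by (subst nn_integral_multc) auto
    also have "\<dots> = of_nat (Suc n) * indicator {\<omega>. num (pts \<omega> \<inter> A) (Suc n)} \<omega>"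
      using J by (auto simp: num_def indicator_def card_image)
    finally show "(\<integral>\<^sup>+m. f (snd \<omega> m) (del m \<omega>) * indicator (idx \<omega>) m \<partial>count_space UNIV) =
       of_nat (Suc n) * indicator {\<omega>. num (pts \<omega> \<inter> A) (Suc n)} \<omega>" .
  qed
  also have "\<dots> = of_nat (Suc n) * emeasure config_space {\<omega>. num (pts \<omega> \<inter> A) (Suc n)}"
    using numm[of "Suc n"] by (subst nn_integral_cmult_indicator) (auto simp: pred_def)
  finally have L: "(\<integral>\<^sup>+\<omega>. (\<integral>\<^sup>+m. f (snd \<omega> m) (del m \<omega>) * indicator (idx \<omega>) m \<partial>count_space UNIV) \<partial>config_space) =
    of_nat (Suc n) * emeasure config_space {\<omega>. num (pts \<omega> \<inter> A) (Suc n)}" .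
  have inner: "(\<integral>\<^sup>+\<omega>. f a \<omega> \<partial>config_space) = emeasure config_space {\<omega>. num (pts \<omega> \<inter> A) n} * indicator A a" for a
  proof -
    have "f a \<omega> = indicator A a * indicator {\<omega>. num (pts \<omega> \<inter> A) n} \<omega>" for \<omega>
      by (auto simp: f_def indicator_def)
    then show ?thesis
      using numm[of n] by (simp add: nn_integral_cmult_indicator pred_def mult.commute)
  qed
  have "(\<integral>\<^sup>+a. (\<integral>\<^sup>+\<omega>. f a \<omega> \<partial>config_space) * indicator strip a \<partial>lborel) =
    (\<integral>\<^sup>+a. emeasure config_space {\<omega>. num (pts \<omega> \<inter> A) n} * indicator (A \<inter> strip) a \<partial>lborel)"
    by (simp add: inner mult.assoc indicator_inter_arith)
  also have "\<dots> = emeasure config_space {\<omega>. num (pts \<omega> \<inter> A) n} * emeasure lborel (A \<inter> strip)"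
    by (rule nn_integral_cmult_indicator) auto
  finally show ?thesis
    using L mecke[OF m] by (simp only: mult.commute)
qed

text \<open>The recurrence fixes all count probabilities up to the factor \<open>p 0\<close>. Since
  the count is almost surely finite they sum to 1, which gives
  \<open>p 0 * exp a = 1\<close>.\<close>

theorem void_probability:
  assumes A: "A \<in> sets borel" and a: "emeasure lborel (A \<inter> strip) = ennreal a" "0 \<le> a"
  shows "emeasure config_space {\<omega>. pts \<omega> \<inter> A = {}} = ennreal (exp (- a))"
proof -
  define p where "p n = measure config_space {\<omega>. num (pts \<omega> \<inter> A) n}" for n
  have fin: "emeasure lborel (A \<inter> strip) < \<infinity>" using a by simp
  have rec: "real (Suc n) * p (Suc n) = a * p n" for n
  proof -
    have "ennreal (real (Suc n) * p (Suc n)) = ennreal (a * p n)"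
      using mecke_count[OF A fin, of n, unfolded a(1)] a(2)
      by (simp add: cfg.emeasure_eq_measure p_def ennreal_mult' ennreal_of_nat_eq_real_of_nat del: of_nat_Suc)
    then show ?thesis using a(2) by (subst (asm) ennreal_inj) (auto simp: p_def)
  qed
  have p_eq: "p n = p 0 * (a ^ n /\<^sub>R fact n)" for n
  proof (induction n)
    case (Suc n)
    have "real (Suc n) * p (Suc n) = real (Suc n) * (p 0 * (a ^ Suc n /\<^sub>R fact (Suc n)))"
      unfolding rec Suc.IH by (simp add: field_simps del: of_nat_Suc)
    then show ?case by (simp del: of_nat_Suc)
  qed simp
  have Int_eq: "pts \<omega> \<inter> A = {a\<in>pts \<omega>. a \<in> A}" for \<omega> by auto
  have meas: "{\<omega>. num (pts \<omega> \<inter> A) n} \<in> sets config_space" for n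
  proof -
    have "Measurable.pred config_space (\<lambda>\<omega>. num (pts \<omega> \<inter> A) n)"
      unfolding Int_eq using A by measurable
    then show ?thesis by (simp add: pred_def)
  qed
  have "p sums measure config_space (\<Union>n. {\<omega>. num (pts \<omega> \<inter> A) n})"
    unfolding p_def using meas
    by (intro cfg.finite_measure_UNION) (auto simp: disjoint_family_on_def num_def)
  moreover have "measure config_space (\<Union>n. {\<omega>. num (pts \<omega> \<inter> A) n}) = 1"
  proof (rule cfg.prob_eq_1[THEN iffD2])
    show "AE \<omega> in config_space. \<omega> \<in> (\<Union>n. {\<omega>. num (pts \<omega> \<inter> A) n})"
      using AE_finite_idx[OF A fin]
    proof eventually_elim
      fix \<omega> assume "finite {m \<in> idx \<omega>. snd \<omega> m \<in> A}"
      moreover have "pts \<omega> \<inter> A = snd \<omega> ` {m \<in> idx \<omega>. snd \<omega> m \<in> A}" by (auto simp: pts_def)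
      ultimately show "\<omega> \<in> (\<Union>n. {\<omega>. num (pts \<omega> \<inter> A) n})" by (simp add: num_def)
    qed
  qed (use meas in auto)
  ultimately have "p sums 1" by simp
  moreover have "p sums (p 0 * exp a)"
  proof -
    have "(\<lambda>n. p 0 * (a ^ n /\<^sub>R fact n)) sums (p 0 * exp a)"
      by (intro sums_mult exp_converges)
    then show ?thesis by (subst p_eq[abs_def])
  qed
  ultimately have "p 0 * exp a = 1" by (rule sums_unique2[symmetric])
  then have "p 0 = exp (- a)" by (simp add: exp_minus field_simps)
  then show ?thesis by (simp add: p_def cfg.emeasure_eq_measure)
qed

section \<open>Records of a point set inside a half-open rectangle\<close>

definition recs :: "(real \<times> real) set \<Rightarrow> (real \<times> real) set" where
  "recs X = {a \<in> X. \<not> (\<exists>b\<in>X. fst b < fst a \<and> snd b > snd a)}"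

lemma recs_empty [simp]: "recs {} = {}"
  by (simp add: recs_def)

text \<open>Unbounded above because the strip itself ends at height 0; for
  \<open>0 \<le> z \<le> w \<le> 1\<close> and \<open>y \<le> 0\<close> the part in the strip has
  area \<open>(w - z) * (- y)\<close>.\<close>

definition rect :: "real \<Rightarrow> real \<Rightarrow> real \<Rightarrow> (real \<times> real) set" where
  "rect z w y = {z..<w} \<times> {y<..}"

lemma mem_rect [simp]: "a \<in> rect z w y \<longleftrightarrow> z \<le> fst a \<and> fst a < w \<and> y < snd a"
  by (auto simp: rect_def mem_Times_iff)

lemma sets_rect [measurable]: "rect z w y \<in> sets borel"
  unfolding rect_def by (intro borel_Times) auto

lemma generic_finite: "generic X \<Longrightarrow> (\<And>a. a \<in> Y \<Longrightarrow> a \<in> X \<and> T \<le> snd a) \<Longrightarrow> finite Y"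
  unfolding generic_def by (rule finite_subset[of _ "{a \<in> X. T \<le> snd a}"]) auto

lemma generic_fst_eq: "generic X \<Longrightarrow> a \<in> X \<Longrightarrow> b \<in> X \<Longrightarrow> fst a = fst b \<Longrightarrow> a = b"
  unfolding generic_def inj_on_def by blast

lemma generic_snd_eq: "generic X \<Longrightarrow> a \<in> X \<Longrightarrow> b \<in> X \<Longrightarrow> snd a = snd b \<Longrightarrow> a = b"
  unfolding generic_def inj_on_def by blast

lemma generic_mem: "generic X \<Longrightarrow> a \<in> X \<Longrightarrow> 0 < fst a \<and> fst a < 1 \<and> snd a < 0"
  unfolding generic_def by auto

text \<open>Nothing lies to the left of \<open>a\<close>, so it is a record. It dominates all later
  points below it, and a point above \<open>a\<close> can be beaten only by points that are
  themselves above and to the right of \<open>a\<close>.\<close>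

lemma recs_leftmost:
  assumes X: "generic X" and a: "a \<in> X" "a \<in> rect z w y"
    and left: "\<And>b. b \<in> X \<Longrightarrow> b \<in> rect z w y \<Longrightarrow> \<not> fst b < fst a"
  shows "recs (X \<inter> rect z w y) = insert a (recs ((X - {a}) \<inter> rect (fst a) w (snd a)))"
proof (intro equalityI subsetI)
  fix r assume r: "r \<in> recs (X \<inter> rect z w y)"
  then have rX: "r \<in> X" "r \<in> rect z w y" by (auto simp: recs_def)
  show "r \<in> insert a (recs ((X - {a}) \<inter> rect (fst a) w (snd a)))"
  proof (cases "r = a")
    case False
    then have "fst a < fst r" using left[OF rX] generic_fst_eq[OF X a(1) rX(1)] by force
    moreover have "snd a < snd r"
    proof (rule ccontr)
      assume "\<not> ?thesis"
      then have "snd r < snd a" using generic_snd_eq[OF X a(1) rX(1)] False by force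
      then show False using r a \<open>fst a < fst r\<close> by (auto simp: recs_def)
    qed
    ultimately show ?thesis using r a False by (auto simp: recs_def)
  qed simp
next
  fix r assume "r \<in> insert a (recs ((X - {a}) \<inter> rect (fst a) w (snd a)))"
  then consider "r = a" | "r \<in> recs ((X - {a}) \<inter> rect (fst a) w (snd a))" by blast
  then show "r \<in> recs (X \<inter> rect z w y)"
  proof cases
    case 1
    then show ?thesis using a left by (auto simp: recs_def)
  next
    case 2
    have "\<not> (fst b < fst r \<and> snd b > snd r)" if b: "b \<in> X" "b \<in> rect z w y" for b
    proof
      assume *: "fst b < fst r \<and> snd b > snd r"
      have "\<not> fst b < fst a" using left b by blast
      with * b 2 have "b \<in> (X - {a}) \<inter> rect (fst a) w (snd a)" by (auto simp: recs_def)
      with * 2 show False by (auto simp: recs_def)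
    qed
    with 2 a show ?thesis by (auto simp: recs_def)
  qed
qed

lemma pred_void [measurable]:
  assumes "f \<in> measurable M config_space" "\<And>n. Measurable.pred M (\<lambda>x. snd (f x) n \<in> A x)"
  shows "Measurable.pred M (\<lambda>x. pts (f x) \<inter> A x = {})"
proof -
  have "Measurable.pred M (\<lambda>x. \<forall>a\<in>pts (f x). a \<notin> A x)"
    using assms by measurable
  moreover have "(\<lambda>x. pts (f x) \<inter> A x = {}) = (\<lambda>x. \<forall>a\<in>pts (f x). a \<notin> A x)" by blast
  ultimately show ?thesis by simp
qed

lemma recs_rect_eq: "recs (pts \<omega> \<inter> rect z w y) = 
  {a \<in> pts \<omega>. (z \<le> fst a \<and> fst a < w \<and> y < snd a) \<and>
     \<not> (\<exists>b\<in>pts \<omega>. (z \<le> fst b \<and> fst b < w \<and> y < snd b) \<and> fst b < fst a \<and> snd b > snd a)}"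
  by (auto simp: recs_def)

lemma pred_num_recs_rect [measurable]:
  assumes [measurable]: "f \<in> measurable M config_space" "z \<in> borel_measurable M" "w \<in> borel_measurable M" "y \<in> borel_measurable M"
  shows "Measurable.pred M (\<lambda>x. num (recs (pts (f x) \<inter> rect (z x) (w x) (y x))) j)"
  unfolding recs_rect_eq by measurable

lemma nn_integral_lborel_pair:
  fixes f :: "real \<times> real \<Rightarrow> ennreal"
  assumes "f \<in> borel_measurable borel"
  shows "(\<integral>\<^sup>+a. f a \<partial>lborel) = (\<integral>\<^sup>+x. \<integral>\<^sup>+y. f (x, y) \<partial>lborel \<partial>lborel)"
proof -
  have "f \<in> borel_measurable (lborel \<Otimes>\<^sub>M lborel)"
    unfolding lborel_prod using assms by simp
  from lborel.nn_integral_fst[OF this] show ?thesis by (simp add: lborel_prod)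
qed

lemma pred_le:
  fixes f :: "'a \<Rightarrow> real"
  shows "f \<in> borel_measurable M \<Longrightarrow> g \<in> borel_measurable M \<Longrightarrow> Measurable.pred M (\<lambda>w. f w \<le> g w)"
  unfolding Measurable.pred_def by (rule borel_measurable_le)

lemma measurable_coords:
  fixes N :: "'a measure"
  shows "(\<lambda>x. fst (snd (snd x) n)) \<in> borel_measurable (N \<Otimes>\<^sub>M config_space)"
    "(\<lambda>x. snd (snd (snd x) n)) \<in> borel_measurable (N \<Otimes>\<^sub>M config_space)"
    "(\<lambda>x. fst (fst x)) \<in> borel_measurable ((borel :: (real \<times> real) measure) \<Otimes>\<^sub>M config_space)"
    "(\<lambda>x. snd (fst x)) \<in> borel_measurable ((borel :: (real \<times> real) measure) \<Otimes>\<^sub>M config_space)"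
  by (intro borel_measurable_fst_snd_real measurable_point measurable_snd measurable_fst)+

text \<open>The induction on \<open>j\<close> carries an arbitrary void region \<open>Q\<close>:
  once the leftmost atom is fixed, the piece of the rectangle to its left is added to
  \<open>Q\<close> and the records north-east of the atom are counted next. Independence from the
  region \<open>Q\<close> is thus obtained along with the law, as the factor
  \<open>exp (- a)\<close>.\<close>

lemma void_and_records:
  assumes "Q \<in> sets borel" "emeasure lborel (Q \<inter> strip) = ennreal a" "0 \<le> a"
    and "0 \<le> z" "z \<le> w" "w \<le> 1" "y \<le> 0" "Q \<inter> rect z w y = {}"
  shows "emeasure config_space {\<omega>. pts \<omega> \<inter> Q = {} \<and> num (recs (pts \<omega> \<inter> rect z w y)) j} =
    ennreal (exp (- a) * p_fun j ((w - z) * (- y)))"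
  using assms
proof (induction j arbitrary: Q a z y)
  case 0
  \<comment> \<open>A generic set has finitely many points in the rectangle; if there are any, the
    leftmost of them is a record.\<close>
  have emp: "recs (X \<inter> rect z w y) = {} \<longleftrightarrow> X \<inter> rect z w y = {}" if "generic X" for X
  proof
    assume e: "recs (X \<inter> rect z w y) = {}"
    show "X \<inter> rect z w y = {}"
    proof (rule ccontr)
      assume ne: "X \<inter> rect z w y \<noteq> {}"
      have f: "finite (X \<inter> rect z w y)" by (rule generic_finite[OF that, of _ y]) auto
      obtain c where "c \<in> X \<inter> rect z w y" "\<forall>b\<in>X \<inter> rect z w y. \<not> fst b < fst c"
        using ex_is_arg_min_if_finite[OF f ne, of fst] unfolding is_arg_min_def by blast
      then have "c \<in> recs (X \<inter> rect z w y)" by (auto simp: recs_def)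
      with e show False by blast
    qed
  qed (auto simp: recs_def)
  have [measurable]: "Q \<in> sets borel" by (rule 0)
  have "emeasure config_space {\<omega>. pts \<omega> \<inter> Q = {} \<and> num (recs (pts \<omega> \<inter> rect z w y)) 0} =
    emeasure config_space {\<omega>. pts \<omega> \<inter> (Q \<union> rect z w y) = {}}"
  proof (rule emeasure_eq_AE)
    show "AE \<omega> in config_space. \<omega> \<in> {\<omega>. pts \<omega> \<inter> Q = {} \<and> num (recs (pts \<omega> \<inter> rect z w y)) 0} \<longleftrightarrow> \<omega> \<in> {\<omega>. pts \<omega> \<inter> (Q \<union> rect z w y) = {}}"
      using AE_generic by eventually_elim (auto simp: emp)
    have "Measurable.pred config_space (\<lambda>\<omega>. pts \<omega> \<inter> Q = {} \<and> num (recs (pts \<omega> \<inter> rect z w y)) 0)"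
       "Measurable.pred config_space (\<lambda>\<omega>. pts \<omega> \<inter> (Q \<union> rect z w y) = {})"
      by measurable
    then show "{\<omega>. pts \<omega> \<inter> Q = {} \<and> num (recs (pts \<omega> \<inter> rect z w y)) 0} \<in> sets config_space"
       "{\<omega>. pts \<omega> \<inter> (Q \<union> rect z w y) = {}} \<in> sets config_space"
      by (simp_all add: pred_def)
  qed
  also have "\<dots> = ennreal (exp (- (a + (w - z) * (- y))))"
  proof (rule void_probability)
    have "(Q \<union> rect z w y) \<inter> strip = Q \<inter> strip \<union> rect z w y \<inter> strip" by blast
    moreover have "emeasure lborel \<dots> = emeasure lborel (Q \<inter> strip) + emeasure lborel (rect z w y \<inter> strip)"
      by (rule plus_emeasure[symmetric]) (use 0 in auto)
    ultimately show "emeasure lborel ((Q \<union> rect z w y) \<inter> strip) = ennreal (a + (w - z) * (- y))"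
      using 0 by (subst ennreal_plus) (simp_all add: emeasure_strip_rect rect_def mult_nonneg_nonpos)
    show "0 \<le> a + (w - z) * (- y)"
      using 0 by (intro add_nonneg_nonneg mult_nonneg_nonneg) auto
  qed measurable
  also have "exp (- (a + (w - z) * (- y))) = exp (- a) * p_fun 0 ((w - z) * (- y))"
    by (simp add: p_fun_0 exp_add[symmetric])
  finally show ?case .
next
  case (Suc j)
  have [measurable]: "Q \<in> sets borel" by (rule Suc)
  \<comment> \<open>\<open>b\<close> plays the leftmost atom of the rectangle, and \<open>X\<close>
    stands for the remaining atoms.\<close>
  define P where "P b X \<longleftrightarrow> (b \<in> rect z w y \<and> X \<inter> (Q \<union> {z..<fst b} \<times> {y<..}) = {} \<and> num (recs (X \<inter> rect (fst b) w (snd b))) j)" for b X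
  have "emeasure config_space {\<omega>. pts \<omega> \<inter> Q = {} \<and> num (recs (pts \<omega> \<inter> rect z w y)) (Suc j)} =
    (\<integral>\<^sup>+b. emeasure config_space {\<omega>. P b (pts \<omega>)} * indicator strip b \<partial>lborel)"
  proof (rule mecke_generic[where P = P and E = "\<lambda>X. X \<inter> Q = {} \<and> num (recs (X \<inter> rect z w y)) (Suc j)"])
    show "Measurable.pred (borel \<Otimes>\<^sub>M config_space) (\<lambda>x. P (fst x) (pts (snd x)))"
    proof -
      have 1: "Measurable.pred ((borel :: (real \<times> real) measure) \<Otimes>\<^sub>M config_space)
        (\<lambda>x. (z \<le> fst (snd (snd x) n) \<and> fst (snd (snd x) n) < fst (fst x)) \<and> y < snd (snd (snd x) n))" for n
        by (intro pred_intros_logic(3) pred_le borel_measurable_pred_less measurable_coords measurable_const) auto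
      have 2: "Measurable.pred ((borel :: (real \<times> real) measure) \<Otimes>\<^sub>M config_space) (\<lambda>x. snd (snd x) n \<in> Q)" for n
        by measurable
      have 3: "Measurable.pred ((borel :: (real \<times> real) measure) \<Otimes>\<^sub>M config_space) (\<lambda>x. snd (snd x) n \<in> Q \<union> {z..<fst (fst x)} \<times> {y<..})" for n
        using pred_intros_logic(5)[OF 2 1, of n n] by (simp add: mem_Times_iff)
      have 4 [measurable]: "Measurable.pred ((borel :: (real \<times> real) measure) \<Otimes>\<^sub>M config_space)
          (\<lambda>x. pts (snd x) \<inter> (Q \<union> {z..<fst (fst x)} \<times> {y<..}) = {})"
        by (rule pred_void[OF measurable_snd 3])
      have 5 [measurable]: "Measurable.pred ((borel :: (real \<times> real) measure) \<Otimes>\<^sub>M config_space) (\<lambda>x. z \<le> fst (fst x) \<and> fst (fst x) < w \<and> y < snd (fst x))"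
        by (intro pred_intros_logic(3) pred_le borel_measurable_pred_less measurable_coords measurable_const) auto
      have 6 [measurable]: "Measurable.pred ((borel :: (real \<times> real) measure) \<Otimes>\<^sub>M config_space) (\<lambda>x. num (recs (pts (snd x) \<inter> rect (fst (fst x)) w (snd (fst x)))) j)"
        by (intro pred_num_recs_rect measurable_snd measurable_coords measurable_const) auto
      show ?thesis unfolding P_def mem_rect by (rule pred_intros_logic(3)[OF 5 pred_intros_logic(3)[OF 4 6]])
    qed
    show "Measurable.pred config_space (\<lambda>\<omega>. pts \<omega> \<inter> Q = {} \<and> num (recs (pts \<omega> \<inter> rect z w y)) (Suc j))"
      by measurable
  next
    fix X assume X: "generic X"
    have rect_eq: "(X - {b}) \<inter> {z..<fst b} \<times> {y<..} = {} \<longleftrightarrow> (\<forall>c. c \<in> X \<longrightarrow> c \<in> rect z w y \<longrightarrow> \<not> fst c < fst b)"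
      if "b \<in> rect z w y" for b
      using that by (force simp: rect_def)
    have num_eq: "num (recs (X \<inter> rect z w y)) (Suc j) \<longleftrightarrow> num (recs ((X - {b}) \<inter> rect (fst b) w (snd b))) j"
      if "b \<in> X" "b \<in> rect z w y" "\<And>c. c \<in> X \<Longrightarrow> c \<in> rect z w y \<Longrightarrow> \<not> fst c < fst b" for b
      using recs_leftmost[OF X that] by (simp add: num_insert recs_def)
    show "(X \<inter> Q = {} \<and> num (recs (X \<inter> rect z w y)) (Suc j)) \<longleftrightarrow> (\<exists>b\<in>X. P b (X - {b}))"
    proof
      assume L: "X \<inter> Q = {} \<and> num (recs (X \<inter> rect z w y)) (Suc j)"
      have f: "finite (X \<inter> rect z w y)" by (rule generic_finite[OF X, of _ y]) auto
      have "X \<inter> rect z w y \<noteq> {}"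
      proof
        assume "X \<inter> rect z w y = {}"
        with L show False by (simp add: num_def del: mem_rect)
      qed
      with f obtain c where c: "c \<in> X" "c \<in> rect z w y" "\<And>b. b \<in> X \<Longrightarrow> b \<in> rect z w y \<Longrightarrow> \<not> fst b < fst c"
        using ex_is_arg_min_if_finite[of "X \<inter> rect z w y" fst] unfolding is_arg_min_def Int_iff by blast
      with L num_eq[OF c] rect_eq[OF c(2)] show "\<exists>b\<in>X. P b (X - {b})"
        by (intro bexI[of _ c]) (auto simp: P_def Int_Un_distrib)
    next
      assume "\<exists>b\<in>X. P b (X - {b})"
      then obtain b where b: "b \<in> X" "P b (X - {b})" by blast
      then have "b \<in> rect z w y" by (simp add: P_def)
      \<comment> \<open>In \<open>P\<close> only the other atoms are required to avoid
        \<open>Q\<close>; for \<open>b\<close> itself this comes from the disjointness of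
        \<open>Q\<close> and the rectangle.\<close>
      moreover then have "b \<notin> Q" using Suc.prems by blast
      ultimately show "X \<inter> Q = {} \<and> num (recs (X \<inter> rect z w y)) (Suc j)"
        using b num_eq[of b] rect_eq[of b] by (auto simp: P_def Int_Un_distrib simp del: mem_rect)
    qed
    fix b c assume bc: "b \<in> X" "c \<in> X" "P b (X - {b})" "P c (X - {c})"
    then have r: "b \<in> rect z w y" "c \<in> rect z w y"
      and e: "(X - {b}) \<inter> {z..<fst b} \<times> {y<..} = {}" "(X - {c}) \<inter> {z..<fst c} \<times> {y<..} = {}"
      unfolding P_def Int_Un_distrib by blast+
    have "\<not> fst b < fst c" "\<not> fst c < fst b"
      using e(2)[unfolded rect_eq[OF r(2)]] e(1)[unfolded rect_eq[OF r(1)]] bc(1,2) r by blast+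
    then show "b = c" using generic_fst_eq[OF X bc(1,2)] by simp
  qed
  also have "\<dots> = (\<integral>\<^sup>+b. ennreal (exp (- a)) * (ennreal (exp (- ((fst b - z) * (- y))) * p_fun j ((w - fst b) * (- snd b))) * indicator {y<..0} (snd b) * indicator {z..<w} (fst b)) \<partial>lborel)"
  proof (rule nn_integral_cong)
    fix b :: "real \<times> real"
    show "emeasure config_space {\<omega>. P b (pts \<omega>)} * indicator strip b = ennreal (exp (- a)) * (ennreal (exp (- ((fst b - z) * (- y))) * p_fun j ((w - fst b) * (- snd b))) * indicator {y<..0} (snd b) * indicator {z..<w} (fst b))"
    proof (cases "b \<in> rect z w y \<inter> strip")
      case True
      then have b: "z \<le> fst b" "fst b < w" "y < snd b" "snd b \<le> 0" by (auto simp: strip_def)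
      define Q' where "Q' = Q \<union> {z..<fst b} \<times> {y<..}"
      have "emeasure config_space {\<omega>. pts \<omega> \<inter> Q' = {} \<and> num (recs (pts \<omega> \<inter> rect (fst b) w (snd b))) j} =
         ennreal (exp (- (a + (fst b - z) * (- y))) * p_fun j ((w - fst b) * (- snd b)))"
      proof (rule Suc.IH)
        have s: "{z..<fst b} \<times> {y<..} \<in> sets borel" by (intro borel_Times) auto
        then show "Q' \<in> sets borel" unfolding Q'_def by auto
        have "Q' \<inter> strip = Q \<inter> strip \<union> {z..<fst b} \<times> {y<..} \<inter> strip" unfolding Q'_def by blast
        moreover have "emeasure lborel \<dots> = emeasure lborel (Q \<inter> strip) + emeasure lborel ({z..<fst b} \<times> {y<..} \<inter> strip)"
        proof (rule plus_emeasure[symmetric])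
          show "Q \<inter> strip \<inter> ({z..<fst b} \<times> {y<..} \<inter> strip) = {}"
            using Suc.prems b by (fastforce simp: rect_def)
        qed (use s in auto)
        ultimately show "emeasure lborel (Q' \<inter> strip) = ennreal (a + (fst b - z) * (- y))"
          using Suc.prems b by (subst ennreal_plus) (simp_all add: emeasure_strip_rect mult_nonneg_nonpos)
        show "Q' \<inter> rect (fst b) w (snd b) = {}"
          using Suc.prems b by (fastforce simp: rect_def Q'_def)
        show "0 \<le> a + (fst b - z) * (- y)"
          using Suc.prems b by (intro add_nonneg_nonneg mult_nonneg_nonneg) auto
      qed (use Suc.prems b in auto)
      moreover have "{\<omega>. P b (pts \<omega>)} = {\<omega>. pts \<omega> \<inter> Q' = {} \<and> num (recs (pts \<omega> \<inter> rect (fst b) w (snd b))) j}"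
        using b by (auto simp: P_def Q'_def)
      moreover have "exp (- (a + (fst b - z) * (- y))) * p_fun j ((w - fst b) * (- snd b)) =
         exp (- a) * (exp (- ((fst b - z) * (- y))) * p_fun j ((w - fst b) * (- snd b)))"
        by (simp add: exp_add[symmetric] mult.assoc[symmetric])
      ultimately have "emeasure config_space {\<omega>. P b (pts \<omega>)} =
          ennreal (exp (- a) * (exp (- ((fst b - z) * (- y))) * p_fun j ((w - fst b) * (- snd b))))"
        by (simp only:)
      then show ?thesis
        using True b by (simp add: ennreal_mult' del: mult_minus_right)
    next
      case False
      then show ?thesis using Suc.prems
        by (cases b) (auto simp: P_def strip_def indicator_def split: if_splits)
    qed
  qed
  also have "\<dots> = ennreal (exp (- a)) * (\<integral>\<^sup>+b. (ennreal (exp (- ((fst b - z) * (- y))) * p_fun j ((w - fst b) * (- snd b))) * indicator {y<..0} (snd b) * indicator {z..<w} (fst b)) \<partial>lborel)"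
    by (rule nn_integral_cmult) simp
  also have "(\<integral>\<^sup>+b. (ennreal (exp (- ((fst b - z) * (- y))) * p_fun j ((w - fst b) * (- snd b))) * indicator {y<..0} (snd b) * indicator {z..<w} (fst b)) \<partial>lborel) =
    (\<integral>\<^sup>+x. (\<integral>\<^sup>+y'. ennreal (exp (- ((x - z) * (- y))) * p_fun j ((w - x) * (- y'))) * indicator {y<..0} y' \<partial>lborel) * indicator {z..<w} x \<partial>lborel)"
    by (subst nn_integral_lborel_pair) (auto simp: nn_integral_multc)
  also have "\<dots> = ennreal (p_fun (Suc j) ((w - z) * (- y)))"
    using Suc.prems by (intro nn_integral_p_fun_rect) auto
  also have "ennreal (exp (- a)) * \<dots> = ennreal (exp (- a) * p_fun (Suc j) ((w - z) * (- y)))"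
    by (simp add: ennreal_mult')
  finally show ?case .
qed

section \<open>The entry atom\<close>

definition early :: "real \<Rightarrow> real \<Rightarrow> (real \<times> real) set" where
  "early s w = {c. fst c < w \<and> (1 - w) * (- snd c) \<le> s}"

text \<open>If \<open>a\<close> is the best atom so far, then at time \<open>x\<close> the box of later and higher points has area
  \<open>(1 - x) * (- snd a)\<close>; \<open>entry s a\<close> is the first \<open>x \<ge> fst a\<close> at which this is at most \<open>s\<close>, and an atom
  is in \<open>early s w\<close> iff it comes before \<open>w\<close> and its entry time is at most \<open>w\<close>. The entry atom
  minimises \<open>entry s\<close>.\<close>

definition entry :: "real \<Rightarrow> real \<times> real \<Rightarrow> real" where
  "entry s a = max (fst a) (1 + s / snd a)"

text \<open>Setting \<open>w\<close> to the uniform line gives the records counted by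
  \<open>q_inf\<close>; \<open>w = 1\<close> gives, almost surely, those counted by
  \<open>p_inf\<close>.\<close>

definition low_recs :: "real \<Rightarrow> real \<Rightarrow> (real \<times> real) set \<Rightarrow> (real \<times> real) set" where
  "low_recs s w X = {a \<in> recs X. fst a < w \<and> box_area a \<le> s}"

lemma mem_early_iff:
  assumes "snd c < 0"
  shows "c \<in> early s w \<longleftrightarrow> fst c < w \<and> entry s c \<le> w"
proof -
  have "1 + s / snd c \<le> w \<longleftrightarrow> (1 - w) * (- snd c) \<le> s"
    using assms by (simp add: field_simps)
  then show ?thesis by (auto simp: early_def entry_def)
qed

lemma box_area_le_iff:
  assumes "snd a < 0"
  shows "box_area a \<le> s \<longleftrightarrow> 1 + s / snd a \<le> fst a"
  using assms by (simp add: box_area_def field_simps)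

lemma entry_threshold_mono:
  fixes a b :: "real \<times> real"
  assumes "0 < s" "snd a < snd b" "snd b < 0"
  shows "1 + s / snd b < 1 + s / snd a"
  using divide_strict_left_mono[of "snd a" "snd b" s] assms by (simp add: mult_neg_neg)

lemma entry_less_1: "0 < s \<Longrightarrow> fst a < 1 \<Longrightarrow> snd a < 0 \<Longrightarrow> entry s a < 1"
  by (simp add: entry_def divide_neg_neg divide_pos_neg)

text \<open>Since \<open>a\<close> is not early at the entry time of \<open>b\<close>,
  \<open>fst a \<ge> entry s b\<close>; with \<open>fst a \<le> entry s a \<le> entry s b\<close>
  all three agree. The same argument for \<open>b\<close> then puts both atoms on one vertical
  line.\<close>

lemma entry_atom_unique:
  assumes X: "generic X" and a: "a \<in> X" "b \<in> X"
    and void: "(X - {a}) \<inter> early s (entry s a) = {}" "(X - {b}) \<inter> early s (entry s b) = {}"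
    and le: "entry s a \<le> entry s b" and s: "0 < s"
  shows "a = b"
proof (rule ccontr)
  assume ab: "a \<noteq> b"
  have neg: "snd a < 0" "snd b < 0" using generic_mem[OF X] a by auto
  have "a \<notin> early s (entry s b)" "b \<notin> early s (entry s a)" using void a ab by auto
  then have 1: "\<not> (fst a < entry s b \<and> entry s a \<le> entry s b)" "\<not> (fst b < entry s a \<and> entry s b \<le> entry s a)"
    using neg by (auto simp: mem_early_iff)
  have fa: "fst a \<le> entry s a" "fst b \<le> entry s b" by (auto simp: entry_def)
  with 1 le have "fst a = entry s b" "entry s a = entry s b" by auto
  with 1 fa have "fst a = fst b" by auto
  with ab generic_fst_eq[OF X a] show False by simp
qed

text \<open>Infinitely many atoms may compete, but an entry time of at most \<open>e < 1\<close>
  forces \<open>snd b \<ge> - s / (1 - e)\<close>. Hence only finitely many enter no later than a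
  given early atom, and \<open>entry s\<close> attains its minimum among them.\<close>

lemma entry_atom_exists:
  assumes X: "generic X" and s: "0 < s" and ne: "X \<inter> early s w \<noteq> {}"
  shows "\<exists>a\<in>X. a \<in> early s w \<and> (X - {a}) \<inter> early s (entry s a) = {}"
proof -
  obtain c where c: "c \<in> X" "c \<in> early s w" using ne by blast
  have c1: "fst c < 1" "snd c < 0" using generic_mem[OF X c(1)] by auto
  define Y where "Y = {b \<in> X. b \<in> early s w \<and> entry s b \<le> entry s c}"
  have e1: "entry s c < 1" using entry_less_1[OF s c1] .
  have "finite Y"
  proof (rule generic_finite[OF X, of _ "- s / (1 - entry s c)"])
    fix b assume b: "b \<in> Y"
    then have nb: "snd b < 0" using generic_mem[OF X] by (auto simp: Y_def)
    have "1 + s / snd b \<le> entry s c" using b by (simp add: Y_def entry_def)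
    then have "- s / (1 - entry s c) \<le> snd b" using nb e1 by (simp add: field_simps)
    then show "b \<in> X \<and> - s / (1 - entry s c) \<le> snd b" using b by (simp add: Y_def)
  qed
  moreover have "c \<in> Y" using c by (simp add: Y_def)
  then have "Y \<noteq> {}" by blast
  ultimately obtain a where "is_arg_min (entry s) (\<lambda>x. x \<in> Y) a" using ex_is_arg_min_if_finite by blast
  then have a: "a \<in> X" "a \<in> early s w" "entry s a \<le> entry s c" and "\<And>b. b \<in> Y \<Longrightarrow> entry s a \<le> entry s b"
    by (auto simp: is_arg_min_def Y_def not_less)
  have amin: "entry s a \<le> entry s b" if b: "b \<in> X" "fst b < entry s a" "entry s b \<le> entry s a" for b
  proof -
    have n: "snd a < 0" "snd b < 0" using generic_mem[OF X] a b by auto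
    have "entry s a \<le> w" using a n by (simp add: mem_early_iff)
    then have "b \<in> early s w" using b n by (simp add: mem_early_iff)
    then have "b \<in> Y" using b a by (auto simp: Y_def)
    then show ?thesis by fact
  qed
  have uniq: "b = d" if b: "b \<in> X" "fst b < entry s a" "entry s b = entry s a" 
    and d: "d \<in> X" "fst d < entry s a" "entry s d = entry s a" for b d
  proof -
    have n: "snd b < 0" "snd d < 0" using generic_mem[OF X] b d by auto
    have "1 + s / snd b = entry s a" "1 + s / snd d = entry s a"
      using b(2,3) d(2,3) unfolding entry_def[of s b] entry_def[of s d] by linarith+
    then have "s / snd b = s / snd d" by linarith
    then have "snd b = snd d" using s n by (simp add: field_simps)
    then show ?thesis using generic_snd_eq[OF X b(1) d(1)] by simp
  qed
  show ?thesis
  \<comment> \<open>Entry times can tie: a box may shrink to area \<open>s\<close> just as a new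
    atom arrives. The atom strictly to the left is then the entry atom, and by \<open>uniq\<close>
    there is only one such.\<close>
  proof (cases "\<exists>b\<in>X. fst b < entry s a \<and> entry s b = entry s a")
    case True
    then obtain b where b: "b \<in> X" "fst b < entry s a" "entry s b = entry s a" by blast
    have n: "snd a < 0" "snd b < 0" using generic_mem[OF X] a b by auto
    have "b \<in> early s w" using a b n by (simp add: mem_early_iff)
    moreover have "d \<notin> early s (entry s b)" if "d \<in> X - {b}" for d
    proof
      assume d: "d \<in> early s (entry s b)"
      have "snd d < 0" using generic_mem[OF X] that by auto
      with d b have "fst d < entry s a" "entry s d \<le> entry s a" by (auto simp: mem_early_iff)
      with amin[of d] that have "entry s d = entry s a" by auto
      with uniq[OF b, of d] that \<open>fst d < entry s a\<close> show False by auto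
    qed
    ultimately show ?thesis using b by blast
  next
    case False
    have "d \<notin> early s (entry s a)" if "d \<in> X - {a}" for d
    proof
      assume d: "d \<in> early s (entry s a)"
      have "snd d < 0" using generic_mem[OF X] that by auto
      with d have "fst d < entry s a" "entry s d \<le> entry s a" by (auto simp: mem_early_iff)
      with amin[of d] that False show False by auto
    qed
    then show ?thesis using a by blast
  qed
qed

text \<open>An atom above \<open>a\<close> cannot lie before the entry time, as it would then be
  early itself. So the later counted records are those of the rectangle that starts at the entry
  time above \<open>a\<close>, where every box area is at most \<open>s\<close> automatically. Only
  the status of \<open>a\<close> itself depends on whether entry was by a jump or by drift.\<close>

lemma low_recs_entry:
  assumes X: "generic X" and s: "0 < s" and a: "a \<in> X" "a \<in> early s w"
    and void: "(X - {a}) \<inter> early s (entry s a) = {}"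
  shows "low_recs s w X =
    (if box_area a \<le> s then {a} else {}) \<union> recs ((X - {a}) \<inter> rect (entry s a) w (snd a))"
proof -
  define E where "E = entry s a"
  have neg: "snd b < 0" if "b \<in> X" for b using generic_mem[OF X that] by simp
  have nearly: "\<not> (fst b < E \<and> entry s b \<le> E)" if "b \<in> X" "b \<noteq> a" for b
    using that void neg[OF that(1)] by (auto simp: E_def mem_early_iff)
  have aE: "fst a \<le> E" "1 + s / snd a \<le> E" by (auto simp: E_def entry_def)
  have high: "E \<le> fst b" if "b \<in> X" "snd b > snd a" for b
  proof (rule ccontr)
    assume "\<not> E \<le> fst b"
    moreover have "1 + s / snd b < 1 + s / snd a"
      using entry_threshold_mono[OF s that(2) neg[OF that(1)]] .
    ultimately have "fst b < E \<and> entry s b \<le> E" using aE by (auto simp: entry_def)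
    with nearly[of b] that show False by auto
  qed
  show ?thesis unfolding E_def[symmetric]
  proof (intro equalityI subsetI)
    fix r assume r: "r \<in> low_recs s w X"
    then have rX: "r \<in> X" "fst r < w" "box_area r \<le> s" "r \<in> recs X" by (auto simp: low_recs_def recs_def)
    show "r \<in> (if box_area a \<le> s then {a} else {}) \<union> recs ((X - {a}) \<inter> rect E w (snd a))"
    proof (cases "r = a")
      case False
      \<comment> \<open>A counted record has a small box already when it arrives, so it enters at
        its own arrival.\<close>
      have "entry s r = fst r" using rX(3) neg[OF rX(1)] by (simp add: box_area_le_iff entry_def)
      with nearly[OF rX(1) False] have rE: "E \<le> fst r" by auto
      then have "fst a < fst r" using aE False generic_fst_eq[OF X a(1) rX(1)] by force
      moreover have "snd r \<noteq> snd a" using generic_snd_eq[OF X a(1) rX(1)] False by auto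
      ultimately have "snd a < snd r" using rX(4) a(1) by (auto simp: recs_def not_less)
      then show ?thesis using rX rE False by (auto simp: recs_def)
    qed (use rX in simp)
  next
    fix r assume "r \<in> (if box_area a \<le> s then {a} else {}) \<union> recs ((X - {a}) \<inter> rect E w (snd a))"
    then consider "r = a" "box_area a \<le> s" | "r \<in> recs ((X - {a}) \<inter> rect E w (snd a))"
      by (auto split: if_splits)
    then show "r \<in> low_recs s w X"
    proof cases
      case 1
      have "E = fst a" using 1(2) neg[OF a(1)] by (simp add: E_def box_area_le_iff entry_def)
      then have "a \<in> recs X" using a(1) high by (force simp: recs_def)
      then show ?thesis using 1 a(2) by (simp add: low_recs_def early_def)
    next
      case 2
      then have r: "r \<in> X" "E \<le> fst r" "fst r < w" "snd a < snd r" by (auto simp: recs_def)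
      have "1 + s / snd r < 1 + s / snd a" using entry_threshold_mono[OF s r(4) neg[OF r(1)]] .
      then have "box_area r \<le> s" using r aE neg[OF r(1)] by (simp add: box_area_le_iff)
      moreover have "\<not> (fst b < fst r \<and> snd b > snd r)" if b: "b \<in> X" for b
      proof
        assume *: "fst b < fst r \<and> snd b > snd r"
        then have "b \<in> (X - {a}) \<inter> rect E w (snd a)" using b r high[OF b] by auto
        with * 2 show False by (auto simp: recs_def)
      qed
      ultimately show ?thesis using r by (auto simp: low_recs_def recs_def)
    qed
  qed
qed

lemma low_recs_no_early:
  assumes "generic X" "X \<inter> early s w = {}"
  shows "low_recs s w X = {}"
proof -
  have "r \<in> early s w" if r: "r \<in> X" "fst r < w" "box_area r \<le> s" for r
    using generic_mem[OF assms(1) r(1)] r by (simp add: mem_early_iff box_area_le_iff entry_def)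
  then show ?thesis using assms(2) by (auto simp: low_recs_def recs_def)
qed

text \<open>If \<open>box_area a \<le> s\<close>, the area jumps below \<open>s\<close> at
  \<open>a\<close>, and \<open>a\<close> is itself the first record counted; otherwise the area
  drifts down to \<open>s\<close> later and \<open>a\<close> is not counted. The condition
  \<open>j \<noteq> 0\<close> guards the truncated \<open>j - 1\<close>.\<close>

definition entry_event :: "real \<Rightarrow> real \<Rightarrow> nat \<Rightarrow> real \<times> real \<Rightarrow> (real \<times> real) set \<Rightarrow> bool" where
  "entry_event s w j a Y \<longleftrightarrow> a \<in> early s w \<and> Y \<inter> early s (entry s a) = {} \<and>
     (box_area a \<le> s \<longrightarrow> j \<noteq> 0) \<and>
     num (recs (Y \<inter> rect (entry s a) w (snd a))) (if box_area a \<le> s then j - 1 else j)"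

lemma low_recs_entry_event:
  assumes X: "generic X" and s: "0 < s"
  shows "(X \<inter> early s w \<noteq> {} \<and> num (low_recs s w X) j) \<longleftrightarrow> (\<exists>a\<in>X. entry_event s w j a (X - {a}))"
proof -
  have num_eq: "num (low_recs s w X) j \<longleftrightarrow> (box_area a \<le> s \<longrightarrow> j \<noteq> 0) \<and>
     num (recs ((X - {a}) \<inter> rect (entry s a) w (snd a))) (if box_area a \<le> s then j - 1 else j)"
    if "a \<in> X" "a \<in> early s w" "(X - {a}) \<inter> early s (entry s a) = {}" for a
    unfolding low_recs_entry[OF X s that] by (auto simp: num_insert recs_def)
  show ?thesis
  proof
    assume L: "X \<inter> early s w \<noteq> {} \<and> num (low_recs s w X) j"
    then obtain a where "a \<in> X" "a \<in> early s w" "(X - {a}) \<inter> early s (entry s a) = {}"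
      using entry_atom_exists[OF X s] by blast
    with L num_eq[OF this] show "\<exists>a\<in>X. entry_event s w j a (X - {a})"
      unfolding entry_event_def by blast
  next
    assume "\<exists>a\<in>X. entry_event s w j a (X - {a})"
    then obtain a where "a \<in> X" "entry_event s w j a (X - {a})" by blast
    then show "X \<inter> early s w \<noteq> {} \<and> num (low_recs s w X) j"
      using num_eq[of a] unfolding entry_event_def by blast
  qed
qed

lemma pred_num_low_recs:
  assumes f: "f \<in> measurable M config_space" and w: "w \<in> borel_measurable M"
  shows "Measurable.pred M (\<lambda>x. num (low_recs s (w x) (pts (f x))) j)"
proof -
  have [measurable]: "(\<lambda>x. fst (snd (f x) n)) \<in> borel_measurable M" "(\<lambda>x. snd (snd (f x) n)) \<in> borel_measurable M" for n
    using f by (intro borel_measurable_fst_snd_real measurable_point; simp)+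
  have "low_recs s w X = {a \<in> X. (\<not> (\<exists>b\<in>X. fst b < fst a \<and> snd b > snd a)) \<and> fst a < w \<and> (1 - fst a) * \<bar>snd a\<bar> \<le> s}" for w X
    by (auto simp: low_recs_def recs_def box_area_def)
  then show ?thesis
    using f w by simp
qed

lemma pred_no_early:
  assumes f: "f \<in> measurable M config_space" and w: "w \<in> borel_measurable M"
  shows "Measurable.pred M (\<lambda>x. pts (f x) \<inter> early s (w x) = {})"
proof (rule pred_void[OF f])
  fix n
  have [measurable]: "(\<lambda>x. fst (snd (f x) n)) \<in> borel_measurable M" "(\<lambda>x. snd (snd (f x) n)) \<in> borel_measurable M"
    using f by (intro borel_measurable_fst_snd_real measurable_point; simp)+
  show "Measurable.pred M (\<lambda>x. snd (f x) n \<in> early s (w x))"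
    unfolding early_def mem_Collect_eq using w
    by (intro pred_intros_logic(3) borel_measurable_pred_less pred_le; measurable)
qed

lemma emeasure_low_recs:
  assumes s: "0 < s"
  shows "emeasure config_space {\<omega>. pts \<omega> \<inter> early s w \<noteq> {} \<and> num (low_recs s w (pts \<omega>)) j} =
    (\<integral>\<^sup>+a. emeasure config_space {\<omega>. entry_event s w j a (pts \<omega>)} * indicator strip a \<partial>lborel)"
proof (rule mecke_generic[where P = "entry_event s w j" and E = "\<lambda>X. X \<inter> early s w \<noteq> {} \<and> num (low_recs s w X) j"])
  let ?M = "(borel :: (real \<times> real) measure) \<Otimes>\<^sub>M config_space"
  note coords = measurable_coords(3,4)
  have e: "(\<lambda>x. entry s (fst x)) \<in> borel_measurable ?M"
    unfolding entry_def by (intro borel_measurable_max borel_measurable_add borel_measurable_divide coords borel_measurable_const)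
  have 1: "Measurable.pred ?M (\<lambda>x. fst x \<in> early s w)"
    unfolding early_def mem_Collect_eq
    by (intro pred_intros_logic(3) borel_measurable_pred_less pred_le borel_measurable_times borel_measurable_uminus coords borel_measurable_const)
  have 2: "Measurable.pred ?M (\<lambda>x. pts (snd x) \<inter> early s (entry s (fst x)) = {})"
    by (rule pred_no_early[OF measurable_snd e])
  have 3: "Measurable.pred ?M (\<lambda>x. box_area (fst x) \<le> s)"
    unfolding box_area_def
    by (intro pred_le borel_measurable_times borel_measurable_diff borel_measurable_abs coords borel_measurable_const)
  have 4: "Measurable.pred ?M (\<lambda>x. num (recs (pts (snd x) \<inter> rect (entry s (fst x)) w (snd (fst x)))) k)" for k
    by (rule pred_num_recs_rect[OF measurable_snd e borel_measurable_const measurable_coords(4)])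
  have "entry_event s w j a Y \<longleftrightarrow> a \<in> early s w \<and> Y \<inter> early s (entry s a) = {} \<and>
     ((box_area a \<le> s \<and> j \<noteq> 0 \<and> num (recs (Y \<inter> rect (entry s a) w (snd a))) (j - 1)) \<or>
      (\<not> box_area a \<le> s \<and> num (recs (Y \<inter> rect (entry s a) w (snd a))) j))" for a Y
    by (auto simp: entry_event_def)
  then show "Measurable.pred ?M (\<lambda>x. entry_event s w j (fst x) (pts (snd x)))"
    using 1 2 3 4 by simp
  show "Measurable.pred config_space (\<lambda>\<omega>. pts \<omega> \<inter> early s w \<noteq> {} \<and> num (low_recs s w (pts \<omega>)) j)"
  proof -
    have "Measurable.pred config_space (\<lambda>\<omega>. pts \<omega> \<inter> early s w = {})"
      by (rule pred_no_early) auto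
    moreover have "Measurable.pred config_space (\<lambda>\<omega>. num (low_recs s w (pts \<omega>)) j)"
      by (rule pred_num_low_recs) auto
    ultimately show ?thesis by simp
  qed
  fix X assume X: "generic X"
  show "(X \<inter> early s w \<noteq> {} \<and> num (low_recs s w X) j) \<longleftrightarrow> (\<exists>a\<in>X. entry_event s w j a (X - {a}))"
    by (rule low_recs_entry_event[OF X s])
  fix a b assume "a \<in> X" "b \<in> X" "entry_event s w j a (X - {a})" "entry_event s w j b (X - {b})"
  then show "a = b"
    using entry_atom_unique[OF X, of a b s] entry_atom_unique[OF X, of b a s] s
    unfolding entry_event_def by (cases "entry s a \<le> entry s b") auto
qed

text \<open>Inside the strip the early region is a rectangle of width \<open>w\<close> whose height
  \<open>s / (1 - w)\<close> is the depth at which a box starting at \<open>w\<close> has area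
  \<open>s\<close>.\<close>

lemma emeasure_early:
  assumes s: "0 < s" and w: "0 \<le> w" "w < 1"
  shows "emeasure lborel (early s w \<inter> strip) = ennreal (w * s / (1 - w))"
proof -
  have "early s w \<inter> strip = {0..<w} \<times> {- (s / (1 - w))..} \<inter> strip"
    using w by (auto simp: early_def strip_def field_simps)
  then show ?thesis using s w emeasure_strip_rect(2)[of 0 w "- (s / (1 - w))"] by simp
qed

lemma sets_early: "early s w \<in> sets borel"
proof -
  have "Measurable.pred borel (\<lambda>c. fst c < w \<and> (1 - w) * (- snd c) \<le> s)"
    by (intro pred_intros_logic(3) borel_measurable_pred_less pred_le borel_measurable_times borel_measurable_uminus
        borel_measurable_fst_snd_real borel_measurable_const) auto
  then show ?thesis by (simp add: pred_def early_def)
qed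

lemma emeasure_no_early:
  assumes s: "0 < s" and w: "0 \<le> w" "w < 1"
  shows "emeasure config_space {\<omega>. pts \<omega> \<inter> early s w = {}} = ennreal (exp (- (w * s / (1 - w))))"
  by (rule void_probability[OF sets_early emeasure_early]) (use assms in auto)

lemma emeasure_entry_event:
  assumes s: "0 < s" and a: "0 \<le> fst a" "fst a < 1" "snd a < 0" "a \<in> early s w" and w: "w \<le> 1"
  shows "emeasure config_space {\<omega>. entry_event s w j a (pts \<omega>)} =
    ennreal (exp (- (entry s a * s / (1 - entry s a))) *
      (if box_area a \<le> s then if j = 0 then 0 else p_fun (j - 1) ((w - entry s a) * (- snd a))
       else p_fun j ((w - entry s a) * (- snd a))))"
proof -
  have e: "0 \<le> entry s a" "entry s a < 1" "entry s a \<le> w"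
    using a entry_less_1[OF s a(2,3)] by (auto simp: mem_early_iff) (auto simp: entry_def)
  \<comment> \<open>The void region ends at the abscissa \<open>entry s a\<close>, where the
    rectangle of later records begins, so the two are disjoint.\<close>
  have *: "emeasure config_space {\<omega>. pts \<omega> \<inter> early s (entry s a) = {} \<and> num (recs (pts \<omega> \<inter> rect (entry s a) w (snd a))) k} =
     ennreal (exp (- (entry s a * s / (1 - entry s a))) * p_fun k ((w - entry s a) * (- snd a)))" for k
    by (rule void_and_records[OF sets_early emeasure_early[OF s e(1,2)]])
       (use s e a w in \<open>auto simp: early_def\<close>)
  show ?thesis
    using *[of j] *[of "j - 1"] a(4) by (auto simp: entry_event_def)
qed

section \<open>Integration over the entry atom\<close>

text \<open>\<open>u = s / (1 - x)\<close> is the depth at which the box at time \<open>x\<close>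
  has area \<open>s\<close>; the times in \<open>{0..<1}\<close> correspond to
  \<open>u \<ge> s\<close>. The substitution is made on compact intervals and extended by monotone
  convergence.\<close>

lemma nn_integral_subst_hyperbola:
  fixes \<phi> :: "real \<Rightarrow> ennreal"
  assumes s: "0 < s" and [measurable]: "\<phi> \<in> borel_measurable borel"
  shows "(\<integral>\<^sup>+x. \<phi> (s / (1 - x)) * ennreal (s / (1 - x)\<^sup>2) * indicator {0..<1} x \<partial>lborel) =
    (\<integral>\<^sup>+u. \<phi> u * indicator {s..} u \<partial>lborel)"
proof -
  \<comment> \<open>Chosen so that the image of \<open>{0..b n}\<close> ends at
    \<open>s * (real n + 2)\<close>; the summand 2 keeps \<open>b n\<close> positive.\<close>
  define b where "b n = 1 - 1 / (real n + 2)" for n :: nat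
  have b: "0 < b n" "b n < 1" "s / (1 - b n) = s * (real n + 2)" for n
    by (auto simp: b_def field_simps)
  have b_mono: "b m \<le> b n" if "m \<le> n" for m n
    using that by (simp add: b_def frac_le)
  have eq: "(\<integral>\<^sup>+u. \<phi> u * indicator {s..s * (real n + 2)} u \<partial>lborel) =
     (\<integral>\<^sup>+x. (\<phi> (s / (1 - x)) * ennreal (s / (1 - x)\<^sup>2)) * indicator {0..b n} x \<partial>lborel)" for n
  proof -
    have "(\<integral>\<^sup>+u. \<phi> u * indicator {s / (1 - 0)..s / (1 - b n)} u \<partial>lborel) =
      (\<integral>\<^sup>+x. \<phi> (s / (1 - x)) * ennreal (s / (1 - x)\<^sup>2) * indicator {0..b n} x \<partial>lborel)"
    proof (rule nn_integral_substitution_aux)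
      fix x assume x: "x \<in> {0..b n}"
      then have "x < 1" using b(2)[of n] by auto
      then show "((\<lambda>x. s / (1 - x)) has_real_derivative s / (1 - x)\<^sup>2) (at x)"
        by (auto intro!: derivative_eq_intros simp: power2_eq_square)
      show "0 \<le> s / (1 - x)\<^sup>2" using s by simp
    next
      show "continuous_on {0..b n} (\<lambda>x. s / (1 - x)\<^sup>2)"
        using b(2)[of n] by (intro continuous_intros) auto
    qed (use b in auto)
    then show ?thesis by (simp add: b(3))
  qed
  have SUP: "(SUP n. \<integral>\<^sup>+x. f x * indicator (B n) x \<partial>lborel) = (\<integral>\<^sup>+x. f x * indicator (\<Union>n. B n) x \<partial>lborel)"
    if [measurable]: "f \<in> borel_measurable borel" "\<And>n. B n \<in> sets borel" and inc: "incseq B"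
    for f :: "real \<Rightarrow> ennreal" and B :: "nat \<Rightarrow> real set"
  proof -
    have "(SUP n. emeasure (density lborel f) (B n)) = emeasure (density lborel f) (\<Union>n. B n)"
      by (rule SUP_emeasure_incseq) (use inc in auto)
    then show ?thesis by (simp add: emeasure_density)
  qed
  have U1: "(\<Union>n. {s..s * (real n + 2)}) = {s..}"
  proof (intro equalityI subsetI)
    fix u assume u: "u \<in> {s..}"
    obtain n :: nat where "u / s \<le> real n" using real_arch_simple by blast
    then have "u \<le> s * (real n + 2)" using s by (simp add: field_simps)
    with u show "u \<in> (\<Union>n. {s..s * (real n + 2)})" by auto
  qed auto
  have U2: "(\<Union>n. {0..b n}) = {0..<1}"
  proof (intro equalityI subsetI)
    fix x :: real assume x: "x \<in> {0..<1}"
    obtain n :: nat where "1 / (1 - x) \<le> real n" using real_arch_simple by blast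
    then have "x \<le> b n" using x by (simp add: b_def field_simps)
    with x show "x \<in> (\<Union>n. {0..b n})" by auto
  next
    fix x assume "x \<in> (\<Union>n. {0..b n})"
    then show "x \<in> {0..<1}" using b(2) by (auto intro: le_less_trans)
  qed
  have "(\<integral>\<^sup>+u. \<phi> u * indicator {s..} u \<partial>lborel) = (SUP n. \<integral>\<^sup>+u. \<phi> u * indicator {s..s * (real n + 2)} u \<partial>lborel)"
    unfolding U1[symmetric] by (rule SUP[symmetric]) (use s in \<open>auto simp: incseq_def\<close>)
  also have "\<dots> = (SUP n. \<integral>\<^sup>+x. (\<phi> (s / (1 - x)) * ennreal (s / (1 - x)\<^sup>2)) * indicator {0..b n} x \<partial>lborel)"
    unfolding eq ..
  also have "\<dots> = (\<integral>\<^sup>+x. (\<phi> (s / (1 - x)) * ennreal (s / (1 - x)\<^sup>2)) * indicator {0..<1} x \<partial>lborel)"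
    unfolding U2[symmetric] by (rule SUP) (use b_mono in \<open>auto simp: incseq_def intro: order_trans\<close>)
  finally show ?thesis by simp
qed

text \<open>The integrand is the probability that no atom is early at \<open>x\<close>, so this is
  the mean entry time. \<open>entry_constants\<close> identifies it with the probability of entry by
  drift.\<close>

definition drift_const :: "real \<Rightarrow> ennreal" where
  "drift_const s = (\<integral>\<^sup>+x. ennreal (exp (- (x * s / (1 - x)))) * indicator {0..<1} x \<partial>lborel)"

text \<open>An atom arriving at \<open>x\<close> brings the area below \<open>s\<close> if its depth
  is at most \<open>s / (1 - x)\<close>; weighting the probability of no earlier entry with this
  length gives the probability of entry by a jump.\<close>

definition jump_const :: "real \<Rightarrow> ennreal" where
  "jump_const s = (\<integral>\<^sup>+x. ennreal (exp (- (x * s / (1 - x))) * (s / (1 - x))) * indicator {0..<1} x \<partial>lborel)"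

text \<open>In the variable \<open>u\<close> everything reduces to three relations:
  \<open>f1 + f2\<close> is the derivative of \<open>- (s / u) * exp (- (u - s))\<close>,
  \<open>g + f2\<close> is \<open>exp (- (u - s))\<close>, and
  \<open>g * (s / u) + s * f1 = f2\<close>. The first two sums both integrate to 1, so
  \<open>g\<close> and \<open>f1\<close> have equal integrals although they are different
  functions.\<close>

lemma entry_constants:
  assumes s: "0 < s"
  obtains c A where "0 < c" "0 < A" "drift_const s = ennreal c" "jump_const s = ennreal A"
    "(\<integral>\<^sup>+u. ennreal ((1 - s / u) * exp (- (u - s))) * indicator {s<..} u \<partial>lborel) = ennreal c"
    "(\<integral>\<^sup>+u. ennreal ((1 - s / u) * exp (- (u - s)) * (s / u)) * indicator {s<..} u \<partial>lborel) + ennreal s * ennreal c = ennreal A"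
proof -
  define f1 f2 where "f1 u = exp (- (u - s)) * (s / u\<^sup>2)" and "f2 u = exp (- (u - s)) * (s / u)" for u
  have [measurable]: "f1 \<in> borel_measurable borel" "f2 \<in> borel_measurable borel"
    unfolding f1_def[abs_def] f2_def[abs_def] by measurable
  define I where "I f = (\<integral>\<^sup>+u. ennreal (f u) * indicator {s..} u \<partial>lborel)" for f :: "real \<Rightarrow> real"
  have I_add: "I (\<lambda>u. f u + g u) = I f + I g" 
    if "\<And>u. s \<le> u \<Longrightarrow> 0 \<le> f u" "\<And>u. s \<le> u \<Longrightarrow> 0 \<le> g u" and [measurable]: "f \<in> borel_measurable borel" "g \<in> borel_measurable borel" for f g
    unfolding I_def using that
    by (subst nn_integral_add[symmetric]) (auto intro!: nn_integral_cong simp: indicator_def)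
  have I_open: "(\<integral>\<^sup>+u. ennreal (f u) * indicator {s<..} u \<partial>lborel) = I f" for f
    unfolding I_def
    by (intro nn_integral_cong_AE, rule AE_mp[OF AE_lborel_singleton[of s]], rule AE_I2) (auto simp: indicator_def)
  have d: "drift_const s = I f1"
  proof -
    have "I f1 = (\<integral>\<^sup>+x. ennreal (f1 (s / (1 - x))) * ennreal (s / (1 - x)\<^sup>2) * indicator {0..<1} x \<partial>lborel)"
      unfolding I_def using s by (subst nn_integral_subst_hyperbola) auto
    also have "\<dots> = drift_const s" unfolding drift_const_def
    proof (rule nn_integral_cong)
      fix x :: real
      show "ennreal (f1 (s / (1 - x))) * ennreal (s / (1 - x)\<^sup>2) * indicator {0..<1} x = ennreal (exp (- (x * s / (1 - x)))) * indicator {0..<1} x"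
      proof (cases "x \<in> {0..<1}")
        case True
        then have "s / (1 - x) - s = x * s / (1 - x)" by (simp add: field_simps)
        moreover have "s / (s / (1 - x))\<^sup>2 * (s / (1 - x)\<^sup>2) = 1"
        proof -
          have K: "s / (s / y)\<^sup>2 * (s / y\<^sup>2) = 1" if "y \<noteq> 0" for y
            using that s by (simp add: power2_eq_square field_simps)
          show ?thesis by (rule K) (use True in simp)
        qed
        ultimately have "f1 (s / (1 - x)) * (s / (1 - x)\<^sup>2) = exp (- (x * s / (1 - x)))"
          by (simp only: f1_def mult.assoc mult_1_right)
        then show ?thesis using s by (simp add: ennreal_mult''[symmetric])
      qed simp
    qed
    finally show ?thesis ..
  qed
  have j: "jump_const s = I f2"
  proof -
    have "I f2 = (\<integral>\<^sup>+x. ennreal (f2 (s / (1 - x))) * ennreal (s / (1 - x)\<^sup>2) * indicator {0..<1} x \<partial>lborel)"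
      unfolding I_def using s by (subst nn_integral_subst_hyperbola) auto
    also have "\<dots> = jump_const s" unfolding jump_const_def
    proof (rule nn_integral_cong)
      fix x :: real
      show "ennreal (f2 (s / (1 - x))) * ennreal (s / (1 - x)\<^sup>2) * indicator {0..<1} x = ennreal (exp (- (x * s / (1 - x))) * (s / (1 - x))) * indicator {0..<1} x"
      proof (cases "x \<in> {0..<1}")
        case True
        then have "s / (1 - x) - s = x * s / (1 - x)" by (simp add: field_simps)
        moreover have "s / (s / (1 - x)) * (s / (1 - x)\<^sup>2) = s / (1 - x)"
        proof -
          have K: "s / (s / y) * (s / y\<^sup>2) = s / y" if "y \<noteq> 0" for y
            using that s by (simp add: power2_eq_square)
          show ?thesis by (rule K) (use True in simp)
        qed
        ultimately have "f2 (s / (1 - x)) * (s / (1 - x)\<^sup>2) = exp (- (x * s / (1 - x))) * (s / (1 - x))"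
          by (simp only: f2_def mult.assoc)
        then show ?thesis using s by (simp add: ennreal_mult''[symmetric])
      qed simp
    qed
    finally show ?thesis ..
  qed
  have nonneg: "0 \<le> f1 u" "0 \<le> f2 u" if "s \<le> u" for u
    using that s by (auto simp: f1_def f2_def)
  have lim: "((\<lambda>u. - exp (- (u - s))) \<longlongrightarrow> 0) at_top" "((\<lambda>u. - (s / u) * exp (- (u - s))) \<longlongrightarrow> 0) at_top"
    using s by real_asymp+
  have sum12: "I f1 + I f2 = 1"
  proof -
    have "I f1 + I f2 = I (\<lambda>u. f1 u + f2 u)" by (rule I_add[symmetric]) (use nonneg in auto)
    also have "\<dots> = 0 - (- (s / s) * exp (- (s - s)))"
      unfolding I_def
    proof (rule nn_integral_FTC_atLeast[OF _ _ _ lim(2)])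
      fix u assume u: "s \<le> u"
      then show "((\<lambda>u. - (s / u) * exp (- (u - s))) has_real_derivative f1 u + f2 u) (at u)"
        using s by (auto intro!: derivative_eq_intros simp: f1_def f2_def power2_eq_square field_simps)
    qed (use nonneg in auto)
    finally show ?thesis using s by simp
  qed
  define g where "g u = (1 - s / u) * exp (- (u - s))" for u
  have [measurable]: "g \<in> borel_measurable borel" unfolding g_def[abs_def] by measurable
  have g_nonneg: "0 \<le> g u" if "s \<le> u" for u
    using that s by (auto simp: g_def)
  have sumg: "I g + I f2 = 1"
  proof -
    have "I g + I f2 = I (\<lambda>u. g u + f2 u)" by (rule I_add[symmetric]) (use nonneg g_nonneg in auto)
    also have "(\<lambda>u. g u + f2 u) = (\<lambda>u. exp (- (u - s)))" by (auto simp: g_def f2_def algebra_simps)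
    also have "I \<dots> = 0 - (- exp (- (s - s)))"
      unfolding I_def
      by (rule nn_integral_FTC_atLeast[OF _ _ _ lim(1)]) (auto intro!: derivative_eq_intros)
    finally show ?thesis by simp
  qed
  have sumh: "I (\<lambda>u. g u * (s / u)) + ennreal s * I f1 = I f2"
  proof -
    have "ennreal s * I f1 = I (\<lambda>u. s * f1 u)"
      unfolding I_def using s by (subst nn_integral_cmult[symmetric]) (auto simp: ennreal_mult' mult.assoc)
    then have "I (\<lambda>u. g u * (s / u)) + ennreal s * I f1 = I (\<lambda>u. g u * (s / u) + s * f1 u)"
      by (simp, subst I_add) (use nonneg g_nonneg s in auto)
    also have "(\<lambda>u. g u * (s / u) + s * f1 u) = f2"
      by (auto simp: g_def f1_def f2_def fun_eq_iff power2_eq_square algebra_simps)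
    finally show ?thesis .
  qed
  \<comment> \<open>Finiteness is what allows cancellation in \<open>ennreal\<close> and the passage
    to real constants.\<close>
  have le: "I f1 \<le> 1" "I f2 \<le> 1" unfolding sum12[symmetric] by (rule add_increasing2[OF zero_le order_refl] add_increasing[OF zero_le order_refl])+
  have pos: "0 < I f" if [measurable]: "f \<in> borel_measurable borel" and f: "\<And>u. s \<le> u \<Longrightarrow> 0 < f u" for f
  proof (rule ccontr)
    assume "\<not> 0 < I f"
    then have "(\<integral>\<^sup>+u. ennreal (f u) * indicator {s..} u \<partial>lborel) = 0" by (simp add: I_def)
    then have "AE u in lborel. ennreal (f u) * indicator {s..} u = 0"
      by (subst (asm) nn_integral_0_iff_AE) auto
    then have "AE u in lborel. u \<notin> {s..s+1}"
      by eventually_elim (use f in \<open>force simp: indicator_def split: if_splits\<close>)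
    then have "{s..s+1} \<in> null_sets lborel"
      by (subst AE_iff_null_sets) auto
    then have "emeasure lborel {s..s+1} = 0" by (rule null_setsD1)
    then show False by simp
  qed
  have fpos: "0 < f1 u" "0 < f2 u" if "s \<le> u" for u using that s by (auto simp: f1_def f2_def)
  have "0 < I f1" "0 < I f2" by (rule pos; use fpos in simp)+
  moreover obtain c where c: "I f1 = ennreal c" "0 \<le> c"
    using le(1) by (cases "I f1") (auto simp: top_unique)
  moreover obtain A where A: "I f2 = ennreal A" "0 \<le> A"
    using le(2) by (cases "I f2") (auto simp: top_unique)
  moreover have "I g = I f1"
  proof -
    have "I f2 + I g = I f2 + I f1" using sum12 sumg by (simp add: add.commute)
    moreover have "I f2 \<noteq> \<top>" using le(2) by (auto simp: top_unique)
    ultimately show ?thesis by (simp add: ennreal_add_left_cancel)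
  qed
  ultimately show ?thesis
    using that[of c A] d j sumh I_open[of g] I_open[of "\<lambda>u. g u * (s / u)"]
    by (simp add: g_def)
qed

text \<open>Coordinates are \<open>x = fst a\<close> and \<open>u = - snd a\<close>. The jump term is the density of an entry atom of box
  area at most \<open>s\<close>, the drift term that of one whose remaining box shrinks to area \<open>s\<close> at time
  \<open>1 - s / u\<close>.\<close>

definition jump_term :: "real \<Rightarrow> nat \<Rightarrow> real \<Rightarrow> real \<Rightarrow> real \<Rightarrow> ennreal" where
  "jump_term s j w x u = (if j \<noteq> 0 \<and> 0 \<le> x \<and> x < w \<and> 0 \<le> u \<and> (1 - x) * u \<le> s
     then ennreal (exp (- (x * s / (1 - x))) * p_fun (j - 1) ((w - x) * u)) else 0)"

definition drift_term :: "real \<Rightarrow> nat \<Rightarrow> real \<Rightarrow> real \<Rightarrow> real \<Rightarrow> ennreal" where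
  "drift_term s j w x u = (if s < u \<and> 0 \<le> x \<and> s < (1 - x) * u \<and> (1 - w) * u \<le> s
     then ennreal (exp (- (u - s)) * p_fun j (s - (1 - w) * u)) else 0)"

lemma measurable_jump_term [measurable (raw)]:
  assumes [measurable]: "w \<in> borel_measurable M" "x \<in> borel_measurable M" "u \<in> borel_measurable M"
  shows "(\<lambda>z. jump_term s j (w z) (x z) (u z)) \<in> borel_measurable M"
  unfolding jump_term_def by measurable

lemma measurable_drift_term [measurable (raw)]:
  assumes [measurable]: "w \<in> borel_measurable M" "x \<in> borel_measurable M" "u \<in> borel_measurable M"
  shows "(\<lambda>z. drift_term s j (w z) (x z) (u z)) \<in> borel_measurable M"
  unfolding drift_term_def by measurable

lemma entry_event_terms:
  assumes s: "0 < s" and w: "w \<le> 1" and a: "snd a \<noteq> 0"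
  shows "emeasure config_space {\<omega>. entry_event s w j a (pts \<omega>)} * indicator strip a =
    jump_term s j w (fst a) (- snd a) + drift_term s j w (fst a) (- snd a)"
proof -
  define x u where "x = fst a" and "u = - snd a"
  have drift_x: "x < 1 - s / u" if "s < u" "s < (1 - x) * u" using that s by (simp add: field_simps)
  have early_iff: "a \<in> early s w \<longleftrightarrow> x < w \<and> (1 - w) * u \<le> s" by (simp add: early_def x_def u_def)
  consider "a \<notin> strip" | "a \<in> strip" "a \<notin> early s w" | "a \<in> strip" "a \<in> early s w" "(1 - x) * u \<le> s"
    | "a \<in> strip" "a \<in> early s w" "s < (1 - x) * u" by linarith
  then show ?thesis
  proof cases
    case 1
    then have "x < 0 \<or> 1 < x \<or> u < 0" by (auto simp: strip_def x_def u_def mem_Times_iff)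
    then have "\<not> (s < u \<and> 0 \<le> x \<and> s < (1 - x) * u)" "\<not> (0 \<le> x \<and> x < w \<and> 0 \<le> u)"
      using s w mult_nonpos_nonneg[of "1 - x" u] by auto
    then show ?thesis
      unfolding jump_term_def drift_term_def x_def[symmetric] u_def[symmetric] using 1 by auto
  next
    case 2
    have u: "0 \<le> u" using 2 by (auto simp: strip_def u_def mem_Times_iff)
    have "\<not> (x < w \<and> (1 - x) * u \<le> s)"
    proof
      assume *: "x < w \<and> (1 - x) * u \<le> s"
      then have "(1 - w) * u \<le> (1 - x) * u" using u by (intro mult_right_mono) auto
      with * 2 early_iff show False by auto
    qed
    \<comment> \<open>The bounds \<open>(1 - w) * u \<le> s < (1 - x) * u\<close> force
      \<open>x < w\<close>; this is how \<open>drift_term\<close> encodes that the atom lies before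
      the line.\<close>
    moreover have "\<not> (s < u \<and> s < (1 - x) * u \<and> (1 - w) * u \<le> s)"
    proof
      assume *: "s < u \<and> s < (1 - x) * u \<and> (1 - w) * u \<le> s"
      then have "(1 - w) * u < (1 - x) * u" by linarith
      then have "x < w" using * s by (simp add: mult_less_cancel_right)
      with * 2 early_iff show False by auto
    qed
    ultimately show ?thesis
      unfolding jump_term_def drift_term_def x_def[symmetric] u_def[symmetric] using 2 by (auto simp: entry_event_def)
  next
    case 3
    then have b: "0 \<le> x" "0 < u" "x < w" using a early_iff by (auto simp: strip_def x_def u_def mem_Times_iff)
    have area: "box_area a \<le> s" using 3 b by (simp add: box_area_def x_def u_def)
    have e: "entry s a = x"
      using area b box_area_le_iff[of a s] by (simp add: entry_def x_def u_def)
    show ?thesis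
      using emeasure_entry_event[OF s, of a w j] b 3 w area e
      by (auto simp: jump_term_def drift_term_def x_def u_def)
  next
    case 4
    then have b: "0 \<le> x" "0 < u" "x < w" "(1 - w) * u \<le> s" using a early_iff by (auto simp: strip_def x_def u_def mem_Times_iff)
    have area: "\<not> box_area a \<le> s" using 4 b by (simp add: box_area_def x_def u_def)
    have e: "entry s a = 1 - s / u"
      using area b box_area_le_iff[of a s] by (simp add: entry_def x_def u_def)
    have "(1 - x) * u \<le> 1 * u" by (rule mult_right_mono) (use b in auto)
    then have su: "s < u" using 4(3) by linarith
    \<comment> \<open>At the entry time \<open>1 - s / u\<close> the early region has area
      \<open>u - s\<close>, and the rectangle of later records is the box of area \<open>s\<close>
      less the part of area \<open>(1 - w) * u\<close> beyond the line.\<close>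
    have "entry s a * s / (1 - entry s a) = u - s" "(w - entry s a) * u = s - (1 - w) * u"
      unfolding e using b s by (simp_all add: field_simps)
    then show ?thesis
      using emeasure_entry_event[OF s, of a w j] b 4 w area su
      by (auto simp: jump_term_def drift_term_def x_def u_def)
  qed
qed

section \<open>Integrals of the jump and drift terms, for a fixed and for a random line\<close>

definition jump_int :: "real \<Rightarrow> nat \<Rightarrow> real \<Rightarrow> ennreal" where
  "jump_int s j w = (\<integral>\<^sup>+x. \<integral>\<^sup>+u. jump_term s j w x u \<partial>lborel \<partial>lborel)"

definition drift_int :: "real \<Rightarrow> nat \<Rightarrow> real \<Rightarrow> ennreal" where
  "drift_int s j w = (\<integral>\<^sup>+x. \<integral>\<^sup>+u. drift_term s j w x u \<partial>lborel \<partial>lborel)"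

lemma emeasure_low_recs_terms:
  assumes s: "0 < s" and w: "w \<le> 1"
  shows "emeasure config_space {\<omega>. pts \<omega> \<inter> early s w \<noteq> {} \<and> num (low_recs s w (pts \<omega>)) j} =
    jump_int s j w + drift_int s j w"
proof -
  have "emeasure config_space {\<omega>. pts \<omega> \<inter> early s w \<noteq> {} \<and> num (low_recs s w (pts \<omega>)) j} =
    (\<integral>\<^sup>+a. jump_term s j w (fst a) (- snd a) + drift_term s j w (fst a) (- snd a) \<partial>lborel)"
    unfolding emeasure_low_recs[OF s]
    by (rule nn_integral_cong_AE, rule AE_mp[OF AE_lborel_pair_coords(2)[of 0]], rule AE_I2)
       (use entry_event_terms[OF s w] in blast)
  also have "\<dots> = (\<integral>\<^sup>+x. \<integral>\<^sup>+y. jump_term s j w x (- y) + drift_term s j w x (- y) \<partial>lborel \<partial>lborel)"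
    by (subst nn_integral_lborel_pair) simp_all
  also have "\<dots> = (\<integral>\<^sup>+x. \<integral>\<^sup>+u. jump_term s j w x u + drift_term s j w x u \<partial>lborel \<partial>lborel)"
    by (subst nn_integral_reflect[symmetric]) simp_all
  also have "\<dots> = jump_int s j w + drift_int s j w"
    unfolding jump_int_def drift_int_def by (simp add: nn_integral_add)
  finally show ?thesis .
qed

lemma nn_integral_jump_term:
  assumes s: "0 < s" and j: "j \<noteq> 0" and x: "0 \<le> x" "x < w" "w \<le> 1"
  shows "(\<integral>\<^sup>+u. jump_term s j w x u \<partial>lborel) =
    ennreal (exp (- (x * s / (1 - x))) * (p_int (j - 1) ((w - x) * (s / (1 - x))) / (w - x)))"
proof -
  have "(\<integral>\<^sup>+u. jump_term s j w x u \<partial>lborel) =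
    (\<integral>\<^sup>+u. ennreal (exp (- (x * s / (1 - x)))) * (ennreal (p_fun (j - 1) ((w - x) * u)) * indicator {0..s / (1 - x)} u) \<partial>lborel)"
  proof (rule nn_integral_cong)
    fix u :: real
    have "(1 - x) * u \<le> s \<longleftrightarrow> u \<le> s / (1 - x)" using x by (simp add: field_simps)
    then show "jump_term s j w x u = ennreal (exp (- (x * s / (1 - x)))) * (ennreal (p_fun (j - 1) ((w - x) * u)) * indicator {0..s / (1 - x)} u)"
      using j x by (auto simp: jump_term_def ennreal_mult' indicator_def)
  qed
  also have "\<dots> = ennreal (exp (- (x * s / (1 - x)))) * ennreal (p_int (j - 1) ((w - x) * (s / (1 - x))) / (w - x))"
    using x s by (subst nn_integral_cmult) (simp_all add: nn_integral_p_fun_scaled)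
  finally show ?thesis by (simp only: ennreal_mult'[OF exp_ge_zero])
qed

text \<open>With the line at the right edge the rectangle of later records has area
  \<open>(1 - x) * u\<close>, which runs over \<open>[0, s]\<close> whatever \<open>x\<close> is.
  The integral over \<open>u\<close> is therefore \<open>p_int (j - 1) s / (1 - x)\<close> times the
  void factor, and \<open>q_fun (j - 1) s\<close> splits off.\<close>

lemma jump_int_1:
  assumes s: "0 < s" and j: "j \<noteq> 0"
  shows "jump_int s j 1 = ennreal (q_fun (j - 1) s) * jump_const s"
proof -
  have "jump_int s j 1 = (\<integral>\<^sup>+x. ennreal (q_fun (j - 1) s) * (ennreal (exp (- (x * s / (1 - x))) * (s / (1 - x))) * indicator {0..<1} x) \<partial>lborel)"
    unfolding jump_int_def
  proof (rule nn_integral_cong)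
    fix x :: real
    show "(\<integral>\<^sup>+u. jump_term s j 1 x u \<partial>lborel) = ennreal (q_fun (j - 1) s) * (ennreal (exp (- (x * s / (1 - x))) * (s / (1 - x))) * indicator {0..<1} x)"
    proof (cases "x \<in> {0..<1}")
      case True
      have "(\<integral>\<^sup>+u. jump_term s j 1 x u \<partial>lborel) =
          ennreal (exp (- (x * s / (1 - x))) * (p_int (j - 1) ((1 - x) * (s / (1 - x))) / (1 - x)))"
        using True by (intro nn_integral_jump_term[OF s j]) auto
      also have "exp (- (x * s / (1 - x))) * (p_int (j - 1) ((1 - x) * (s / (1 - x))) / (1 - x)) =
        q_fun (j - 1) s * (exp (- (x * s / (1 - x))) * (s / (1 - x)))"
        using True s by (simp add: q_fun_eq)
      also have "ennreal \<dots> = ennreal (q_fun (j - 1) s) * ennreal (exp (- (x * s / (1 - x))) * (s / (1 - x)))"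
        using s by (intro ennreal_mult') (simp add: q_fun_eq(1) p_int_nonneg)
      finally show ?thesis using True by (simp only: indicator_simps mult_1_right)
    qed (auto simp: jump_term_def indicator_def)
  qed
  also have "\<dots> = ennreal (q_fun (j - 1) s) * jump_const s"
    unfolding jump_const_def by (rule nn_integral_cmult) measurable
  finally show ?thesis .
qed

text \<open>For fixed \<open>x\<close>, integrating over \<open>w\<close> before \<open>x\<close>
  meets the derivative of \<open>p_fun j + p_int j\<close>. The value is the same for all
  \<open>x\<close> up to the void factor, which is why the jumps end up with
  \<open>drift_const\<close> and not \<open>jump_const\<close>.\<close>

lemma nn_integral_jump_int:
  assumes s: "0 < s" and j: "j \<noteq> 0"
  shows "(\<integral>\<^sup>+w. jump_int s j w * indicator {0..1} w \<partial>lborel) = ennreal (p_fun j s + p_int j s) * drift_const s"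
proof -
  have [measurable]: "(\<lambda>w. \<integral>\<^sup>+u. jump_term s j w x u \<partial>lborel) \<in> borel_measurable borel"
    "(\<lambda>x. \<integral>\<^sup>+u. jump_term s j w x u \<partial>lborel) \<in> borel_measurable borel" for x w
    by measurable
  have "(\<integral>\<^sup>+w. jump_int s j w * indicator {0..1} w \<partial>lborel) =
    (\<integral>\<^sup>+w. \<integral>\<^sup>+x. (\<integral>\<^sup>+u. jump_term s j w x u \<partial>lborel) * indicator {0..1} w \<partial>lborel \<partial>lborel)"
    unfolding jump_int_def by (intro nn_integral_cong nn_integral_multc[symmetric]) simp
  also have "\<dots> = (\<integral>\<^sup>+x. \<integral>\<^sup>+w. (\<integral>\<^sup>+u. jump_term s j w x u \<partial>lborel) * indicator {0..1} w \<partial>lborel \<partial>lborel)"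
    by (rule lborel_pair.Fubini') measurable
  also have "\<dots> = (\<integral>\<^sup>+x. ennreal (p_fun j s + p_int j s) * (ennreal (exp (- (x * s / (1 - x)))) * indicator {0..<1} x) \<partial>lborel)"
  proof (rule nn_integral_cong)
    fix x :: real
    show "(\<integral>\<^sup>+w. (\<integral>\<^sup>+u. jump_term s j w x u \<partial>lborel) * indicator {0..1} w \<partial>lborel) =
      ennreal (p_fun j s + p_int j s) * (ennreal (exp (- (x * s / (1 - x)))) * indicator {0..<1} x)"
    proof (cases "x \<in> {0..<1}")
      case True
      \<comment> \<open>With this \<open>k\<close> the argument \<open>k * (w - x)\<close> runs from
        0 to \<open>s\<close> as \<open>w\<close> goes from \<open>x\<close> to 1; at 0 the
        antiderivative vanishes because \<open>j \<noteq> 0\<close>.\<close>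
      define k where "k = s / (1 - x)"
      have k: "0 < k" "k * (1 - x) = s" using True s by (auto simp: k_def)
      have "(\<integral>\<^sup>+w. (\<integral>\<^sup>+u. jump_term s j w x u \<partial>lborel) * indicator {0..1} w \<partial>lborel) =
        (\<integral>\<^sup>+w. ennreal (exp (- (x * s / (1 - x)))) * (ennreal (k * (exp (- (k * (w - x))) * rec_gf' j (k * (w - x)))) * indicator {x..1} w) \<partial>lborel)"
      proof (rule nn_integral_cong_AE, rule AE_mp[OF AE_lborel_singleton[of x]], rule AE_I2, rule impI)
        fix w assume wx: "w \<noteq> x"
        show "(\<integral>\<^sup>+u. jump_term s j w x u \<partial>lborel) * indicator {0..1} w =
          ennreal (exp (- (x * s / (1 - x)))) * (ennreal (k * (exp (- (k * (w - x))) * rec_gf' j (k * (w - x)))) * indicator {x..1} w)"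
        proof (cases "x < w \<and> w \<le> 1")
          case w: True
          have "p_int (j - 1) ((w - x) * (s / (1 - x))) / (w - x) = k * (exp (- (k * (w - x))) * rec_gf' j (k * (w - x)))"
            using w j by (simp add: p_int_def k_def mult.commute)
          then show ?thesis
            using nn_integral_jump_term[OF s j, of x w] w True by (simp add: ennreal_mult')
        next
          case False
          then show ?thesis using wx by (auto simp: jump_term_def indicator_def)
        qed
      qed
      also have "\<dots> = ennreal (exp (- (x * s / (1 - x)))) * (\<integral>\<^sup>+w. (ennreal (k * (exp (- (k * (w - x))) * rec_gf' j (k * (w - x)))) * indicator {x..1} w) \<partial>lborel)"
        by (rule nn_integral_cmult) measurable
      also have "(\<integral>\<^sup>+w. (ennreal (k * (exp (- (k * (w - x))) * rec_gf' j (k * (w - x)))) * indicator {x..1} w) \<partial>lborel) =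
         ennreal ((p_fun j (k * (1 - x)) + p_int j (k * (1 - x))) - (p_fun j (k * (x - x)) + p_int j (k * (x - x))))"
      proof (rule nn_integral_FTC_Icc)
        fix w assume "w \<in> {x..1}"
        then have w: "x \<le> w" "w \<le> 1" by auto
        show "((\<lambda>w. p_fun j (k * (w - x)) + p_int j (k * (w - x))) has_real_derivative
            k * (exp (- (k * (w - x))) * rec_gf' j (k * (w - x)))) (at w)"
          by (auto intro!: derivative_eq_intros DERIV_chain2[OF DERIV_p_fun] simp: algebra_simps)
        show "0 \<le> k * (exp (- (k * (w - x))) * rec_gf' j (k * (w - x)))"
          using w k by (simp add: rec_gf'_nonneg)
      qed (use True in auto)
      also have "\<dots> = ennreal (p_fun j s + p_int j s)"
        using j p_fun_Suc_0[of "j - 1"] by (simp add: k)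
      finally show ?thesis using True by (simp add: mult.commute)
    next
      case False
      then have "jump_term s j w x = (\<lambda>_. 0)" if "w \<in> {0..1}" for w
        using that by (auto simp: jump_term_def fun_eq_iff)
      then have 0: "(\<integral>\<^sup>+u. jump_term s j w x u \<partial>lborel) * indicator {0..1} w = 0" for w
        by (cases "w \<in> {0..1}") (auto simp: indicator_def)
      show ?thesis unfolding 0 using False by simp
    qed
  qed
  also have "\<dots> = ennreal (p_fun j s + p_int j s) * drift_const s"
    unfolding drift_const_def by (rule nn_integral_cmult) measurable
  finally show ?thesis .
qed

text \<open>For fixed \<open>u\<close> and \<open>w\<close>, \<open>drift_term\<close> depends on
  \<open>x\<close> only through \<open>0 \<le> x < 1 - s / u\<close>, so integrating over
  \<open>x\<close> first gives the factor \<open>1 - s / u\<close>.\<close>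

lemma drift_int_eq:
  assumes s: "0 < s"
  shows "drift_int s j w = (\<integral>\<^sup>+u. ennreal ((1 - s / u) * exp (- (u - s))) * indicator {s<..} u *
    (ennreal (p_fun j (s - (1 - w) * u)) * indicator {u. (1 - w) * u \<le> s} u) \<partial>lborel)"
proof -
  have "drift_int s j w = (\<integral>\<^sup>+u. \<integral>\<^sup>+x. drift_term s j w x u \<partial>lborel \<partial>lborel)"
    unfolding drift_int_def by (rule lborel_pair.Fubini'[symmetric]) measurable
  also have "\<dots> = (\<integral>\<^sup>+u. ennreal ((1 - s / u) * exp (- (u - s))) * indicator {s<..} u *
    (ennreal (p_fun j (s - (1 - w) * u)) * indicator {u. (1 - w) * u \<le> s} u) \<partial>lborel)"
  proof (rule nn_integral_cong)
    fix u :: real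
    show "(\<integral>\<^sup>+x. drift_term s j w x u \<partial>lborel) = ennreal ((1 - s / u) * exp (- (u - s))) * indicator {s<..} u *
      (ennreal (p_fun j (s - (1 - w) * u)) * indicator {u. (1 - w) * u \<le> s} u)"
    proof (cases "s < u \<and> (1 - w) * u \<le> s")
      case True
      have "(\<integral>\<^sup>+x. drift_term s j w x u \<partial>lborel) =
        (\<integral>\<^sup>+x. ennreal (exp (- (u - s)) * p_fun j (s - (1 - w) * u)) * indicator {0..<1 - s / u} x \<partial>lborel)"
      proof (rule nn_integral_cong)
        fix x :: real
        have "s < (1 - x) * u \<longleftrightarrow> x < 1 - s / u" using True s by (simp add: field_simps)
        then show "drift_term s j w x u = ennreal (exp (- (u - s)) * p_fun j (s - (1 - w) * u)) * indicator {0..<1 - s / u} x"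
          using True by (auto simp: drift_term_def indicator_def)
      qed
      also have "\<dots> = ennreal (exp (- (u - s)) * p_fun j (s - (1 - w) * u)) * ennreal (1 - s / u)"
        using True s by (subst nn_integral_cmult_indicator) auto
      finally show ?thesis using True s p_fun_nonneg[of "s - (1 - w) * u" j]
        by (simp add: ennreal_mult mult_ac)
    qed (auto simp: drift_term_def indicator_def)
  qed
  finally show ?thesis .
qed

text \<open>At \<open>w = 1\<close> the rectangle of later records is the whole remaining box of
  area \<open>s\<close>, whatever \<open>u\<close> is.\<close>

lemma drift_int_1:
  assumes s: "0 < s"
  shows "drift_int s j 1 = ennreal (p_fun j s) *
    (\<integral>\<^sup>+u. ennreal ((1 - s / u) * exp (- (u - s))) * indicator {s<..} u \<partial>lborel)"
  unfolding drift_int_eq[OF s] using s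
  by (subst nn_integral_cmult[symmetric]) (auto simp: mult.commute)

text \<open>The remaining area \<open>s - (1 - w) * u\<close> grows at rate \<open>u\<close> from 0
  to \<open>s\<close> as \<open>w\<close> runs from \<open>1 - s / u\<close> to 1, so integrating
  \<open>p_fun j\<close> gives \<open>p_int j s / u = q_fun j s * (s / u)\<close>.\<close>

lemma nn_integral_drift_int:
  assumes s: "0 < s"
  shows "(\<integral>\<^sup>+w. drift_int s j w * indicator {0..1} w \<partial>lborel) = ennreal (q_fun j s) *
    (\<integral>\<^sup>+u. ennreal ((1 - s / u) * exp (- (u - s)) * (s / u)) * indicator {s<..} u \<partial>lborel)"
proof -
  define h where "h w u = ennreal ((1 - s / u) * exp (- (u - s))) * indicator {s<..} u *
    (ennreal (p_fun j (s - (1 - w) * u)) * indicator {u. (1 - w) * u \<le> s} u)" for w u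
  have h_eq: "h w u = (if s < u \<and> (1 - w) * u \<le> s then ennreal ((1 - s / u) * exp (- (u - s))) * ennreal (p_fun j (s - (1 - w) * u)) else 0)" for w u
    by (auto simp: h_def indicator_def)
  have [measurable]: "(\<lambda>z. h (f z) (g z)) \<in> borel_measurable M" if [measurable]: "f \<in> borel_measurable M" "g \<in> borel_measurable M" for f g and M :: "'z measure"
    unfolding h_eq by measurable
  have "(\<integral>\<^sup>+w. drift_int s j w * indicator {0..1} w \<partial>lborel) =
    (\<integral>\<^sup>+w. \<integral>\<^sup>+u. h w u * indicator {0..1} w \<partial>lborel \<partial>lborel)"
    unfolding drift_int_eq[OF s] h_def[symmetric] by (intro nn_integral_cong nn_integral_multc[symmetric]) measurable
  also have "\<dots> = (\<integral>\<^sup>+u. \<integral>\<^sup>+w. h w u * indicator {0..1} w \<partial>lborel \<partial>lborel)"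
    by (rule lborel_pair.Fubini') measurable
  also have "\<dots> = (\<integral>\<^sup>+u. ennreal (q_fun j s) * (ennreal ((1 - s / u) * exp (- (u - s)) * (s / u)) * indicator {s<..} u) \<partial>lborel)"
  proof (rule nn_integral_cong)
    fix u :: real
    show "(\<integral>\<^sup>+w. h w u * indicator {0..1} w \<partial>lborel) = ennreal (q_fun j s) * (ennreal ((1 - s / u) * exp (- (u - s)) * (s / u)) * indicator {s<..} u)"
    proof (cases "s < u")
      case True
      have u: "0 < u" "s / u < 1" using True s by auto
      have "(\<integral>\<^sup>+w. h w u * indicator {0..1} w \<partial>lborel) =
        (\<integral>\<^sup>+w. ennreal ((1 - s / u) * exp (- (u - s))) * (ennreal (p_fun j (s - (1 - w) * u)) * indicator {1 - s / u..1} w) \<partial>lborel)"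
      proof (rule nn_integral_cong)
        fix w :: real
        have *: "(1 - w) * u \<le> s \<longleftrightarrow> 1 - s / u \<le> w" using u by (simp add: field_simps)
        have **: "0 \<le> w" if "1 - s / u \<le> w" using u that by linarith
        show "h w u * indicator {0..1} w = ennreal ((1 - s / u) * exp (- (u - s))) * (ennreal (p_fun j (s - (1 - w) * u)) * indicator {1 - s / u..1} w)"
          unfolding h_eq * using True ** by (simp add: indicator_def)
      qed
      also have "\<dots> = ennreal ((1 - s / u) * exp (- (u - s))) * (\<integral>\<^sup>+w. ennreal (p_fun j (s - (1 - w) * u)) * indicator {1 - s / u..1} w \<partial>lborel)"
        by (rule nn_integral_cmult) measurable
      also have "(\<integral>\<^sup>+w. ennreal (p_fun j (s - (1 - w) * u)) * indicator {1 - s / u..1} w \<partial>lborel) =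
        ennreal (p_int j (s - (1 - 1) * u) / u - p_int j (s - (1 - (1 - s / u)) * u) / u)"
      proof (rule nn_integral_FTC_Icc)
        fix w assume "w \<in> {1 - s / u..1}"
        then have w: "1 - s / u \<le> w" by simp
        then have "(1 - w) * u \<le> s" using u by (simp add: field_simps)
        then show "0 \<le> p_fun j (s - (1 - w) * u)" by (intro p_fun_nonneg) simp
        show "((\<lambda>w. p_int j (s - (1 - w) * u) / u) has_real_derivative p_fun j (s - (1 - w) * u)) (at w)"
          by (use u in \<open>auto intro!: derivative_eq_intros\<close>)
      qed (use u s in auto)
      also have "\<dots> = ennreal (q_fun j s * (s / u))"
        using u s by (simp add: q_fun_eq(1))
      finally show ?thesis using True u s p_int_nonneg[of s j]
        by (simp add: q_fun_eq(1) ennreal_mult'[symmetric] ennreal_mult''[symmetric] mult_ac)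
    qed (simp add: h_def)
  qed
  also have "\<dots> = ennreal (q_fun j s) * (\<integral>\<^sup>+u. ennreal ((1 - s / u) * exp (- (u - s)) * (s / u)) * indicator {s<..} u \<partial>lborel)"
    by (rule nn_integral_cmult) measurable
  finally show ?thesis .
qed

section \<open>The two record counts\<close>

text \<open>For \<open>j = 0\<close> there is no jump contribution, but the event without early
  atoms contributes \<open>drift_const s\<close>. This identity gives it the form
  \<open>(p_fun j s + p_int j s) * drift_const s\<close> that the jumps have for
  \<open>j > 0\<close>.\<close>

lemma p_fun_0_plus_p_int:
  assumes "0 \<le> s"
  shows "p_fun 0 s + p_int 0 s = 1"
proof -
  have "rec_gf' 0 t = 0" for t
  proof -
    have "((\<lambda>t. rec_gf 0 t) has_real_derivative 0) (at t)"
      unfolding rec_gf_0 by simp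
    then show ?thesis using DERIV_unique[OF DERIV_rec_gf[of 0 t]] by simp
  qed
  then have "((\<lambda>t. p_fun 0 t + p_int 0 t) has_real_derivative 0) (at t)" for t
    using DERIV_add[OF DERIV_p_fun[of 0 t] DERIV_p_int[of 0 t]] by simp
  then have "p_fun 0 s + p_int 0 s = p_fun 0 0 + p_int 0 0"
    by (intro DERIV_isconst_all) auto
  then show ?thesis by (simp add: p_fun_0)
qed

text \<open>Without an early atom no record is counted, so that event shows up only for
  \<open>j = 0\<close>.\<close>

lemma low_recs_split:
  assumes s: "0 < s" and w: "w \<le> 1"
  shows "emeasure config_space {\<omega>. num (low_recs s w (pts \<omega>)) j} = jump_int s j w + drift_int s j w +
    (if j = 0 then emeasure config_space {\<omega>. pts \<omega> \<inter> early s w = {}} else 0)"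
proof -
  have P1: "Measurable.pred config_space (\<lambda>\<omega>. pts \<omega> \<inter> early s w = {})"
    by (rule pred_no_early) auto
  have P2: "Measurable.pred config_space (\<lambda>\<omega>. num (low_recs s w (pts \<omega>)) j)"
    by (rule pred_num_low_recs) auto
  have m1: "{\<omega>. pts \<omega> \<inter> early s w \<noteq> {} \<and> num (low_recs s w (pts \<omega>)) j} \<in> sets config_space"
    using pred_intros_logic(3)[OF pred_intros_logic(2)[OF P1] P2] by (simp add: pred_def)
  have m2: "{\<omega>. pts \<omega> \<inter> early s w = {} \<and> num (low_recs s w (pts \<omega>)) j} \<in> sets config_space"
    using pred_intros_logic(3)[OF P1 P2] by (simp add: pred_def)
  have m3: "{\<omega>. pts \<omega> \<inter> early s w = {} \<and> j = 0} \<in> sets config_space"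
    using P1 by (cases "j = 0") (simp_all add: pred_def)
  have "{\<omega>. num (low_recs s w (pts \<omega>)) j} = {\<omega>. pts \<omega> \<inter> early s w \<noteq> {} \<and> num (low_recs s w (pts \<omega>)) j} \<union>
     {\<omega>. pts \<omega> \<inter> early s w = {} \<and> num (low_recs s w (pts \<omega>)) j}" by auto
  also have "emeasure config_space \<dots> = emeasure config_space {\<omega>. pts \<omega> \<inter> early s w \<noteq> {} \<and> num (low_recs s w (pts \<omega>)) j} +
     emeasure config_space {\<omega>. pts \<omega> \<inter> early s w = {} \<and> num (low_recs s w (pts \<omega>)) j}"
    by (rule plus_emeasure[OF m1 m2, symmetric]) auto
  also have "emeasure config_space {\<omega>. pts \<omega> \<inter> early s w = {} \<and> num (low_recs s w (pts \<omega>)) j} =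
     emeasure config_space {\<omega>. pts \<omega> \<inter> early s w = {} \<and> j = 0}"
  proof (rule emeasure_eq_AE[OF _ m2 m3])
    show "AE \<omega> in config_space. \<omega> \<in> {\<omega>. pts \<omega> \<inter> early s w = {} \<and> num (low_recs s w (pts \<omega>)) j} \<longleftrightarrow>
        \<omega> \<in> {\<omega>. pts \<omega> \<inter> early s w = {} \<and> j = 0}"
      using AE_generic
    proof eventually_elim
      fix \<omega> assume "inj_on (snd \<omega>) (idx \<omega>) \<and> generic (pts \<omega>)"
      then have "low_recs s w (pts \<omega>) = {}" if "pts \<omega> \<inter> early s w = {}"
        using low_recs_no_early that by blast
      then show "\<omega> \<in> {\<omega>. pts \<omega> \<inter> early s w = {} \<and> num (low_recs s w (pts \<omega>)) j} \<longleftrightarrow>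
        \<omega> \<in> {\<omega>. pts \<omega> \<inter> early s w = {} \<and> j = 0}"
        by (auto simp: num_def)
    qed
  qed
  finally show ?thesis by (simp add: emeasure_low_recs_terms[OF s w])
qed

section \<open>The closed formulas for both record counts\<close>

lemma records_eq_recs: "records \<omega> = recs (pts (fst \<omega>))"
  by (auto simp: records_def recs_def atoms_eq_pts)

lemma PPP_space_eq: "PPP_space = config_space \<Otimes>\<^sub>M uniform_measure lborel {0..1}"
  by (simp add: PPP_space_def config_space_def counts_space_def points_space_def)

lemma prob_space_W: "prob_space (uniform_measure lborel {0..1::real})"
  by (rule prob_space_uniform_measure) auto

interpretation W: prob_space "uniform_measure lborel {0..1::real}" by (rule prob_space_W)
interpretation PPP: pair_prob_space config_space "uniform_measure lborel {0..1::real}" ..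

lemma emeasure_PPP:
  assumes "Measurable.pred (config_space \<Otimes>\<^sub>M borel) (\<lambda>\<omega>. Q (fst \<omega>) (snd \<omega>))"
  shows "emeasure PPP_space {\<omega> \<in> space PPP_space. Q (fst \<omega>) (snd \<omega>)} =
    (\<integral>\<^sup>+w. emeasure config_space {\<omega>. Q \<omega> w} * indicator {0..1} w \<partial>lborel)"
proof -
  let ?W = "uniform_measure lborel {0..1::real}"
  have sp: "space PPP_space = UNIV" by (simp add: PPP_space_eq space_pair_measure)
  have eq: "sets (config_space \<Otimes>\<^sub>M borel) = sets (config_space \<Otimes>\<^sub>M ?W)"
    by (rule sets_pair_measure_cong) simp_all
  have m: "{\<omega>. Q (fst \<omega>) (snd \<omega>)} \<in> sets (config_space \<Otimes>\<^sub>M ?W)"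
    using assms unfolding eq[symmetric] by (simp add: pred_def space_pair_measure)
  have "emeasure PPP_space {\<omega> \<in> space PPP_space. Q (fst \<omega>) (snd \<omega>)} =
    (\<integral>\<^sup>+w. emeasure config_space ((\<lambda>\<omega>. (\<omega>, w)) -` {\<omega>. Q (fst \<omega>) (snd \<omega>)}) \<partial>?W)"
    using PPP.emeasure_pair_measure_alt2[OF m] unfolding sp by (simp add: PPP_space_eq)
  also have "\<dots> = (\<integral>\<^sup>+w. emeasure config_space ((\<lambda>\<omega>. (\<omega>, w)) -` {\<omega>. Q (fst \<omega>) (snd \<omega>)}) * indicator {0..1} w \<partial>lborel)"
    using PPP.measurable_emeasure_Pair2[OF m] by (subst nn_integral_uniform_measure) (simp_all add: divide_ennreal_def)
  finally show ?thesis by (simp add: vimage_def)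
qed

lemma q_inf_eq:
  assumes s: "0 < s" and c: "drift_const s = ennreal c" "0 < c" and A: "0 < A"
    and Dq: "(\<integral>\<^sup>+u. ennreal ((1 - s / u) * exp (- (u - s)) * (s / u)) * indicator {s<..} u \<partial>lborel) + ennreal s * ennreal c = ennreal A"
  shows "q_inf j s = A * q_fun j s + c * p_fun j s"
proof -
  define D where "D = (\<integral>\<^sup>+u. ennreal ((1 - s / u) * exp (- (u - s)) * (s / u)) * indicator {s<..} u \<partial>lborel)"
  have q: "0 \<le> q_fun j s" "p_int j s = s * q_fun j s" "0 \<le> p_fun j s"
    using s by (simp_all add: q_fun_eq(1) p_int_nonneg p_fun_nonneg)
  have mj: "jump_int s j \<in> borel_measurable borel" "drift_int s j \<in> borel_measurable borel"
    unfolding jump_int_def[abs_def] drift_int_def[abs_def] by measurable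
  have "emeasure PPP_space {\<omega> \<in> space PPP_space. num (low_recs s (snd \<omega>) (pts (fst \<omega>))) j} =
    (\<integral>\<^sup>+w. emeasure config_space {\<omega>. num (low_recs s w (pts \<omega>)) j} * indicator {0..1} w \<partial>lborel)"
    by (rule emeasure_PPP[where Q = "\<lambda>\<omega> w. num (low_recs s w (pts \<omega>)) j"], rule pred_num_low_recs) auto
  also have "\<dots> = (\<integral>\<^sup>+w. (jump_int s j w * indicator {0..1} w + drift_int s j w * indicator {0..1} w) +
     (if j = 0 then ennreal (exp (- (w * s / (1 - w)))) * indicator {0..<1} w else 0) \<partial>lborel)"
  \<comment> \<open>The void probability has \<open>1 - w\<close> in a denominator, so the single
    point \<open>w = 1\<close> is set aside.\<close>
  proof (rule nn_integral_cong_AE, rule AE_mp[OF AE_lborel_singleton[of 1]], rule AE_I2, rule impI)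
    fix w :: real assume "w \<noteq> 1"
    then show "emeasure config_space {\<omega>. num (low_recs s w (pts \<omega>)) j} * indicator {0..1} w =
      (jump_int s j w * indicator {0..1} w + drift_int s j w * indicator {0..1} w) +
       (if j = 0 then ennreal (exp (- (w * s / (1 - w)))) * indicator {0..<1} w else 0)"
      using s by (cases "w \<in> {0..<1}") (auto simp: low_recs_split emeasure_no_early indicator_def)
  qed
  also have "\<dots> = (\<integral>\<^sup>+w. jump_int s j w * indicator {0..1} w \<partial>lborel) + (\<integral>\<^sup>+w. drift_int s j w * indicator {0..1} w \<partial>lborel) +
     (if j = 0 then drift_const s else 0)"
    using mj by (simp add: nn_integral_add drift_const_def)
  also have "\<dots> = ennreal (p_fun j s + p_int j s) * drift_const s + ennreal (q_fun j s) * D"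
  proof (cases "j = 0")
    case True
    have "jump_int s 0 w = 0" for w by (simp add: jump_int_def jump_term_def)
    then show ?thesis
      using True s nn_integral_drift_int[OF s, of 0] p_fun_0_plus_p_int[of s] by (simp add: D_def add.commute)
  next
    case False
    then show ?thesis using s nn_integral_drift_int[OF s, of j] nn_integral_jump_int[OF s False] by (simp add: D_def)
  qed
  \<comment> \<open>As \<open>p_int j s = s * q_fun j s\<close>, this term contributes
    \<open>s * c\<close> to the coefficient of \<open>q_fun j s\<close>; with \<open>D\<close> from
    the drift part it adds up to \<open>A\<close> by \<open>Dq\<close>.\<close>
  also have "ennreal (p_fun j s + p_int j s) * drift_const s = ennreal c * ennreal (p_fun j s) + ennreal (q_fun j s) * (ennreal s * ennreal c)"
    using q c s by (simp add: ennreal_mult[symmetric] ennreal_plus[symmetric] algebra_simps del: ennreal_plus)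
  also have "\<dots> + ennreal (q_fun j s) * D = ennreal c * ennreal (p_fun j s) + ennreal (q_fun j s) * (D + ennreal s * ennreal c)"
    by (simp add: distrib_left add_ac)
  also have "\<dots> = ennreal (A * q_fun j s + c * p_fun j s)"
    unfolding D_def Dq using q c A by (simp add: ennreal_mult[symmetric] ennreal_plus[symmetric] algebra_simps del: ennreal_plus)
  finally show ?thesis
    using q c A by (simp add: q_inf_def records_eq_recs W_of_def low_recs_def num_def conj_assoc measure_def del: ennreal_plus)
qed

lemma p_inf_eq:
  assumes s: "0 < s" and j: "j \<noteq> 0" and A: "jump_const s = ennreal A" "0 < A" and c: "0 < c"
    and Dp: "(\<integral>\<^sup>+u. ennreal ((1 - s / u) * exp (- (u - s))) * indicator {s<..} u \<partial>lborel) = ennreal c"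
  shows "p_inf j s = A * q_fun (j - 1) s + c * p_fun j s"
proof -
  have q: "0 \<le> q_fun (j - 1) s" "0 \<le> p_fun j s"
    using s by (simp_all add: q_fun_eq(1) p_int_nonneg p_fun_nonneg)
  define R where "R X = {a \<in> recs X. box_area a \<le> s}" for X
  \<comment> \<open>Generic atoms have \<open>fst a < 1\<close>, so a line at 1 excludes none of
    them.\<close>
  have R_eq: "R X = low_recs s 1 X" if "generic X" for X
    using generic_mem[OF that] by (auto simp: R_def low_recs_def recs_def)
  have R_mem: "R X = {a \<in> X. (\<not> (\<exists>b\<in>X. fst b < fst a \<and> snd b > snd a)) \<and> (1 - fst a) * \<bar>snd a\<bar> \<le> s}" for X
    by (auto simp: R_def recs_def box_area_def)
  have PR: "Measurable.pred M (\<lambda>x. num (R (pts (f x))) j)" if f: "f \<in> measurable M config_space" for f and M :: "'m measure"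
  proof -
    have [measurable]: "(\<lambda>x. fst (snd (f x) n)) \<in> borel_measurable M" "(\<lambda>x. snd (snd (f x) n)) \<in> borel_measurable M" for n
      using f by (intro borel_measurable_fst_snd_real measurable_point; simp)+
    show ?thesis
      unfolding R_mem using f by simp
  qed
  have "emeasure PPP_space {\<omega> \<in> space PPP_space. num (R (pts (fst \<omega>))) j} =
    (\<integral>\<^sup>+w. emeasure config_space {\<omega>. num (R (pts \<omega>)) j} * indicator {0..1::real} w \<partial>lborel)"
    by (rule emeasure_PPP[where Q = "\<lambda>\<omega> w. num (R (pts \<omega>)) j"], rule PR) auto
  also have "\<dots> = emeasure config_space {\<omega>. num (R (pts \<omega>)) j}"
    by (subst nn_integral_cmult_indicator) auto
  also have "\<dots> = emeasure config_space {\<omega>. num (low_recs s 1 (pts \<omega>)) j}"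
  proof (rule emeasure_eq_AE)
    show "AE \<omega> in config_space. \<omega> \<in> {\<omega>. num (R (pts \<omega>)) j} \<longleftrightarrow> \<omega> \<in> {\<omega>. num (low_recs s 1 (pts \<omega>)) j}"
      using AE_generic by eventually_elim (auto simp: R_eq)
    show "{\<omega>. num (R (pts \<omega>)) j} \<in> sets config_space"
      using PR[of "\<lambda>x. x" config_space] by (simp add: pred_def)
    show "{\<omega>. num (low_recs s 1 (pts \<omega>)) j} \<in> sets config_space"
      using pred_num_low_recs[of "\<lambda>x. x" config_space "\<lambda>_. 1" s j] by (simp add: pred_def)
  qed
  also have "\<dots> = ennreal (q_fun (j - 1) s) * ennreal A + ennreal (p_fun j s) * ennreal c"
    using j by (simp add: low_recs_split[OF s] jump_int_1[OF s j] drift_int_1[OF s, unfolded Dp] A)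
  also have "\<dots> = ennreal (A * q_fun (j - 1) s + c * p_fun j s)"
    using q c A by (simp add: ennreal_mult[symmetric] ennreal_plus[symmetric] algebra_simps del: ennreal_plus)
  finally show ?thesis
    using q c A by (simp add: p_inf_def records_eq_recs R_def num_def measure_def del: ennreal_plus)
qed

theorem theorem5:
  fixes s :: real
  assumes "s > 0"
  shows "(\<forall>j::nat. j \<ge> 1 \<longrightarrow> (q_inf j s = p_inf j s \<longleftrightarrow> q_fun (j - 1) s = q_fun j s))
       \<and> (\<forall>j::nat. q_inf j s = p_inf (Suc j) s \<longleftrightarrow> p_fun j s = p_fun (Suc j) s)"
proof -
  obtain c A where *: "0 < c" "0 < A" "drift_const s = ennreal c" "jump_const s = ennreal A"
    "(\<integral>\<^sup>+u. ennreal ((1 - s / u) * exp (- (u - s))) * indicator {s<..} u \<partial>lborel) = ennreal c"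
    "(\<integral>\<^sup>+u. ennreal ((1 - s / u) * exp (- (u - s)) * (s / u)) * indicator {s<..} u \<partial>lborel) + ennreal s * ennreal c = ennreal A"
    using entry_constants[OF assms] by blast
  have q: "q_inf j s = A * q_fun j s + c * p_fun j s" for j
    by (rule q_inf_eq[OF assms *(3) *(1) *(2) *(6)])
  have p: "p_inf j s = A * q_fun (j - 1) s + c * p_fun j s" if "j \<noteq> 0" for j
    by (rule p_inf_eq[OF assms that *(4) *(2) *(1) *(5)])
  \<comment> \<open>Subtracting the formulas leaves \<open>A * (q_fun j s - q_fun (j - 1) s)\<close>
    in the first equivalence and \<open>c * (p_fun j s - p_fun (Suc j) s)\<close> in the
    second.\<close>
  show ?thesis
    using *(1,2) by (auto simp: q p)
qed

end
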